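(* For all integers $d,n\ge 1$ there is an algorithm which, on input $(d,n)$, constructs an orthonormal Schur basis $\{|(\lambda,i,j)\rangle : \lambda\vdash_d n,\ 0\le i<\dim\mathcal Q_\lambda,\ 0\le j<\dim\mathcal P_\lambda\}$ of $(\mathbb C^d)^{\otimes n}$ such that for each $(\lambda,i,j)$ there is a standard basis vector $|v\rangle$ of $(\mathbb C^d)^{\otimes n}$ with $|(\lambda,i,j)\rangle\in\operatorname{span}\{P_\pi|v\rangle : \pi\in S_n\}$.
   Context: The standard basis of $(\mathbb C^d)^{\otimes n}$ is $|e\rangle=|e_1,\dots,e_n\rangle$, $e\in[d]^n$. For $\pi\in S_n$, $P_\pi=\sum_{i_1,\dots,i_n\in[d]}|i_{\pi^{-1}(1)},\dots,i_{\pi^{-1}(n)}\rangle\langle i_1,\dots,i_n|$. The groups $S_n$ and $U(d)$ act on $(\mathbb C^d)^{\otimes n}$ by $\pi\mapsto P_\pi$ and $U\mapsto U^{\otimes n}$. $\lambda\vdash_d n$ means $\lambda$ is a partition of $n$ into at most $d$ parts. $\mathcal Q_\lambda$ and $\mathcal P_\lambda$ denote the irreducible representations of $U(d)$ and $S_n$ labelled by $\lambda$ (those appearing in Schur–Weyl duality), and $\Pi_\lambda$ denotes the $\lambda$-isotypic component, so that $(\mathbb C^d)^{\otimes n}=\bigoplus_{\lambda\vdash_d n}\Pi_\lambda$ orthogonally and $\dim\Pi_\lambda=\dim\mathcal Q_\lambda\cdot\dim\mathcal P_\lambda$. A Schur basis is a family of vectors $|(\lambda,i,j)\rangle$ with $\lambda\vdash_d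 n$, $0\le i<\dim\mathcal Q_\lambda$, $0\le j<\dim\mathcal P_\lambda$ such that: for all $\lambda$, $\Pi_\lambda=\operatorname{span}\{|(\lambda,i,j)\rangle:\forall i,j\}$; for all $\lambda,j$, $\operatorname{span}\{|(\lambda,i,j)\rangle:\forall i\}$ is a $U(d)$-subrepresentation isomorphic to $\mathcal Q_\lambda$; for all $\lambda,i$, $\operatorname{span}\{|(\lambda,i,j)\rangle:\forall j\}$ is an $S_n$-subrepresentation isomorphic to $\mathcal P_\lambda$. *)

theory Defs
  imports
    Complex_Main
    "HOL-Library.Function_Algebras"
    "HOL-Library.Nat_Bijection"
    "HOL-Combinatorics.Permutations"
    "HOL-Computational_Algebra.Polynomial"
    "Jordan_Normal_Form.Schur_Decomposition"
begin

definition cscale :: "complex \<Rightarrow> ('a \<Rightarrow> complex) \<Rightarrow> 'a \<Rightarrow> complex" where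
  "cscale c f = (\<lambda>a. c * f a)"

interpretation cfun: vector_space cscale
  by unfold_locales (auto simp: cscale_def fun_eq_iff algebra_simps)

text \<open>
  A representation of a group on a subspace is given by the set of group elements and the map
  sending a group element to the operator by which it acts.
\<close>

definition subrep :: "'g set \<Rightarrow> ('g \<Rightarrow> ('a \<Rightarrow> complex) \<Rightarrow> 'a \<Rightarrow> complex) \<Rightarrow>
    ('a \<Rightarrow> complex) set \<Rightarrow> ('a \<Rightarrow> complex) set \<Rightarrow> bool" where
  "subrep G \<rho> V W \<longleftrightarrow>
     cfun.subspace W \<and> W \<subseteq> V \<and> (\<forall>g\<in>G. \<forall>x\<in>W. \<rho> g x \<in> W)"

definition rep_iso :: "'g set \<Rightarrow> ('g \<Rightarrow> ('a \<Rightarrow> complex) \<Rightarrow> 'a \<Rightarrow> complex) \<Rightarrow> ('a \<Rightarrow> complex) set \<Rightarrow>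
    ('g \<Rightarrow> ('b \<Rightarrow> complex) \<Rightarrow> 'b \<Rightarrow> complex) \<Rightarrow> ('b \<Rightarrow> complex) set \<Rightarrow> bool" where
  "rep_iso G \<rho> V \<sigma> W \<longleftrightarrow>
     (\<exists>\<phi>. bij_betw \<phi> V W \<and>
        (\<forall>x\<in>V. \<forall>y\<in>V. \<phi> (x + y) = \<phi> x + \<phi> y) \<and>
        (\<forall>c. \<forall>x\<in>V. \<phi> (cscale c x) = cscale c (\<phi> x)) \<and>
        (\<forall>g\<in>G. \<forall>x\<in>V. \<phi> (\<rho> g x) = \<sigma> g (\<phi> x)))"

text \<open>
  Tensor positions and the letters of \<open>[d]\<close> are numbered from 0. A vector of the \<open>n\<close>-th tensor
  power of \<open>\<complex>\<^sup>d\<close> is its coefficient function on words, extended by zero.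
\<close>

type_synonym tensor = "nat list \<Rightarrow> complex"

definition words :: "nat \<Rightarrow> nat \<Rightarrow> nat list set" where
  "words d n = {e. length e = n \<and> set e \<subseteq> {..<d}}"

definition tensor_space :: "nat \<Rightarrow> nat \<Rightarrow> tensor set" where
  "tensor_space d n = {x. \<forall>e. e \<notin> words d n \<longrightarrow> x e = 0}"

definition ket :: "nat list \<Rightarrow> tensor" where
  "ket e = (\<lambda>a. if a = e then 1 else 0)"

definition tinner :: "nat \<Rightarrow> nat \<Rightarrow> tensor \<Rightarrow> tensor \<Rightarrow> complex" where
  "tinner d n x y = (\<Sum>e\<in>words d n. cnj (x e) * y e)"

definition symgrp :: "nat \<Rightarrow> (nat \<Rightarrow> nat) set" where
  "symgrp n = {\<pi>. \<pi> permutes {..<n}}"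

definition perm_op :: "nat \<Rightarrow> nat \<Rightarrow> (nat \<Rightarrow> nat) \<Rightarrow> tensor \<Rightarrow> tensor" where
  "perm_op d n \<pi> x =
     (\<Sum>e\<in>words d n. cscale (x e) (ket (map (\<lambda>k. e ! (inv_into UNIV \<pi> k)) [0..<n])))"

definition unitary_grp :: "nat \<Rightarrow> complex mat set" where
  "unitary_grp d = {U \<in> carrier_mat d d. U * mat_adjoint U = 1\<^sub>m d}"

definition tensor_pow_op :: "nat \<Rightarrow> nat \<Rightarrow> complex mat \<Rightarrow> tensor \<Rightarrow> tensor" where
  "tensor_pow_op d n U x =
     (\<lambda>a. if a \<in> words d n then \<Sum>e\<in>words d n. (\<Prod>k<n. U $$ (a ! k, e ! k)) * x e else 0)"

definition partitions_upto :: "nat \<Rightarrow> nat \<Rightarrow> nat list set" where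
  "partitions_upto d n =
     {l. sorted_wrt (\<ge>) l \<and> 0 \<notin> set l \<and> sum_list l = n \<and> length l \<le> d}"

text \<open>
  Row and column of \<open>k\<close> in the tableau of shape \<open>l\<close> whose cells are filled with \<open>0, 1, 2, \<dots>\<close>
  in reading order.
\<close>

definition row_of :: "nat list \<Rightarrow> nat \<Rightarrow> nat" where
  "row_of l k = (LEAST r. k < sum_list (take (Suc r) l))"

definition col_of :: "nat list \<Rightarrow> nat \<Rightarrow> nat" where
  "col_of l k = k - sum_list (take (row_of l k) l)"

definition row_group :: "nat \<Rightarrow> nat list \<Rightarrow> (nat \<Rightarrow> nat) set" where
  "row_group n l = {\<pi> \<in> symgrp n. \<forall>k<n. row_of l (\<pi> k) = row_of l k}"

definition col_group :: "nat \<Rightarrow> nat list \<Rightarrow> (nat \<Rightarrow> nat) set" where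
  "col_group n l = {\<pi> \<in> symgrp n. \<forall>k<n. col_of l (\<pi> k) = col_of l k}"

text \<open>
  Elements of the group algebra of the symmetric group are coefficient functions on permutations.
  The Young symmetrizer is the row symmetrizer times the column antisymmetrizer.
\<close>

definition young_symmetrizer :: "nat \<Rightarrow> nat list \<Rightarrow> (nat \<Rightarrow> nat) \<Rightarrow> complex" where
  "young_symmetrizer n l =
     (\<lambda>\<sigma>. \<Sum>(p, q) \<in> row_group n l \<times> col_group n l.
        if \<sigma> = p \<circ> q then of_int (sign q) else 0)"

definition regular_op :: "(nat \<Rightarrow> nat) \<Rightarrow> ((nat \<Rightarrow> nat) \<Rightarrow> complex) \<Rightarrow> (nat \<Rightarrow> nat) \<Rightarrow> complex" where
  "regular_op \<pi> f = (\<lambda>\<sigma>. f (inv_into UNIV \<pi> \<circ> \<sigma>))"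

definition algebra_op :: "nat \<Rightarrow> nat \<Rightarrow> ((nat \<Rightarrow> nat) \<Rightarrow> complex) \<Rightarrow> tensor \<Rightarrow> tensor" where
  "algebra_op d n f x = (\<Sum>\<pi>\<in>symgrp n. cscale (f \<pi>) (perm_op d n \<pi> x))"

text \<open>
  \<open>P_irrep\<close>: the left ideal of the group algebra generated by the Young symmetrizer (Specht module),
  with the action \<open>regular_op\<close>. \<open>Q_irrep\<close>: the image of the Young symmetrizer on the tensor power
  (Weyl module of highest weight \<open>l\<close>), with the action \<open>tensor_pow_op d n\<close>.
\<close>

definition P_irrep :: "nat \<Rightarrow> nat list \<Rightarrow> ((nat \<Rightarrow> nat) \<Rightarrow> complex) set" where
  "P_irrep n l = cfun.span ((\<lambda>\<pi>. regular_op \<pi> (young_symmetrizer n l)) ` symgrp n)"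

definition Q_irrep :: "nat \<Rightarrow> nat \<Rightarrow> nat list \<Rightarrow> tensor set" where
  "Q_irrep d n l = algebra_op d n (young_symmetrizer n l) ` tensor_space d n"

text \<open>
  The isotypic component is the sum of all subrepresentations of the symmetric group isomorphic to
  the irreducible one; by Schur-Weyl duality it is also the isotypic component for the unitary group.
\<close>

definition isotypic :: "nat \<Rightarrow> nat \<Rightarrow> nat list \<Rightarrow> tensor set" where
  "isotypic d n l =
     cfun.span (\<Union>{W. subrep (symgrp n) (perm_op d n) (tensor_space d n) W \<and>
                      rep_iso (symgrp n) (perm_op d n) W regular_op (P_irrep n l)})"

definition schur_labels :: "nat \<Rightarrow> nat \<Rightarrow> (nat list \<times> nat \<times> nat) set" where
  "schur_labels d n =
     {(l, i, j). l \<in> partitions_upto d n \<and> i < cfun.dim (Q_irrep d n l) \<and> j < cfun.dim (P_irrep n l)}"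

definition schur_basis :: "nat \<Rightarrow> nat \<Rightarrow> (nat list \<times> nat \<times> nat \<Rightarrow> tensor) \<Rightarrow> bool" where
  "schur_basis d n B \<longleftrightarrow>
     (\<forall>l\<in>partitions_upto d n.
        isotypic d n l =
          cfun.span {B (l, i, j) | i j. i < cfun.dim (Q_irrep d n l) \<and> j < cfun.dim (P_irrep n l)}) \<and>
     (\<forall>l\<in>partitions_upto d n. \<forall>j<cfun.dim (P_irrep n l).
        let W = cfun.span {B (l, i, j) | i. i < cfun.dim (Q_irrep d n l)} in
          subrep (unitary_grp d) (tensor_pow_op d n) (tensor_space d n) W \<and>
          rep_iso (unitary_grp d) (tensor_pow_op d n) W (tensor_pow_op d n) (Q_irrep d n l)) \<and>
     (\<forall>l\<in>partitions_upto d n. \<forall>i<cfun.dim (Q_irrep d n l).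
        let W = cfun.span {B (l, i, j) | j. j < cfun.dim (P_irrep n l)} in
          subrep (symgrp n) (perm_op d n) (tensor_space d n) W \<and>
          rep_iso (symgrp n) (perm_op d n) W regular_op (P_irrep n l))"

definition orthonormal_basis :: "nat \<Rightarrow> nat \<Rightarrow> 'i set \<Rightarrow> ('i \<Rightarrow> tensor) \<Rightarrow> bool" where
  "orthonormal_basis d n I B \<longleftrightarrow>
     (\<forall>s\<in>I. B s \<in> tensor_space d n) \<and>
     (\<forall>s\<in>I. \<forall>t\<in>I. tinner d n (B s) (B t) = (if s = t then 1 else 0)) \<and>
     cfun.span (B ` I) = tensor_space d n"

text \<open>
  Algorithms are terms for partial (mu-)recursive functions; \<open>computes A xs y\<close> says that \<open>A\<close> halts
  on input \<open>xs\<close> with output \<open>y\<close>.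
\<close>

datatype recf = Zero | Succ | Proj nat | Comp recf "recf list" | PrimRec recf recf | Mu recf

inductive computes :: "recf \<Rightarrow> nat list \<Rightarrow> nat \<Rightarrow> bool" where
  zero: "computes Zero xs 0"
| succ: "computes Succ [x] (Suc x)"
| proj: "i < length xs \<Longrightarrow> computes (Proj i) xs (xs ! i)"
| comp: "list_all2 (\<lambda>g y. computes g xs y) gs ys \<Longrightarrow> computes f ys z \<Longrightarrow> computes (Comp f gs) xs z"
| prim_0: "computes f xs y \<Longrightarrow> computes (PrimRec f g) (0 # xs) y"
| prim_Suc: "computes (PrimRec f g) (k # xs) r \<Longrightarrow> computes g (k # r # xs) y \<Longrightarrow>
    computes (PrimRec f g) (Suc k # xs) y"
| mu: "computes f (y # xs) 0 \<Longrightarrow> (\<forall>z<y. \<exists>v>0. computes f (z # xs) v) \<Longrightarrow> computes (Mu f) xs y"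

inductive_cases computes_elims:
  "computes Zero xs y" "computes Succ xs y" "computes (Proj i) xs y" "computes (Comp f gs) xs y"
  "computes (PrimRec f g) (0 # xs) y" "computes (PrimRec f g) (Suc k # xs) y" "computes (Mu f) xs y"

lemma computes_deterministic: "computes f xs y \<Longrightarrow> computes f xs y' \<Longrightarrow> y = y'"
proof (induction arbitrary: y' rule: computes.induct)
  case (zero xs)
  then show ?case by (rule computes_elims(1)) simp
next
  case (succ x)
  then show ?case by (rule computes_elims(2)) simp
next
  case (proj i xs)
  from proj.prems show ?case by (rule computes_elims(3)) simp
next
  case (comp xs gs ys f z)
  obtain ys' where
    ys': "list_all2 (\<lambda>g y. computes g xs y) gs ys'" and z': "computes f ys' y'"
    by (rule computes_elims(4)[OF comp.prems])
  have len: "length ys = length ys'"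
    using list_all2_lengthD[OF comp.IH(1)] list_all2_lengthD[OF ys'] by linarith
  have "ys ! k = ys' ! k" if "k < length ys" for k
  proof -
    have "computes (gs ! k) xs (ys' ! k)"
      using that len by (intro list_all2_nthD2[OF ys']) simp
    with list_all2_nthD2[OF comp.IH(1) that] show ?thesis by blast
  qed
  with len have "ys = ys'" by (rule nth_equalityI)
  with z' have "computes f ys y'" by simp
  then show ?case by (rule comp.IH(2))
next
  case (prim_0 f xs y g)
  from prim_0.prems show ?case by (rule computes_elims(5)) (rule prim_0.IH)
next
  case (prim_Suc f g k xs r y)
  obtain r' where
    "computes (PrimRec f g) (k # xs) r'" "computes g (k # r' # xs) y'"
    by (rule computes_elims(6)[OF prim_Suc.prems])
  then show ?case using prim_Suc.IH by metis
next
  case (mu f y xs)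
  have y': "computes f (y' # xs) 0" "\<forall>z<y'. \<exists>v>0. computes f (z # xs) v"
    by (rule computes_elims(7)[OF mu.prems], assumption)+
  show ?case
  proof (rule linorder_cases[of y y'])
    assume "y < y'"
    then obtain v where "v > 0" "computes f (y # xs) v" using y'(2) by metis
    then show ?thesis using mu.IH(1) by force
  next
    assume "y' < y"
    then obtain v where "v > 0" "\<forall>w. computes f (y' # xs) w \<longrightarrow> v = w" using mu.IH(2) by metis
    then show ?thesis using y'(1) by force
  qed
qed

text \<open>
  Exact code of an algebraic number: the coefficients (constant term first) of a nonzero integer
  polynomial, and a disk with centre \<open>(a + b\<i>) / m\<close> and radius \<open>r / m\<close> in which the number is
  the only root.
\<close>

definition algebraic_code :: "nat \<Rightarrow> complex \<Rightarrow> bool" where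
  "algebraic_code c z \<longleftrightarrow>
     (\<exists>cs a b r m. c = list_encode [list_encode (map int_encode cs), int_encode a, int_encode b, r, m] \<and>
        Poly cs \<noteq> 0 \<and> m > 0 \<and>
        {x :: complex. poly (map_poly of_int (Poly cs)) x = 0 \<and>
           cmod (x - Complex (of_int a / of_nat m) (of_int b / of_nat m)) < of_nat r / of_nat m} = {z})"

text \<open>
  The family is output as a table: one row for each label \<open>(l, i, j)\<close> and each word \<open>e\<close>, consisting
  of the label, the word and a code of the coefficient of \<open>ket e\<close> in \<open>B (l, i, j)\<close>.
\<close>

fun row_encode :: "((nat list \<times> nat \<times> nat) \<times> nat list) \<times> nat \<Rightarrow> nat" where
  "row_encode (((l, i, j), e), c) = list_encode [list_encode l, i, j, list_encode e, c]"

definition encodes_family :: "nat \<Rightarrow> nat \<Rightarrow> nat \<Rightarrow> (nat list \<times> nat \<times> nat \<Rightarrow> tensor) \<Rightarrow> bool" where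
  "encodes_family d n out B \<longleftrightarrow>
     (\<exists>rows. out = list_encode (map row_encode rows) \<and>
        distinct (map fst rows) \<and>
        set (map fst rows) = schur_labels d n \<times> words d n \<and>
        (\<forall>((s, e), c) \<in> set rows. algebraic_code c (B s e)))"

end

theory Submission
  imports Defs "HOL-Combinatorics.Cycles"
begin

text \<open>
  For the Young symmetrizer \<open>c\<close> of shape \<open>l\<close>, the map \<open>w \<otimes> u \<mapsto> w u\<close> sends \<open>P_irrep n l \<otimes> Q_irrep d n l\<close>
  onto the isotypic component and multiplies inner products by a constant, because \<open>c\<^sup>* f c\<close> is a multiple of
  \<open>c\<^sup>* c\<close> for every \<open>f\<close>. So orthogonal bases of the two factors multiply to an orthogonal Schur basis.
  Both factors are spanned by integer vectors, those of \<open>Q_irrep d n l\<close> lying in single weight spaces; hence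
  Gram--Schmidt without normalization gives integer vectors, and the normalized coefficients have the form
  \<open>k / sqrt N\<close>. That the components exhaust the tensor power follows by counting: the symmetrized \<open>c\<close> are
  orthogonal class functions, and there are as many of them as cycle types.

  The algorithm searches for the least number that encodes integer vectors \<open>x\<close> and group algebra
  elements \<open>y\<close> for which the \<open>d ^ n\<close> vectors \<open>(y c) x\<close> are nonzero and pairwise orthogonal. This is
  decidable, and by the dimension count it already implies that the normalized vectors form a Schur basis.
\<close>

section \<open>The group algebra and its action\<close>

no_notation m_inv (\<open>(\<open>open_block notation=\<open>prefix inv\<close>\<close>inv\<index> _)\<close> [81] 80)

text \<open>Write \<open>c = a b\<close> with \<open>a\<close> the row symmetrizer and
  \<open>b\<close> the column antisymmetrizer; both are fixed by \<open>gstar\<close>, so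
  \<open>gstar n c = b a\<close>. All scalars come from one fact: \<open>a f b\<close> is a multiple
  of \<open>c\<close> for every \<open>f\<close>, because a permutation either is a row permutation
  times a column permutation or makes the product vanish. That these scalars are nonzero comes from
  positivity of the inner product on the group algebra. The obstacle on the computational side is
  that the labels range up to the dimensions of the irreducible representations, which the algorithm
  does not compute. The certificate therefore mentions no dimension. It claims \<open>d ^ n\<close>
  labels that form, for each shape, a rectangle starting at \<open>(0, 0)\<close>. Orthogonality
  bounds the sides of each rectangle by \<open>dim Q\<close> and \<open>dim P\<close>, and the
  products of these dimensions add up to \<open>d ^ n\<close>, so every bound is attained. Each
  check is an equation between integers; square roots enter only when the output codes are written.
  Even the sign of a permutation is guessed and then verified.\<close>

lemma fun_sum_apply: "(\<Sum>i\<in>I. f i) x = (\<Sum>i\<in>I. f i x)" for f :: "'i \<Rightarrow> 'a \<Rightarrow> complex"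
  by (induction I rule: infinite_finite_induct) auto

lemma cscale_apply [simp]: "cscale c f a = c * f a"
  by (simp add: cscale_def)

section \<open>The symmetric group as a set of functions on the naturals\<close>

lemma finite_symgrp [simp, intro]: "finite (symgrp n)"
  by (simp add: symgrp_def finite_permutations)

lemma symgrp_id [simp, intro]: "id \<in> symgrp n"
  by (simp add: symgrp_def permutes_id)

lemma symgrp_comp [simp, intro]: "\<pi> \<in> symgrp n \<Longrightarrow> \<sigma> \<in> symgrp n \<Longrightarrow> \<pi> \<circ> \<sigma> \<in> symgrp n"
  by (simp add: symgrp_def permutes_compose)

lemma symgrp_inv [simp, intro]: "\<pi> \<in> symgrp n \<Longrightarrow> inv \<pi> \<in> symgrp n"
  by (simp add: symgrp_def permutes_inv)

lemma symgrp_bij: "\<pi> \<in> symgrp n \<Longrightarrow> bij \<pi>"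
  by (auto simp: symgrp_def permutes_bij)

lemma symgrp_inv_inv [simp]: "\<pi> \<in> symgrp n \<Longrightarrow> inv (inv \<pi>) = \<pi>"
  by (simp add: symgrp_bij inv_inv_eq)

lemma symgrp_inv_o [simp]:
  assumes "\<pi> \<in> symgrp n"
  shows "inv \<pi> \<circ> \<pi> = id" "\<pi> \<circ> inv \<pi> = id" "inv \<pi> \<circ> (\<pi> \<circ> f) = f" "\<pi> \<circ> (inv \<pi> \<circ> f) = f"
    "inv \<pi> (\<pi> k) = k" "\<pi> (inv \<pi> k) = k"
  using assms permutes_inv_o[of \<pi> "{..<n}"] permutes_inverses[of \<pi> "{..<n}"]
  by (auto simp: symgrp_def fun_eq_iff)

lemma symgrp_inv_comp:
  "\<pi> \<in> symgrp n \<Longrightarrow> \<sigma> \<in> symgrp n \<Longrightarrow> inv (\<pi> \<circ> \<sigma>) = inv \<sigma> \<circ> inv \<pi>"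
  by (simp add: o_inv_distrib symgrp_bij)

lemma symgrp_less [simp]: "\<pi> \<in> symgrp n \<Longrightarrow> \<pi> k < n \<longleftrightarrow> k < n"
  unfolding symgrp_def using permutes_in_image[of \<pi> "{..<n}" k] by simp

lemma symgrp_inj: "\<pi> \<in> symgrp n \<Longrightarrow> \<pi> x = \<pi> y \<longleftrightarrow> x = y"
  by (metis symgrp_inv_o(5))

lemma symgrp_comp_iff [simp]: "\<pi> \<in> symgrp n \<Longrightarrow> \<pi> \<circ> \<sigma> \<in> symgrp n \<longleftrightarrow> \<sigma> \<in> symgrp n"
  by (metis symgrp_comp symgrp_inv symgrp_inv_o(3))

lemma symgrp_comp_iff' [simp]: "\<pi> \<in> symgrp n \<Longrightarrow> \<sigma> \<circ> \<pi> \<in> symgrp n \<longleftrightarrow> \<sigma> \<in> symgrp n"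
proof
  assume \<pi>: "\<pi> \<in> symgrp n" and "\<sigma> \<circ> \<pi> \<in> symgrp n"
  hence "(\<sigma> \<circ> \<pi>) \<circ> inv \<pi> \<in> symgrp n" using \<pi> by (blast intro: symgrp_comp[of "\<sigma> \<circ> \<pi>"])
  moreover have "(\<sigma> \<circ> \<pi>) \<circ> inv \<pi> = \<sigma>" using symgrp_inv_o(2)[OF \<pi>] by (simp add: comp_assoc)
  ultimately show "\<sigma> \<in> symgrp n" by (simp only:)
qed simp

lemma sum_symgrp_left:
  assumes "\<sigma> \<in> symgrp n"
  shows "(\<Sum>\<pi>\<in>symgrp n. f (\<sigma> \<circ> \<pi>)) = (\<Sum>\<pi>\<in>symgrp n. f \<pi>)"
  by (rule sum.reindex_bij_witness[where i = "\<lambda>\<pi>. inv \<sigma> \<circ> \<pi>" and j = "\<lambda>\<pi>. \<sigma> \<circ> \<pi>"])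
     (use assms in auto)

lemma sum_symgrp_inv: "(\<Sum>\<pi>\<in>symgrp n. f (inv \<pi>)) = (\<Sum>\<pi>\<in>symgrp n. f \<pi>)"
  by (rule sum.reindex_bij_witness[where i = inv and j = inv]) auto

text \<open>One form serves two spaces: \<open>I = words d n\<close> gives \<open>tinner\<close>,
  and \<open>I = symgrp n\<close> gives the inner product of the group algebra in which the
  permutations are orthonormal.\<close>

definition inner_on :: "'a set \<Rightarrow> ('a \<Rightarrow> complex) \<Rightarrow> ('a \<Rightarrow> complex) \<Rightarrow> complex" where
  "inner_on I x y = (\<Sum>e\<in>I. cnj (x e) * y e)"

lemma tinner_inner_on: "tinner d n = inner_on (words d n)"
  by (simp add: fun_eq_iff tinner_def inner_on_def)

lemma inner_on_cnj: "cnj (inner_on I x y) = inner_on I y x"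
  by (simp add: inner_on_def mult.commute)

lemma inner_on_linear:
  "inner_on I x (y + z) = inner_on I x y + inner_on I x z"
  "inner_on I x (y - z) = inner_on I x y - inner_on I x z"
  "inner_on I (x + y) z = inner_on I x z + inner_on I y z"
  "inner_on I (x - y) z = inner_on I x z - inner_on I y z"
  "inner_on I x (cscale c y) = c * inner_on I x y"
  "inner_on I (cscale c x) y = cnj c * inner_on I x y"
  "inner_on I x 0 = 0" "inner_on I 0 x = 0"
  by (simp_all add: inner_on_def algebra_simps sum.distrib sum_subtractf sum_distrib_left)

lemma inner_on_sum:
  "inner_on I x (\<Sum>j\<in>J. f j) = (\<Sum>j\<in>J. inner_on I x (f j))"
  "inner_on I (\<Sum>j\<in>J. f j) x = (\<Sum>j\<in>J. inner_on I (f j) x)"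
  by (induction J rule: infinite_finite_induct) (simp_all add: inner_on_linear)

lemma inner_on_self: "inner_on I x x = of_real (\<Sum>e\<in>I. (cmod (x e))\<^sup>2)"
  unfolding inner_on_def of_real_sum
  by (intro sum.cong refl) (metis mult.commute complex_norm_square of_real_power)

lemma inner_on_self_eq_0:
  assumes "finite I" "\<And>e. e \<notin> I \<Longrightarrow> x e = 0"
  shows "inner_on I x x = 0 \<longleftrightarrow> x = 0"
proof
  assume "inner_on I x x = 0"
  hence "(\<Sum>e\<in>I. (cmod (x e))\<^sup>2) = 0" unfolding inner_on_self using of_real_eq_0_iff by blast
  hence "\<forall>e\<in>I. (cmod (x e))\<^sup>2 = 0" by (subst (asm) sum_nonneg_eq_0_iff) (auto simp: assms)
  thus "x = 0" using assms(2) by (auto simp: fun_eq_iff)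
qed (simp add: inner_on_linear)

section \<open>The group algebra: convolution, point masses and involution\<close>

definition galg :: "nat \<Rightarrow> ((nat \<Rightarrow> nat) \<Rightarrow> complex) set" where
  "galg n = {f. \<forall>\<sigma>. \<sigma> \<notin> symgrp n \<longrightarrow> f \<sigma> = 0}"

definition conv :: "nat \<Rightarrow> ((nat \<Rightarrow> nat) \<Rightarrow> complex) \<Rightarrow> ((nat \<Rightarrow> nat) \<Rightarrow> complex) \<Rightarrow> (nat \<Rightarrow> nat) \<Rightarrow> complex"
  where "conv n f g = (\<lambda>\<sigma>. \<Sum>\<pi>\<in>symgrp n. f \<pi> * g (inv \<pi> \<circ> \<sigma>))"

definition gdelta :: "(nat \<Rightarrow> nat) \<Rightarrow> (nat \<Rightarrow> nat) \<Rightarrow> complex" where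
  "gdelta \<pi> = (\<lambda>\<sigma>. if \<sigma> = \<pi> then 1 else 0)"

text \<open>The guard is needed since \<open>inv \<sigma>\<close> may be a permutation even if \<open>\<sigma>\<close> is not.\<close>
definition gstar :: "nat \<Rightarrow> ((nat \<Rightarrow> nat) \<Rightarrow> complex) \<Rightarrow> (nat \<Rightarrow> nat) \<Rightarrow> complex" where
  "gstar n f = (\<lambda>\<sigma>. if \<sigma> \<in> symgrp n then cnj (f (inv \<sigma>)) else 0)"

lemma galg_closed [simp, intro]:
  "f \<in> galg n \<Longrightarrow> g \<in> galg n \<Longrightarrow> f + g \<in> galg n"
  "f \<in> galg n \<Longrightarrow> g \<in> galg n \<Longrightarrow> f - g \<in> galg n"
  "f \<in> galg n \<Longrightarrow> cscale c f \<in> galg n"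
  "0 \<in> galg n"
  "\<pi> \<in> symgrp n \<Longrightarrow> gdelta \<pi> \<in> galg n"
  "gstar n f \<in> galg n"
  by (auto simp: galg_def gdelta_def gstar_def)

lemma galg_sum: "(\<And>i. i \<in> I \<Longrightarrow> f i \<in> galg n) \<Longrightarrow> (\<Sum>i\<in>I. f i) \<in> galg n"
  by (induction I rule: infinite_finite_induct) auto

text \<open>The sum samples \<open>f\<close> on permutations only, and left multiplication by
  \<open>inv \<pi>\<close> keeps a non-permutation outside \<open>symgrp n\<close>; so it is the
  right factor that has to vanish there.\<close>

lemma conv_galg [simp, intro]: "g \<in> galg n \<Longrightarrow> conv n f g \<in> galg n"
  by (auto simp: galg_def conv_def intro!: sum.neutral)

lemma conv_linear:
  "conv n (f + g) h = conv n f h + conv n g h"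
  "conv n f (g + h) = conv n f g + conv n f h"
  "conv n (f - g) h = conv n f h - conv n g h"
  "conv n f (g - h) = conv n f g - conv n f h"
  "conv n (cscale c f) g = cscale c (conv n f g)"
  "conv n f (cscale c g) = cscale c (conv n f g)"
  "conv n 0 g = 0" "conv n f 0 = 0"
  by (simp_all add: conv_def fun_eq_iff algebra_simps sum.distrib sum_subtractf sum_distrib_left)

lemma conv_sum:
  "conv n (\<Sum>i\<in>I. f i) g = (\<Sum>i\<in>I. conv n (f i) g)"
  "conv n g (\<Sum>i\<in>I. f i) = (\<Sum>i\<in>I. conv n g (f i))"
  by (induction I rule: infinite_finite_induct) (simp_all add: conv_linear)

lemma conv_assoc: "conv n (conv n f g) h = conv n f (conv n g h)"
proof
  fix \<sigma>
  have "conv n (conv n f g) h \<sigma> =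
      (\<Sum>\<pi>\<in>symgrp n. \<Sum>\<rho>\<in>symgrp n. f \<rho> * g (inv \<rho> \<circ> \<pi>) * h (inv \<pi> \<circ> \<sigma>))"
    by (simp add: conv_def sum_distrib_right)
  also have "\<dots> = (\<Sum>\<rho>\<in>symgrp n. \<Sum>\<pi>\<in>symgrp n. f \<rho> * g (inv \<rho> \<circ> \<pi>) * h (inv \<pi> \<circ> \<sigma>))"
    by (rule sum.swap)
  also have "\<dots> = (\<Sum>\<rho>\<in>symgrp n. \<Sum>\<tau>\<in>symgrp n. f \<rho> * g (inv \<rho> \<circ> (\<rho> \<circ> \<tau>)) * h (inv (\<rho> \<circ> \<tau>) \<circ> \<sigma>))"
    by (intro sum.cong refl sum_symgrp_left[symmetric])
  also have "\<dots> = (\<Sum>\<rho>\<in>symgrp n. \<Sum>\<tau>\<in>symgrp n. f \<rho> * (g \<tau> * h (inv \<tau> \<circ> (inv \<rho> \<circ> \<sigma>))))"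
    by (intro sum.cong refl) (simp add: symgrp_inv_comp comp_assoc mult.assoc)
  also have "\<dots> = conv n f (conv n g h) \<sigma>"
    by (simp add: conv_def sum_distrib_left)
  finally show "conv n (conv n f g) h \<sigma> = conv n f (conv n g h) \<sigma>" .
qed

lemma conv_gdelta_left: "\<pi> \<in> symgrp n \<Longrightarrow> conv n (gdelta \<pi>) f = regular_op \<pi> f"
  by (rule ext) (simp add: conv_def gdelta_def regular_op_def if_distrib[of "\<lambda>x. x * _"] cong: if_cong)

text \<open>The equation is restricted to permutations because elsewhere the left side is 0, whereas
  \<open>f\<close> is arbitrary.\<close>

lemma conv_gdelta_right:
  assumes "\<pi> \<in> symgrp n" "\<sigma> \<in> symgrp n"
  shows "conv n f (gdelta \<pi>) \<sigma> = f (\<sigma> \<circ> inv \<pi>)"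
proof -
  have "inv \<rho> \<circ> \<sigma> = \<pi> \<longleftrightarrow> \<rho> = \<sigma> \<circ> inv \<pi>" if "\<rho> \<in> symgrp n" for \<rho>
  proof
    assume "inv \<rho> \<circ> \<sigma> = \<pi>"
    hence "\<sigma> = \<rho> \<circ> \<pi>" using that by (metis symgrp_inv_o(4))
    thus "\<rho> = \<sigma> \<circ> inv \<pi>" using assms by (simp add: comp_assoc)
  next
    assume "\<rho> = \<sigma> \<circ> inv \<pi>"
    thus "inv \<rho> \<circ> \<sigma> = \<pi>" using assms by (simp add: symgrp_inv_comp comp_assoc)
  qed
  hence "conv n f (gdelta \<pi>) \<sigma> = (\<Sum>\<rho>\<in>symgrp n. if \<rho> = \<sigma> \<circ> inv \<pi> then f \<rho> else 0)"
    unfolding conv_def gdelta_def by (intro sum.cong refl) auto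
  thus ?thesis using assms by simp
qed

lemma conv_id [simp]:
  "conv n (gdelta id) f = f"
  "f \<in> galg n \<Longrightarrow> conv n f (gdelta id) = f"
proof -
  show "conv n (gdelta id) f = f" by (simp add: conv_gdelta_left regular_op_def)
  assume f: "f \<in> galg n"
  show "conv n f (gdelta id) = f"
  proof
    fix \<sigma> show "conv n f (gdelta id) \<sigma> = f \<sigma>"
    proof (cases "\<sigma> \<in> symgrp n")
      case True thus ?thesis by (simp add: conv_gdelta_right)
    next
      case False
      have "conv n f (gdelta id) \<in> galg n" by simp
      thus ?thesis using f False by (simp add: galg_def)
    qed
  qed
qed

lemma conv_gdelta_gdelta:
  "\<pi> \<in> symgrp n \<Longrightarrow> \<sigma> \<in> symgrp n \<Longrightarrow> conv n (gdelta \<pi>) (gdelta \<sigma>) = gdelta (\<pi> \<circ> \<sigma>)"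
proof
  fix \<tau> assume "\<pi> \<in> symgrp n" "\<sigma> \<in> symgrp n"
  moreover from this have "inv \<pi> \<circ> \<tau> = \<sigma> \<longleftrightarrow> \<tau> = \<pi> \<circ> \<sigma>" by (metis symgrp_inv_o(3,4))
  ultimately show "conv n (gdelta \<pi>) (gdelta \<sigma>) \<tau> = gdelta (\<pi> \<circ> \<sigma>) \<tau>"
    by (simp add: conv_gdelta_left) (simp add: regular_op_def gdelta_def)
qed

lemma galg_expand: "f \<in> galg n \<Longrightarrow> f = (\<Sum>\<pi>\<in>symgrp n. cscale (f \<pi>) (gdelta \<pi>))"
  by (rule ext) (auto simp: galg_def gdelta_def fun_sum_apply if_distrib[of "\<lambda>x. _ * x"] cong: if_cong)

lemma gstar_gstar [simp]: "f \<in> galg n \<Longrightarrow> gstar n (gstar n f) = f"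
  by (auto simp: gstar_def galg_def fun_eq_iff)

lemma gstar_linear:
  "gstar n (f + g) = gstar n f + gstar n g"
  "gstar n (cscale c f) = cscale (cnj c) (gstar n f)"
  "gstar n 0 = 0"
  by (auto simp: gstar_def fun_eq_iff)

lemma gstar_sum: "gstar n (\<Sum>i\<in>I. f i) = (\<Sum>i\<in>I. gstar n (f i))"
  by (induction I rule: infinite_finite_induct) (simp_all only: not_False_eq_True sum.infinite sum.empty sum.insert gstar_linear)

lemma gstar_gdelta: "\<pi> \<in> symgrp n \<Longrightarrow> gstar n (gdelta \<pi>) = gdelta (inv \<pi>)"
proof
  fix \<sigma> assume "\<pi> \<in> symgrp n"
  thus "gstar n (gdelta \<pi>) \<sigma> = gdelta (inv \<pi>) \<sigma>" by (auto simp: gstar_def gdelta_def)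
qed

lemma gstar_conv:
  assumes "g \<in> galg n"
  shows "gstar n (conv n f g) = conv n (gstar n g) (gstar n f)"
proof
  fix \<sigma>
  show "gstar n (conv n f g) \<sigma> = conv n (gstar n g) (gstar n f) \<sigma>"
  proof (cases "\<sigma> \<in> symgrp n")
    case False
    have "conv n (gstar n g) (gstar n f) \<in> galg n" by simp
    with False show ?thesis by (simp add: galg_def gstar_def)
  next
    case True
    have "conv n (gstar n g) (gstar n f) \<sigma> =
        (\<Sum>\<pi>\<in>symgrp n. cnj (g (inv \<pi>)) * cnj (f (inv (inv \<pi> \<circ> \<sigma>))))"
      unfolding conv_def by (intro sum.cong refl) (simp add: gstar_def True)
    \<comment> \<open>Replacing \<open>\<pi>\<close> by \<open>\<sigma> \<circ> \<pi>\<close> turns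
      the argument of \<open>f\<close> into \<open>\<pi>\<close> itself, which is the summation
      variable on the other side.\<close>
    also have "\<dots> = (\<Sum>\<pi>\<in>symgrp n. cnj (g (inv (\<sigma> \<circ> \<pi>))) * cnj (f (inv (inv (\<sigma> \<circ> \<pi>) \<circ> \<sigma>))))"
      using sum_symgrp_left[OF True, of "\<lambda>\<pi>. cnj (g (inv \<pi>)) * cnj (f (inv (inv \<pi> \<circ> \<sigma>)))"] by simp
    also have "\<dots> = (\<Sum>\<pi>\<in>symgrp n. cnj (g (inv \<pi> \<circ> inv \<sigma>)) * cnj (f \<pi>))"
    proof (intro sum.cong refl)
      fix \<pi> assume \<pi>: "\<pi> \<in> symgrp n"
      have "inv (\<sigma> \<circ> \<pi>) \<circ> \<sigma> = inv \<pi>"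
        using True \<pi> by (simp add: symgrp_inv_comp comp_assoc)
      thus "cnj (g (inv (\<sigma> \<circ> \<pi>))) * cnj (f (inv (inv (\<sigma> \<circ> \<pi>) \<circ> \<sigma>))) =
          cnj (g (inv \<pi> \<circ> inv \<sigma>)) * cnj (f \<pi>)"
        using True \<pi> by (simp only: symgrp_inv_inv) (simp add: symgrp_inv_comp)
    qed
    also have "\<dots> = gstar n (conv n f g) \<sigma>"
      by (simp add: gstar_def True conv_def mult.commute)
    finally show ?thesis ..
  qed
qed

text \<open>The bridge between products and inner products: any identity for
  \<open>conv n (gstar n f) g\<close> yields one for the inner product by reading off the
  coefficient at \<open>id\<close>.\<close>

lemma conv_gstar_id: "conv n (gstar n f) g id = inner_on (symgrp n) f g"
proof -
  have "conv n (gstar n f) g id = (\<Sum>\<pi>\<in>symgrp n. cnj (f (inv \<pi>)) * g (inv \<pi>))"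
    by (simp add: conv_def gstar_def)
  also have "\<dots> = inner_on (symgrp n) f g"
    unfolding inner_on_def by (rule sum_symgrp_inv)
  finally show ?thesis .
qed

lemma galg_inner_eq_0: "f \<in> galg n \<Longrightarrow> inner_on (symgrp n) f f = 0 \<longleftrightarrow> f = 0"
  by (rule inner_on_self_eq_0) (auto simp: galg_def)

text \<open>Positivity of the involution. It is what shows later that the square of a Young
  symmetrizer does not vanish.\<close>

lemma conv_gstar_eq_0: "f \<in> galg n \<Longrightarrow> conv n (gstar n f) f = 0 \<Longrightarrow> f = 0"
  by (metis conv_gstar_id galg_inner_eq_0 zero_fun_apply)

section \<open>Words and the action of permutations on tensors\<close>

definition wact :: "nat \<Rightarrow> (nat \<Rightarrow> nat) \<Rightarrow> nat list \<Rightarrow> nat list" where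
  "wact n \<pi> e = map (\<lambda>k. e ! \<pi> k) [0..<n]"

lemma finite_words [simp, intro]: "finite (words d n)"
proof -
  have "words d n = {e. set e \<subseteq> {..<d} \<and> length e = n}" by (auto simp: words_def)
  thus ?thesis by (simp add: finite_lists_length_eq)
qed

lemma card_words: "card (words d n) = d ^ n"
proof -
  have "words d n = {e. set e \<subseteq> {..<d} \<and> length e = n}" by (auto simp: words_def)
  thus ?thesis by (simp add: card_lists_length_eq)
qed

lemma length_wact [simp]: "length (wact n \<pi> e) = n"
  by (simp add: wact_def)

lemma wact_nth [simp]: "k < n \<Longrightarrow> wact n \<pi> e ! k = e ! \<pi> k"
  by (simp add: wact_def)

lemma wact_words [simp, intro]: "\<pi> \<in> symgrp n \<Longrightarrow> e \<in> words d n \<Longrightarrow> wact n \<pi> e \<in> words d n"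
  by (auto simp: words_def wact_def subset_iff)

text \<open>Precomposition of words is a right action, so the order of composition is reversed;
  \<open>perm_op\<close> pulls back along it and thereby becomes a left action.\<close>

lemma wact_comp: "\<sigma> \<in> symgrp n \<Longrightarrow> wact n \<sigma> (wact n \<pi> e) = wact n (\<pi> \<circ> \<sigma>) e"
  by (rule nth_equalityI) auto

lemma wact_id [simp]: "e \<in> words d n \<Longrightarrow> wact n id e = e"
  by (rule nth_equalityI) (auto simp: words_def)

lemma wact_inv [simp]:
  assumes "\<pi> \<in> symgrp n" "e \<in> words d n"
  shows "wact n \<pi> (wact n (inv \<pi>) e) = e" "wact n (inv \<pi>) (wact n \<pi> e) = e"
  using assms by (auto simp: wact_comp)

lemma bij_betw_wact: "\<pi> \<in> symgrp n \<Longrightarrow> bij_betw (wact n \<pi>) (words d n) (words d n)"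
  by (rule bij_betw_byWitness[where f' = "wact n (inv \<pi>)"]) auto

lemma sum_words_wact:
  "\<pi> \<in> symgrp n \<Longrightarrow> (\<Sum>e\<in>words d n. f (wact n \<pi> e)) = (\<Sum>e\<in>words d n. f e)"
  by (rule sum.reindex_bij_betw[OF bij_betw_wact])

text \<open>Reads the operator off at an output word instead of pushing kets forward: the only input
  word that is sent to \<open>a\<close> is \<open>wact n \<pi> a\<close>.\<close>

lemma perm_op_apply:
  assumes "\<pi> \<in> symgrp n"
  shows "perm_op d n \<pi> x a = (if a \<in> words d n then x (wact n \<pi> a) else 0)"
proof -
  have "perm_op d n \<pi> x a = (\<Sum>e\<in>words d n. if a = wact n (inv \<pi>) e then x e else 0)"
    unfolding perm_op_def fun_sum_apply
    by (intro sum.cong refl) (simp add: ket_def wact_def)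
  also have "\<dots> = (\<Sum>e\<in>words d n. if a \<in> words d n \<and> e = wact n \<pi> a then x e else 0)"
    by (intro sum.cong refl if_cong) (use assms in auto)
  also have "\<dots> = (if a \<in> words d n then x (wact n \<pi> a) else 0)"
    using assms by (cases "a \<in> words d n") auto
  finally show ?thesis .
qed

lemma perm_op_tensor_space [simp, intro]: "\<pi> \<in> symgrp n \<Longrightarrow> perm_op d n \<pi> x \<in> tensor_space d n"
  by (simp add: tensor_space_def perm_op_apply)

lemma subspace_tensor_space: "cfun.subspace (tensor_space d n)"
  by (simp add: cfun.subspace_def tensor_space_def)

lemma perm_op_linear:
  assumes "\<pi> \<in> symgrp n"
  shows "perm_op d n \<pi> (x + y) = perm_op d n \<pi> x + perm_op d n \<pi> y"
    "perm_op d n \<pi> (cscale c x) = cscale c (perm_op d n \<pi> x)"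
  using assms by (auto simp: fun_eq_iff perm_op_apply)

lemma perm_op_comp:
  "\<pi> \<in> symgrp n \<Longrightarrow> \<sigma> \<in> symgrp n \<Longrightarrow> perm_op d n (\<pi> \<circ> \<sigma>) x = perm_op d n \<pi> (perm_op d n \<sigma> x)"
  by (auto simp: fun_eq_iff perm_op_apply wact_comp)

lemma perm_op_id [simp]: "x \<in> tensor_space d n \<Longrightarrow> perm_op d n id x = x"
  by (auto simp: fun_eq_iff perm_op_apply tensor_space_def)

lemma perm_op_ket:
  assumes "\<pi> \<in> symgrp n" "e \<in> words d n"
  shows "perm_op d n \<pi> (ket e) = ket (wact n (inv \<pi>) e)"
proof
  fix a show "perm_op d n \<pi> (ket e) a = ket (wact n (inv \<pi>) e) a"
    using assms by (auto simp: perm_op_apply ket_def)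
qed

lemma perm_op_adjoint:
  assumes "\<pi> \<in> symgrp n"
  shows "inner_on (words d n) (perm_op d n \<pi> x) y = inner_on (words d n) x (perm_op d n (inv \<pi>) y)"
proof -
  have "inner_on (words d n) x (perm_op d n (inv \<pi>) y) =
      (\<Sum>e\<in>words d n. cnj (x e) * y (wact n (inv \<pi>) e))"
    unfolding inner_on_def by (intro sum.cong refl) (simp add: perm_op_apply assms)
  also have "\<dots> = (\<Sum>e\<in>words d n. cnj (x (wact n \<pi> e)) * y (wact n (inv \<pi>) (wact n \<pi> e)))"
    using assms by (subst sum_words_wact) auto
  also have "\<dots> = inner_on (words d n) (perm_op d n \<pi> x) y"
    unfolding inner_on_def by (intro sum.cong refl) (simp add: perm_op_apply assms)
  finally show ?thesis ..
qed

lemma algebra_op_linear: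
  "algebra_op d n (f + g) x = algebra_op d n f x + algebra_op d n g x"
  "algebra_op d n (cscale c f) x = cscale c (algebra_op d n f x)"
  "algebra_op d n 0 x = 0"
  "algebra_op d n f (x + y) = algebra_op d n f x + algebra_op d n f y"
  "algebra_op d n f (cscale c x) = cscale c (algebra_op d n f x)"
  "algebra_op d n f 0 = 0"
  by (auto simp: fun_eq_iff algebra_op_def fun_sum_apply perm_op_apply perm_op_linear sum_distrib_left
      algebra_simps sum.distrib intro!: sum.cong)

lemma algebra_op_sum:
  "algebra_op d n (\<Sum>i\<in>I. f i) x = (\<Sum>i\<in>I. algebra_op d n (f i) x)"
  "algebra_op d n g (\<Sum>i\<in>I. y i) = (\<Sum>i\<in>I. algebra_op d n g (y i))"
  by (induction I rule: infinite_finite_induct) (simp_all add: algebra_op_linear)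

lemma algebra_op_tensor_space [simp, intro]: "algebra_op d n f x \<in> tensor_space d n"
  unfolding algebra_op_def
  by (intro cfun.subspace_sum cfun.subspace_scale subspace_tensor_space perm_op_tensor_space)

lemma algebra_op_gdelta: "\<pi> \<in> symgrp n \<Longrightarrow> algebra_op d n (gdelta \<pi>) x = perm_op d n \<pi> x"
  by (rule ext) (simp add: algebra_op_def gdelta_def fun_sum_apply if_distrib[of "\<lambda>x. x * _"] cong: if_cong)

lemma algebra_op_id [simp]: "x \<in> tensor_space d n \<Longrightarrow> algebra_op d n (gdelta id) x = x"
  by (simp add: algebra_op_gdelta)

lemma algebra_op_apply:
  "algebra_op d n f x a = (if a \<in> words d n then \<Sum>\<pi>\<in>symgrp n. f \<pi> * x (wact n \<pi> a) else 0)"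
  by (auto simp: algebra_op_def fun_sum_apply perm_op_apply intro!: sum.cong)

lemma algebra_op_conv: "algebra_op d n (conv n f g) x = algebra_op d n f (algebra_op d n g x)"
proof
  fix a
  show "algebra_op d n (conv n f g) x a = algebra_op d n f (algebra_op d n g x) a"
  proof (cases "a \<in> words d n")
    case True
    have "algebra_op d n (conv n f g) x a =
        (\<Sum>\<sigma>\<in>symgrp n. \<Sum>\<pi>\<in>symgrp n. f \<pi> * g (inv \<pi> \<circ> \<sigma>) * x (wact n \<sigma> a))"
      using True by (simp add: algebra_op_apply conv_def sum_distrib_right)
    also have "\<dots> = (\<Sum>\<pi>\<in>symgrp n. \<Sum>\<sigma>\<in>symgrp n. f \<pi> * g (inv \<pi> \<circ> \<sigma>) * x (wact n \<sigma> a))"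
      by (rule sum.swap)
    also have "\<dots> = (\<Sum>\<pi>\<in>symgrp n. \<Sum>\<tau>\<in>symgrp n. f \<pi> * g (inv \<pi> \<circ> (\<pi> \<circ> \<tau>)) * x (wact n (\<pi> \<circ> \<tau>) a))"
      by (intro sum.cong refl sum_symgrp_left[symmetric])
    also have "\<dots> = (\<Sum>\<pi>\<in>symgrp n. \<Sum>\<tau>\<in>symgrp n. f \<pi> * (g \<tau> * x (wact n \<tau> (wact n \<pi> a))))"
      by (intro sum.cong refl) (simp add: wact_comp mult.assoc)
    also have "\<dots> = algebra_op d n f (algebra_op d n g x) a"
      using True by (simp add: algebra_op_apply sum_distrib_left)
    finally show ?thesis .
  qed (simp add: algebra_op_apply)
qed

text \<open>Permutation operators are unitary. With \<open>gstar\<close> as adjoint, inner products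
  of images turn into products in the group algebra.\<close>

lemma algebra_op_adjoint:
  "inner_on (words d n) (algebra_op d n f x) y = inner_on (words d n) x (algebra_op d n (gstar n f) y)"
proof -
  have "inner_on (words d n) x (algebra_op d n (gstar n f) y) =
      (\<Sum>\<pi>\<in>symgrp n. cnj (f (inv \<pi>)) * inner_on (words d n) x (perm_op d n \<pi> y))"
    unfolding algebra_op_def inner_on_sum
    by (intro sum.cong refl) (simp add: gstar_def inner_on_linear)
  also have "\<dots> = (\<Sum>\<pi>\<in>symgrp n. cnj (f (inv (inv \<pi>))) * inner_on (words d n) x (perm_op d n (inv \<pi>) y))"
    by (rule sum_symgrp_inv[symmetric])
  also have "\<dots> = inner_on (words d n) (algebra_op d n f x) y"
    unfolding algebra_op_def inner_on_sum
    by (intro sum.cong refl) (simp add: inner_on_linear perm_op_adjoint)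
  finally show ?thesis ..
qed

lemma tensor_inner_eq_0:
  "x \<in> tensor_space d n \<Longrightarrow> inner_on (words d n) x x = 0 \<longleftrightarrow> x = 0"
  by (rule inner_on_self_eq_0) (auto simp: tensor_space_def)

section \<open>Tensor powers of matrices and their commutation with permutations\<close>

lemma tensor_pow_op_tensor_space [simp, intro]: "tensor_pow_op d n U x \<in> tensor_space d n"
  by (simp add: tensor_pow_op_def tensor_space_def)

lemma tensor_pow_op_linear:
  "tensor_pow_op d n U (x + y) = tensor_pow_op d n U x + tensor_pow_op d n U y"
  "tensor_pow_op d n U (cscale c x) = cscale c (tensor_pow_op d n U x)"
  "tensor_pow_op d n U 0 = 0"
  by (auto simp: fun_eq_iff tensor_pow_op_def sum_distrib_left algebra_simps sum.distrib)

lemma tensor_pow_op_sum: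
  "tensor_pow_op d n U (\<Sum>i\<in>I. f i) = (\<Sum>i\<in>I. tensor_pow_op d n U (f i))"
  by (induction I rule: infinite_finite_induct) (simp_all only: not_False_eq_True sum.infinite sum.empty sum.insert tensor_pow_op_linear)

text \<open>Permuting the positions of the row word and the column word simultaneously only reorders
  the product of matrix entries.\<close>

lemma tensor_pow_op_perm_op:
  assumes "\<pi> \<in> symgrp n"
  shows "tensor_pow_op d n U (perm_op d n \<pi> x) = perm_op d n \<pi> (tensor_pow_op d n U x)"
proof
  fix a
  show "tensor_pow_op d n U (perm_op d n \<pi> x) a = perm_op d n \<pi> (tensor_pow_op d n U x) a"
  proof (cases "a \<in> words d n")
    case True
    have *: "(\<Prod>k<n. U $$ (a ! \<pi> k, e ! \<pi> k)) = (\<Prod>k<n. U $$ (a ! k, e ! k))" for e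
      using prod.reindex_bij_betw[OF permutes_imp_bij, of \<pi> "{..<n}"] assms by (simp add: symgrp_def)
    have "perm_op d n \<pi> (tensor_pow_op d n U x) a =
        (\<Sum>e\<in>words d n. (\<Prod>k<n. U $$ (wact n \<pi> a ! k, e ! k)) * x e)"
      using True assms by (simp add: perm_op_apply tensor_pow_op_def)
    also have "\<dots> = (\<Sum>e\<in>words d n. (\<Prod>k<n. U $$ (wact n \<pi> a ! k, wact n \<pi> e ! k)) * x (wact n \<pi> e))"
      by (rule sum_words_wact[OF assms, symmetric])
    also have "\<dots> = tensor_pow_op d n U (perm_op d n \<pi> x) a"
      using True assms by (simp add: perm_op_apply tensor_pow_op_def *)
    finally show ?thesis ..
  qed (use assms in \<open>simp add: perm_op_apply tensor_pow_op_def\<close>)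
qed

lemma tensor_pow_op_algebra_op:
  "tensor_pow_op d n U (algebra_op d n f x) = algebra_op d n f (tensor_pow_op d n U x)"
  by (simp add: algebra_op_def tensor_pow_op_sum tensor_pow_op_linear tensor_pow_op_perm_op)

section \<open>Young symmetrizers\<close>

lemma downclosed_eq_lessThan:
  fixes S :: "nat set"
  assumes "finite S" "\<And>x y. x \<in> S \<Longrightarrow> y \<le> x \<Longrightarrow> y \<in> S"
  shows "S = {..<card S}"
proof (cases "S = {}")
  case False
  have "S = {..Max S}"
    using assms False by (auto intro: Max_ge Max_in)
  hence "S = {..<Suc (Max S)}" by (simp add: lessThan_Suc_atMost)
  thus ?thesis by (metis card_lessThan)
qed simp

section \<open>Tableau combinatorics behind the Young symmetrizer\<close>

definition shape :: "nat \<Rightarrow> nat list \<Rightarrow> bool" where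
  "shape n l \<longleftrightarrow> sorted_wrt (\<ge>) l \<and> 0 \<notin> set l \<and> sum_list l = n"

lemma partitions_upto_shape: "l \<in> partitions_upto d n \<longleftrightarrow> shape n l \<and> length l \<le> d"
  by (auto simp: partitions_upto_def shape_def)

lemma sum_take_Suc:
  "sum_list (take (Suc r) l) = sum_list (take r l) + (if r < length l then l ! r else 0)"
  for l :: "nat list"
  by (simp add: take_Suc_conv_app_nth)

lemma sum_take_mono: "r \<le> s \<Longrightarrow> sum_list (take r l) \<le> sum_list (take s l)" for l :: "nat list"
  by (induction s) (auto simp: le_Suc_eq sum_take_Suc)

lemma sum_take_le: "sum_list (take r l) \<le> sum_list l" for l :: "nat list"
  using sum_take_mono[of r "max r (length l)" l] by simp

lemma row_of_eqI:
  assumes "sum_list (take r l) \<le> k" "k < sum_list (take (Suc r) l)"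
  shows "row_of l k = r"
  unfolding row_of_def
proof (rule Least_equality)
  fix s assume "k < sum_list (take (Suc s) l)"
  thus "r \<le> s" using sum_take_mono[of "Suc s" r l] assms(1) by (auto simp: not_le[symmetric] Suc_le_eq)
qed (rule assms)

lemma row_of_bounds:
  assumes "k < sum_list l"
  shows "sum_list (take (row_of l k) l) \<le> k" "k < sum_list (take (Suc (row_of l k)) l)"
    "row_of l k < length l"
proof -
  have "k < sum_list (take (Suc (length l)) l)" using assms by simp
  thus *: "k < sum_list (take (Suc (row_of l k)) l)" unfolding row_of_def by (rule LeastI)
  show **: "sum_list (take (row_of l k) l) \<le> k"
  proof (cases "row_of l k")
    case (Suc r)
    hence "r < row_of l k" by simp
    hence "\<not> k < sum_list (take (Suc r) l)" unfolding row_of_def by (rule not_less_Least)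
    thus ?thesis using Suc by simp
  qed simp
  show "row_of l k < length l"
    by (rule ccontr) (use * ** in simp)
qed

lemma row_of_less_iff:
  assumes "k < sum_list l"
  shows "row_of l k < r \<longleftrightarrow> k < sum_list (take r l)"
proof
  assume "row_of l k < r"
  thus "k < sum_list (take r l)"
    using row_of_bounds(2)[OF assms] sum_take_mono[of "Suc (row_of l k)" r l] by simp
next
  assume "k < sum_list (take r l)"
  thus "row_of l k < r"
    using row_of_bounds(1)[OF assms] sum_take_mono[of r "row_of l k" l] by (meson leD leI le_trans)
qed

lemma col_of_less: "k < sum_list l \<Longrightarrow> col_of l k < l ! row_of l k"
  using row_of_bounds[of k l] by (simp add: col_of_def sum_take_Suc)

lemma cell_eq: "k < sum_list l \<Longrightarrow> k = sum_list (take (row_of l k) l) + col_of l k"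
  using row_of_bounds(1)[of k l] by (simp add: col_of_def)

lemma cell_inj:
  "j < sum_list l \<Longrightarrow> k < sum_list l \<Longrightarrow> row_of l j = row_of l k \<Longrightarrow> col_of l j = col_of l k \<Longrightarrow> j = k"
  by (metis cell_eq)

lemma cell_exists:
  assumes "r < length l" "c < l ! r"
  obtains k where "k < sum_list l" "row_of l k = r" "col_of l k = c"
proof
  let ?k = "sum_list (take r l) + c"
  have *: "?k < sum_list (take (Suc r) l)" using assms by (simp add: sum_take_Suc)
  show "?k < sum_list l" using * sum_take_le[of "Suc r" l] by simp
  show **: "row_of l ?k = r" by (rule row_of_eqI) (use * in auto)
  show "col_of l ?k = c" by (simp add: col_of_def **)
qed

text \<open>The parts of the conjugate partition.\<close>

definition col_height :: "nat list \<Rightarrow> nat \<Rightarrow> nat" where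
  "col_height l c = card {r. r < length l \<and> c < l ! r}"

text \<open>Row lengths decrease weakly, so the rows that reach column \<open>c\<close> form an
  initial segment.\<close>

lemma col_height:
  assumes "sorted_wrt (\<ge>) l"
  shows "r < length l \<and> c < l ! r \<longleftrightarrow> r < col_height l c"
proof -
  have "{r. r < length l \<and> c < l ! r} = {..<col_height l c}"
    unfolding col_height_def
  proof (rule downclosed_eq_lessThan)
    fix x y assume "x \<in> {r. r < length l \<and> c < l ! r}" "y \<le> x"
    thus "y \<in> {r. r < length l \<and> c < l ! r}"
      using assms sorted_wrt_nth_less[of "(\<ge>)" l y x] by (cases "y = x") fastforce+
  qed simp
  thus ?thesis by blast
qed

lemma row_less_col_height:
  assumes "shape n l" "k < n"
  shows "row_of l k < col_height l (col_of l k)"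
  using assms row_of_bounds(3)[of k l] col_of_less[of k l]
  by (subst col_height[symmetric]) (auto simp: shape_def)

lemma card_row_less:
  assumes "shape n l"
  shows "card {x. x < n \<and> row_of l x < k} = sum_list (take k l)"
proof -
  have "{x. x < n \<and> row_of l x < k} = {..<sum_list (take k l)}"
    using assms sum_take_le[of k l] by (auto simp: shape_def row_of_less_iff)
  thus ?thesis by simp
qed

lemma card_fibres:
  assumes "finite A" "\<And>x. x \<in> A \<Longrightarrow> f x < (n::nat)"
  shows "(\<Sum>c<n. card {x\<in>A. f x = c}) = card A"
proof -
  have "card A = card (\<Union>c\<in>{..<n}. {x\<in>A. f x = c})"
    by (rule arg_cong[of _ _ card]) (use assms in auto)
  also have "\<dots> = (\<Sum>c<n. card {x\<in>A. f x = c})"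
    by (subst card_UN_disjoint) (use assms in auto)
  finally show ?thesis ..
qed

lemma col_of_less_n: "shape n l \<Longrightarrow> k < n \<Longrightarrow> col_of l k < n"
  by (metis shape_def cell_eq le_add2 le_less_trans)

text \<open>Double counting of the cells in the first \<open>k\<close> rows: column \<open>c\<close>
  contains the smaller of \<open>k\<close> and its height.\<close>

lemma sum_min_col_height:
  assumes "shape n l"
  shows "(\<Sum>c<n. min k (col_height l c)) = sum_list (take k l)"
proof -
  let ?A = "{x. x < n \<and> row_of l x < k}"
  have "card {x\<in>?A. col_of l x = c} = min k (col_height l c)" for c
  proof -
    have "bij_betw (row_of l) {x\<in>?A. col_of l x = c} {..<min k (col_height l c)}"
      unfolding bij_betw_def
    proof
      show "inj_on (row_of l) {x\<in>?A. col_of l x = c}"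
        using assms by (auto simp: inj_on_def shape_def intro: cell_inj)
      show "row_of l ` {x\<in>?A. col_of l x = c} = {..<min k (col_height l c)}"
      proof (intro equalityI subsetI)
        fix r assume "r \<in> {..<min k (col_height l c)}"
        hence "r < k" "r < length l" "c < l ! r"
          using assms col_height[of l r c] by (auto simp: shape_def)
        thus "r \<in> row_of l ` {x\<in>?A. col_of l x = c}"
          using cell_exists[of r l c] assms by (force simp: shape_def)
      qed (use row_less_col_height[OF assms] in auto)
    qed
    from bij_betw_same_card[OF this] show ?thesis by (simp only: card_lessThan)
  qed
  moreover have "(\<Sum>c<n. card {x\<in>?A. col_of l x = c}) = card ?A"
    by (rule card_fibres) (use col_of_less_n[OF assms] in auto)
  ultimately show ?thesis using card_row_less[OF assms] by simp
qed

text \<open>If this fails for \<open>inv \<sigma>\<close>, then \<open>\<sigma>\<close> conjugates a column transposition into a row transposition, and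
  the product of row symmetrizer, \<open>\<sigma>\<close> and column antisymmetrizer vanishes.\<close>
definition rows_transversal :: "nat \<Rightarrow> nat list \<Rightarrow> nat list \<Rightarrow> (nat \<Rightarrow> nat) \<Rightarrow> bool" where
  "rows_transversal n l m \<tau> \<longleftrightarrow>
     (\<forall>x<n. \<forall>y<n. row_of l x = row_of l y \<longrightarrow> col_of m (\<tau> x) = col_of m (\<tau> y) \<longrightarrow> x = y)"

text \<open>Two bounds on one set: its members come from distinct rows among the first
  \<open>k\<close> by transversality, and \<open>\<tau>\<close> puts them into distinct cells of a
  single column.\<close>

lemma rows_transversal_card_le:
  assumes "shape n m" "\<tau> \<in> symgrp n" "rows_transversal n l m \<tau>"
  shows "card {x. x < n \<and> row_of l x < k \<and> col_of m (\<tau> x) = c} \<le> min k (col_height m c)"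
proof -
  let ?A = "{x. x < n \<and> row_of l x < k \<and> col_of m (\<tau> x) = c}"
  have "card ?A \<le> card {..<k}"
    by (rule card_inj_on_le[of "row_of l"]) (use assms in \<open>auto simp: inj_on_def rows_transversal_def\<close>)
  moreover have "card ?A \<le> card {..<col_height m c}"
  proof (rule card_inj_on_le[of "\<lambda>x. row_of m (\<tau> x)"])
    have "\<tau> x = \<tau> y" if "x < n" "y < n" "row_of m (\<tau> x) = row_of m (\<tau> y)"
      "col_of m (\<tau> x) = col_of m (\<tau> y)" for x y
      using that assms by - (rule cell_inj[of _ m]; auto simp: shape_def)
    thus "inj_on (\<lambda>x. row_of m (\<tau> x)) ?A"
      using assms(2) by (auto simp: inj_on_def symgrp_inj)
    show "(\<lambda>x. row_of m (\<tau> x)) ` ?A \<subseteq> {..<col_height m c}"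
      using row_less_col_height[OF assms(1)] assms(2) by auto
  qed simp
  ultimately show ?thesis by simp
qed

lemma rows_transversal_sum:
  assumes "shape n l" "shape n m" "\<tau> \<in> symgrp n"
  shows "(\<Sum>c<n. card {x. x < n \<and> row_of l x < k \<and> col_of m (\<tau> x) = c}) = sum_list (take k l)"
proof -
  have "(\<Sum>c<n. card {x \<in> {x. x < n \<and> row_of l x < k}. col_of m (\<tau> x) = c}) = sum_list (take k l)"
    by (subst card_fibres) (use card_row_less[OF assms(1)] col_of_less_n[OF assms(2)] assms(3) in auto)
  thus ?thesis by (simp add: conj_assoc)
qed

text \<open>Summing the columnwise bounds over all columns gives the dominance order between the two
  shapes.\<close>

lemma rows_transversal_dominance:
  assumes "shape n l" "shape n m" "\<tau> \<in> symgrp n" "rows_transversal n l m \<tau>"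
  shows "sum_list (take k l) \<le> sum_list (take k m)"
  unfolding rows_transversal_sum[OF assms(1-3), symmetric] sum_min_col_height[OF assms(2), symmetric]
  by (intro sum_mono rows_transversal_card_le assms)

text \<open>For equal shapes the columnwise bounds have equal sums, so each is an equality. Passing
  from the rows before that of \<open>x\<close> to those including it adds exactly one entry to the
  column of \<open>\<tau> x\<close>; hence \<open>min k h\<close> grows at this \<open>k\<close>,
  which means that \<open>k\<close> is below the height \<open>h\<close>.\<close>

lemma rows_transversal_cell:
  assumes "shape n l" "\<tau> \<in> symgrp n" "rows_transversal n l l \<tau>" "x < n"
  shows "row_of l x < col_height l (col_of l (\<tau> x))"
proof -
  define N where "N k c = card {x. x < n \<and> row_of l x < k \<and> col_of l (\<tau> x) = c}" for k c
  have N: "N k c = min k (col_height l c)" if "c < n" for k c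
  proof -
    have "(\<Sum>c<n. N k c) = (\<Sum>c<n. min k (col_height l c))"
      unfolding N_def using rows_transversal_sum[OF assms(1,1,2)] sum_min_col_height[OF assms(1)] by simp
    thus ?thesis
      using rows_transversal_card_le[OF assms(1-3)] that
      by (intro sum_mono_inv[of "N k" "{..<n}"]) (auto simp: N_def)
  qed
  let ?k = "row_of l x" and ?c = "col_of l (\<tau> x)"
  have "{y. y < n \<and> row_of l y < Suc ?k \<and> col_of l (\<tau> y) = ?c} =
      insert x {y. y < n \<and> row_of l y < ?k \<and> col_of l (\<tau> y) = ?c}"
    using assms(3,4) by (auto simp: rows_transversal_def less_Suc_eq)
  hence "N (Suc ?k) ?c = Suc (N ?k ?c)" unfolding N_def by simp
  moreover have "?c < n" using assms col_of_less_n by simp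
  ultimately show ?thesis using N by (simp add: min_def split: if_splits)
qed

text \<open>Von Neumann's lemma. Move each \<open>x\<close> within its row to the column in which
  \<open>inv \<sigma>\<close> puts it; the preceding lemma says that this cell exists. The result
  \<open>p'\<close> is a row permutation, and \<open>p' \<circ> \<sigma>\<close> preserves columns
  because \<open>\<sigma>\<close> undoes \<open>inv \<sigma>\<close>.\<close>

lemma rows_transversal_factor:
  assumes "shape n l" "\<sigma> \<in> symgrp n" "rows_transversal n l l (inv \<sigma>)"
  obtains p q where "p \<in> row_group n l" "q \<in> col_group n l" "\<sigma> = p \<circ> q"
proof -
  let ?\<tau> = "inv \<sigma>"
  have \<tau>: "?\<tau> \<in> symgrp n" using assms by simp
  have "\<forall>x\<in>{..<n}. \<exists>y. y < n \<and> row_of l y = row_of l x \<and> col_of l y = col_of l (?\<tau> x)"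
  proof
    fix x assume "x \<in> {..<n}"
    hence "row_of l x < col_height l (col_of l (?\<tau> x))"
      using rows_transversal_cell[OF assms(1) \<tau> assms(3)] by simp
    hence "row_of l x < length l" "col_of l (?\<tau> x) < l ! row_of l x"
      using col_height assms(1) by (auto simp: shape_def)
    thus "\<exists>y. y < n \<and> row_of l y = row_of l x \<and> col_of l y = col_of l (?\<tau> x)"
      using cell_exists assms(1) by (metis shape_def)
  qed
  then obtain g where g: "\<And>x. x < n \<Longrightarrow> g x < n \<and> row_of l (g x) = row_of l x \<and> col_of l (g x) = col_of l (?\<tau> x)"
    by (metis lessThan_iff)
  define p' where "p' x = (if x < n then g x else x)" for x
  have "inj_on g {..<n}"
  proof (rule inj_onI)
    fix x y assume "x \<in> {..<n}" "y \<in> {..<n}" "g x = g y"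
    thus "x = y" using g[of x] g[of y] assms(3) unfolding rows_transversal_def by simp
  qed
  moreover have "g ` {..<n} \<subseteq> {..<n}" using g by auto
  ultimately have "bij_betw g {..<n} {..<n}"
    by (simp add: bij_betw_def endo_inj_surj)
  hence "bij_betw p' {..<n} {..<n}" by (rule bij_betw_cong[THEN iffD1, rotated]) (simp add: p'_def)
  hence p': "p' \<in> symgrp n" unfolding symgrp_def mem_Collect_eq by (rule bij_imp_permutes) (simp add: p'_def)
  show ?thesis
  proof
    show "inv p' \<in> row_group n l"
      unfolding row_group_def
    proof (intro CollectI conjI allI impI)
      fix k assume "k < n"
      hence "row_of l (p' (inv p' k)) = row_of l (inv p' k)" using p' g by (simp add: p'_def)
      thus "row_of l (inv p' k) = row_of l k" using p' by simp
    qed (use p' in simp)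
    show "p' \<circ> \<sigma> \<in> col_group n l"
      unfolding col_group_def using p' assms(2) g by (auto simp: p'_def)
    show "\<sigma> = inv p' \<circ> (p' \<circ> \<sigma>)" using p' by simp
  qed
qed

text \<open>Differences of partial sums give the parts once the lengths agree. If one list were
  longer, its positive parts would keep it short of \<open>n\<close> at the point where the other
  has already reached \<open>n\<close>.\<close>

lemma shape_eqI:
  assumes "shape n l" "shape n m" "\<And>k. sum_list (take k l) = sum_list (take k m)"
  shows "l = m"
proof -
  have le: "length l' \<le> length m'" if "shape n l'" "shape n m'"
    "\<And>k. sum_list (take k l') = sum_list (take k m')" for l' m'
  proof (rule ccontr)
    assume "\<not> length l' \<le> length m'"
    hence len: "length m' < length l'" by simp
    hence "0 < l' ! length m'" using that(1) by (metis gr0I nth_mem shape_def)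
    hence "sum_list (take (length m') l') < sum_list (take (Suc (length m')) l')"
      using len by (simp add: sum_take_Suc)
    also have "\<dots> \<le> n" using that(1) sum_take_le[of "Suc (length m')" l'] by (simp add: shape_def)
    also have "\<dots> = sum_list (take (length m') m')" using that(2) by (simp add: shape_def)
    finally show False using that(3) by simp
  qed
  have len: "length l = length m" using le[of l m] le[of m l] assms by force
  show ?thesis
  proof (rule nth_equalityI[OF len])
    fix i assume "i < length l"
    thus "l ! i = m ! i"
      using assms(3)[of "Suc i"] assms(3)[of i] len by (simp add: sum_take_Suc)
  qed
qed

section \<open>Young subgroups and their symmetrizers\<close>

definition fibre_group :: "nat \<Rightarrow> (nat \<Rightarrow> nat) \<Rightarrow> (nat \<Rightarrow> nat) set" where
  "fibre_group n F = {\<pi> \<in> symgrp n. \<forall>k<n. F (\<pi> k) = F k}"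

lemma row_group_fibre: "row_group n l = fibre_group n (row_of l)"
  and col_group_fibre: "col_group n l = fibre_group n (col_of l)"
  by (simp_all add: row_group_def col_group_def fibre_group_def)

lemma fibre_group_symgrp: "\<pi> \<in> fibre_group n F \<Longrightarrow> \<pi> \<in> symgrp n"
  by (simp add: fibre_group_def)

lemma finite_fibre_group [simp]: "finite (fibre_group n F)"
  by (simp add: fibre_group_def)

lemma fibre_group_closed:
  "id \<in> fibre_group n F"
  "\<pi> \<in> fibre_group n F \<Longrightarrow> \<sigma> \<in> fibre_group n F \<Longrightarrow> \<pi> \<circ> \<sigma> \<in> fibre_group n F"
  "\<pi> \<in> fibre_group n F \<Longrightarrow> inv \<pi> \<in> fibre_group n F"
proof -
  show "inv \<pi> \<in> fibre_group n F" if "\<pi> \<in> fibre_group n F"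
    unfolding fibre_group_def
  proof (intro CollectI conjI allI impI)
    fix k assume "k < n"
    have \<pi>: "\<pi> \<in> symgrp n" using that by (simp add: fibre_group_def)
    hence "F (\<pi> (inv \<pi> k)) = F (inv \<pi> k)"
      using that \<open>k < n\<close> unfolding fibre_group_def by (simp del: symgrp_inv_o)
    thus "F (inv \<pi> k) = F k" using \<pi> by simp
  qed (use that in \<open>simp add: fibre_group_def\<close>)
qed (auto simp: fibre_group_def)

lemma symgrp_transpose: "x < n \<Longrightarrow> y < n \<Longrightarrow> transpose x y \<in> symgrp n"
  by (simp add: symgrp_def permutes_swap_id)

lemma fibre_group_transpose:
  "x < n \<Longrightarrow> y < n \<Longrightarrow> F x = F y \<Longrightarrow> transpose x y \<in> fibre_group n F"
  by (auto simp: fibre_group_def symgrp_transpose transpose_def)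

text \<open>Here \<open>s\<close> is to be a character with values 1 and -1: the trivial one for
  rows and \<open>sign\<close> for columns, so that both symmetrizers share one theory.\<close>

definition fibre_sum :: "nat \<Rightarrow> (nat \<Rightarrow> nat) \<Rightarrow> ((nat \<Rightarrow> nat) \<Rightarrow> int) \<Rightarrow> (nat \<Rightarrow> nat) \<Rightarrow> complex" where
  "fibre_sum n F s = (\<Sum>\<pi>\<in>fibre_group n F. cscale (of_int (s \<pi>)) (gdelta \<pi>))"

definition is_character :: "nat \<Rightarrow> ((nat \<Rightarrow> nat) \<Rightarrow> int) \<Rightarrow> bool" where
  "is_character n s \<longleftrightarrow> (\<forall>\<pi>\<in>symgrp n. s \<pi> * s \<pi> = 1 \<and> (\<forall>\<sigma>\<in>symgrp n. s (\<pi> \<circ> \<sigma>) = s \<pi> * s \<sigma>))"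

lemma symgrp_permutation: "\<pi> \<in> symgrp n \<Longrightarrow> permutation \<pi>"
  using permutation_permutes by (auto simp: symgrp_def)

lemma is_character_sign: "is_character n sign"
  by (simp add: is_character_def symgrp_permutation sign_compose sign_idempotent)

lemma is_character_1: "is_character n (\<lambda>_. 1)"
  by (simp add: is_character_def)

lemma is_character_id: "is_character n s \<Longrightarrow> s id = 1"
  unfolding is_character_def by (metis comp_id symgrp_id)

lemma is_character_inv: "is_character n s \<Longrightarrow> \<pi> \<in> symgrp n \<Longrightarrow> s (inv \<pi>) = s \<pi>"
  using is_character_id[of n s] unfolding is_character_def
  by (metis mult.assoc mult.right_neutral symgrp_inv symgrp_inv_o(2) mult.commute)

lemma sum_fibre_left:
  assumes "\<sigma> \<in> fibre_group n F"
  shows "(\<Sum>\<pi>\<in>fibre_group n F. f (\<sigma> \<circ> \<pi>)) = (\<Sum>\<pi>\<in>fibre_group n F. f \<pi>)"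
  by (rule sum.reindex_bij_witness[where i = "\<lambda>\<pi>. inv \<sigma> \<circ> \<pi>" and j = "\<lambda>\<pi>. \<sigma> \<circ> \<pi>"])
     (use assms fibre_group_symgrp[OF assms] in \<open>auto intro: fibre_group_closed\<close>)

lemma fibre_sum_galg [simp]: "fibre_sum n F s \<in> galg n"
  unfolding fibre_sum_def by (intro galg_sum galg_closed fibre_group_symgrp)

lemma gstar_fibre_sum:
  assumes "is_character n s"
  shows "gstar n (fibre_sum n F s) = fibre_sum n F s"
proof -
  have "gstar n (fibre_sum n F s) = (\<Sum>\<pi>\<in>fibre_group n F. cscale (of_int (s \<pi>)) (gdelta (inv \<pi>)))"
    unfolding fibre_sum_def gstar_sum
    by (intro sum.cong refl) (auto simp: gstar_linear gstar_gdelta fibre_group_symgrp)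
  also have "\<dots> = fibre_sum n F s"
    unfolding fibre_sum_def
    by (rule sum.reindex_bij_witness[where i = inv and j = inv])
       (use assms in \<open>auto dest: fibre_group_symgrp simp: is_character_inv fibre_group_closed\<close>)
  finally show ?thesis .
qed

lemma conv_gdelta_fibre_sum:
  assumes "is_character n s" "\<sigma> \<in> fibre_group n F"
  shows "conv n (gdelta \<sigma>) (fibre_sum n F s) = cscale (of_int (s \<sigma>)) (fibre_sum n F s)"
proof -
  have \<sigma>: "\<sigma> \<in> symgrp n" using assms fibre_group_symgrp by blast
  \<comment> \<open>Multiplying by \<open>s \<sigma>\<close> first makes the coefficients
    \<open>s (\<sigma> \<circ> \<pi>)\<close>, which a shift of the summation variable absorbs. The
    extra factor is cancelled afterwards, its square being 1.\<close>
  have "cscale (of_int (s \<sigma>)) (conv n (gdelta \<sigma>) (fibre_sum n F s)) =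
      (\<Sum>\<pi>\<in>fibre_group n F. cscale (of_int (s (\<sigma> \<circ> \<pi>))) (gdelta (\<sigma> \<circ> \<pi>)))"
    unfolding fibre_sum_def conv_sum cfun.scale_sum_right
    using assms \<sigma>
    by (intro sum.cong refl)
       (auto simp: conv_linear conv_gdelta_gdelta is_character_def fibre_group_symgrp)
  also have "\<dots> = fibre_sum n F s"
    unfolding fibre_sum_def by (rule sum_fibre_left[OF assms(2)])
  finally have "cscale (of_int (s \<sigma>)) (cscale (of_int (s \<sigma>)) (conv n (gdelta \<sigma>) (fibre_sum n F s))) =
      cscale (of_int (s \<sigma>)) (fibre_sum n F s)" by simp
  moreover have "of_int (s \<sigma>) * of_int (s \<sigma>) = (1 :: complex)"
    using assms(1) \<sigma> unfolding is_character_def by (metis of_int_1 of_int_mult)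
  ultimately show ?thesis by simp
qed

text \<open>Obtained from the left-hand version by \<open>gstar\<close>, which fixes the sum and
  moves the point mass to the inverse permutation.\<close>

lemma conv_fibre_sum_gdelta:
  assumes "is_character n s" "\<sigma> \<in> fibre_group n F"
  shows "conv n (fibre_sum n F s) (gdelta \<sigma>) = cscale (of_int (s \<sigma>)) (fibre_sum n F s)"
proof -
  have \<sigma>: "\<sigma> \<in> symgrp n" using assms fibre_group_symgrp by blast
  have "conv n (fibre_sum n F s) (gdelta \<sigma>) =
      gstar n (gstar n (conv n (fibre_sum n F s) (gdelta \<sigma>)))"
    using \<sigma> by simp
  also have "gstar n (conv n (fibre_sum n F s) (gdelta \<sigma>)) = conv n (gdelta (inv \<sigma>)) (fibre_sum n F s)"
    using \<sigma> by (simp add: gstar_conv gstar_gdelta gstar_fibre_sum[OF assms(1)])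
  also have "\<dots> = cscale (of_int (s \<sigma>)) (fibre_sum n F s)"
    using conv_gdelta_fibre_sum[OF assms(1) fibre_group_closed(3)[OF assms(2)]] assms(1) \<sigma>
    by (simp add: is_character_inv)
  also have "gstar n \<dots> = \<dots>"
    by (simp add: gstar_linear gstar_fibre_sum[OF assms(1)])
  finally show ?thesis .
qed

lemma conv_fibre_sum_self:
  assumes "is_character n s"
  shows "conv n (fibre_sum n F s) (fibre_sum n F s) =
    cscale (of_nat (card (fibre_group n F))) (fibre_sum n F s)"
proof -
  have "of_int (s \<pi>) * of_int (s \<pi>) = (1 :: complex)" if "\<pi> \<in> fibre_group n F" for \<pi>
    using assms fibre_group_symgrp[OF that] unfolding is_character_def by (metis of_int_1 of_int_mult)
  hence "conv n (fibre_sum n F s) (fibre_sum n F s) = (\<Sum>\<pi>\<in>fibre_group n F. fibre_sum n F s)"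
    unfolding fibre_sum_def[of n F s] conv_sum(1)
    unfolding fibre_sum_def[of n F s, symmetric]
    by (intro sum.cong refl) (simp add: conv_linear conv_gdelta_fibre_sum[OF assms])
  also have "\<dots> = cscale (of_nat (card (fibre_group n F))) (fibre_sum n F s)"
    by (rule ext) (simp add: fun_sum_apply)
  finally show ?thesis .
qed

lemma conv_expand: "conv n f g = (\<Sum>\<pi>\<in>symgrp n. cscale (f \<pi>) (conv n (gdelta \<pi>) g))"
  by (rule ext) (simp add: fun_sum_apply conv_gdelta_left, simp add: conv_def regular_op_def)

section \<open>Products of Young symmetrizers\<close>

abbreviation row_sym :: "nat \<Rightarrow> nat list \<Rightarrow> (nat \<Rightarrow> nat) \<Rightarrow> complex" where
  "row_sym n l \<equiv> fibre_sum n (row_of l) (\<lambda>_. 1)"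

abbreviation col_sym :: "nat \<Rightarrow> nat list \<Rightarrow> (nat \<Rightarrow> nat) \<Rightarrow> complex" where
  "col_sym n l \<equiv> fibre_sum n (col_of l) sign"

lemma young_symmetrizer_conv: "young_symmetrizer n l = conv n (row_sym n l) (col_sym n l)"
proof -
  have "conv n (row_sym n l) (col_sym n l) =
      (\<Sum>p\<in>row_group n l. conv n (gdelta p) (col_sym n l))"
    by (subst fibre_sum_def) (simp add: conv_sum(1) row_group_fibre)
  also have "\<dots> = (\<Sum>p\<in>row_group n l. \<Sum>q\<in>col_group n l. cscale (of_int (sign q)) (gdelta (p \<circ> q)))"
    unfolding fibre_sum_def conv_sum(2) col_group_fibre
    by (intro sum.cong refl)
       (auto simp: conv_linear conv_gdelta_gdelta fibre_group_symgrp row_group_fibre)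
  also have "\<dots> = young_symmetrizer n l"
    by (rule ext)
       (simp add: young_symmetrizer_def fun_sum_apply sum.cartesian_product gdelta_def
          if_distrib[of "\<lambda>x. _ * x"] case_prod_unfold cong: if_cong)
  finally show ?thesis ..
qed

lemma young_symmetrizer_galg [simp]: "young_symmetrizer n l \<in> galg n"
  by (simp add: young_symmetrizer_conv)

text \<open>The row symmetrizer absorbs the row transposition \<open>t\<close> with factor 1. Since
  \<open>t \<sigma> = \<sigma> t'\<close>, it can be moved to the right, where the column
  antisymmetrizer absorbs \<open>t'\<close> with factor -1. So the product equals its
  negative.\<close>

lemma row_gdelta_col_eq_0:
  assumes "\<sigma> \<in> symgrp n" "\<not> rows_transversal n l m (inv \<sigma>)"
  shows "conv n (row_sym n l) (conv n (gdelta \<sigma>) (col_sym n m)) = 0"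
proof -
  obtain x y where xy: "x < n" "y < n" "x \<noteq> y" "row_of l x = row_of l y"
    "col_of m (inv \<sigma> x) = col_of m (inv \<sigma> y)"
    using assms(2) by (auto simp: rows_transversal_def)
  let ?t = "transpose x y" and ?t' = "transpose (inv \<sigma> x) (inv \<sigma> y)"
  let ?z = "conv n (row_sym n l) (conv n (gdelta \<sigma>) (col_sym n m))"
  have t: "?t \<in> fibre_group n (row_of l)" "?t' \<in> fibre_group n (col_of m)"
    using xy assms(1) by (auto intro!: fibre_group_transpose)
  hence t': "?t \<in> symgrp n" "?t' \<in> symgrp n" by (auto intro: fibre_group_symgrp)
  have comm: "?t \<circ> \<sigma> = \<sigma> \<circ> ?t'"
  proof
    fix k
    have "\<sigma> k = x \<longleftrightarrow> k = inv \<sigma> x" "\<sigma> k = y \<longleftrightarrow> k = inv \<sigma> y"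
      using assms(1) by (metis symgrp_inv_o(5,6))+
    thus "(?t \<circ> \<sigma>) k = (\<sigma> \<circ> ?t') k" using assms(1) by (simp add: transpose_def)
  qed
  have "?z = conv n (conv n (row_sym n l) (gdelta ?t)) (conv n (gdelta \<sigma>) (col_sym n m))"
    using conv_fibre_sum_gdelta[OF is_character_1 t(1)] by simp
  also have "\<dots> = conv n (row_sym n l) (conv n (conv n (gdelta ?t) (gdelta \<sigma>)) (col_sym n m))"
    by (simp add: conv_assoc)
  also have "conv n (gdelta ?t) (gdelta \<sigma>) = conv n (gdelta \<sigma>) (gdelta ?t')"
    using t' assms(1) comm by (simp add: conv_gdelta_gdelta)
  also have "conv n (row_sym n l) (conv n \<dots> (col_sym n m)) =
      conv n (row_sym n l) (conv n (gdelta \<sigma>) (conv n (gdelta ?t') (col_sym n m)))"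
    by (simp add: conv_assoc)
  also have "conv n (gdelta ?t') (col_sym n m) = cscale (-1) (col_sym n m)"
    using conv_gdelta_fibre_sum[OF is_character_sign t(2)] xy(3) assms(1)
    by (simp add: sign_swap_id symgrp_inj[OF symgrp_inv])
  also have "conv n (row_sym n l) (conv n (gdelta \<sigma>) (cscale (-1) (col_sym n m))) = cscale (-1) ?z"
    by (simp only: conv_linear)
  finally have "?z = cscale (-1) ?z" .
  hence "?z k = -1 * ?z k" for k by (metis cscale_apply)
  moreover have "w = 0" if "w = -1 * w" for w :: complex
    using that by (simp add: complex_eq_iff)
  ultimately show ?thesis by (intro ext) (metis zero_fun_apply)
qed

text \<open>By linearity it suffices to treat a single permutation. Either the product vanishes, or
  the permutation is \<open>p \<circ> q\<close> with \<open>p\<close> in the row group and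
  \<open>q\<close> in the column group, and both factors are absorbed.\<close>

lemma row_conv_col_scalar:
  assumes "shape n l"
  shows "\<exists>\<kappa>. conv n (row_sym n l) (conv n f (col_sym n l)) = cscale \<kappa> (young_symmetrizer n l)"
proof -
  have *: "\<exists>\<kappa>. conv n (row_sym n l) (conv n (gdelta \<sigma>) (col_sym n l)) = cscale \<kappa> (young_symmetrizer n l)"
    if \<sigma>: "\<sigma> \<in> symgrp n" for \<sigma>
  proof (cases "rows_transversal n l l (inv \<sigma>)")
    case False
    thus ?thesis using row_gdelta_col_eq_0[OF \<sigma>, of l l] by (metis cfun.scale_zero_left)
  next
    case True
    from rows_transversal_factor[OF assms \<sigma> this] obtain p q where pq:
      "p \<in> fibre_group n (row_of l)" "q \<in> fibre_group n (col_of l)" "\<sigma> = p \<circ> q"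
      by (auto simp: row_group_fibre col_group_fibre)
    have "conv n (row_sym n l) (conv n (gdelta \<sigma>) (col_sym n l)) =
        conv n (conv n (row_sym n l) (gdelta p)) (conv n (gdelta q) (col_sym n l))"
      using conv_gdelta_gdelta[OF pq(1,2)[THEN fibre_group_symgrp]] pq(3) by (simp add: conv_assoc flip: conv_assoc[of n "gdelta p"])
    also have "\<dots> = cscale (of_int (sign q)) (young_symmetrizer n l)"
      using conv_fibre_sum_gdelta[OF is_character_1 pq(1)] conv_gdelta_fibre_sum[OF is_character_sign pq(2)]
      by (simp add: conv_linear young_symmetrizer_conv)
    finally show ?thesis by blast
  qed
  then obtain \<kappa> where \<kappa>: "\<And>\<sigma>. \<sigma> \<in> symgrp n \<Longrightarrow>
      conv n (row_sym n l) (conv n (gdelta \<sigma>) (col_sym n l)) = cscale (\<kappa> \<sigma>) (young_symmetrizer n l)"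
    by metis
  have "conv n (row_sym n l) (conv n f (col_sym n l)) =
      (\<Sum>\<sigma>\<in>symgrp n. cscale (f \<sigma> * \<kappa> \<sigma>) (young_symmetrizer n l))"
    unfolding conv_expand[of n f] conv_sum(2)
    by (intro sum.cong refl) (simp add: conv_linear \<kappa>)
  also have "\<dots> = cscale (\<Sum>\<sigma>\<in>symgrp n. f \<sigma> * \<kappa> \<sigma>) (young_symmetrizer n l)"
    by (rule cfun.scale_sum_left[symmetric])
  finally show ?thesis by blast
qed

lemma row_conv_col_dominance:
  assumes "shape n l" "shape n m" "conv n (row_sym n l) (conv n f (col_sym n m)) \<noteq> 0"
  shows "sum_list (take k l) \<le> sum_list (take k m)"
proof -
  have "\<exists>\<sigma>\<in>symgrp n. conv n (row_sym n l) (conv n (gdelta \<sigma>) (col_sym n m)) \<noteq> 0"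
  proof (rule ccontr)
    assume "\<not> ?thesis"
    hence "conv n (row_sym n l) (conv n f (col_sym n m)) = 0"
      unfolding conv_expand[of n f] conv_sum(2) conv_linear by (intro sum.neutral) simp
    thus False using assms(3) by simp
  qed
  then obtain \<sigma> where "\<sigma> \<in> symgrp n" "rows_transversal n l m (inv \<sigma>)"
    using row_gdelta_col_eq_0 by blast
  thus ?thesis using rows_transversal_dominance[OF assms(1,2)] symgrp_inv by blast
qed

text \<open>A nonzero product would force dominance both ways. Read as row symmetrizer of
  \<open>l\<close> and column antisymmetrizer of \<open>m\<close> it gives one direction; its inner
  factor, from the columns of \<open>l\<close> to the rows of \<open>m\<close>, becomes after
  \<open>gstar\<close> the same situation with \<open>l\<close> and \<open>m\<close>
  exchanged.\<close>

lemma young_conv_young_neq: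
  assumes "shape n l" "shape n m" "l \<noteq> m"
  shows "conv n (young_symmetrizer n l) (conv n f (young_symmetrizer n m)) = 0"
proof (rule ccontr)
  let ?z = "conv n (young_symmetrizer n l) (conv n f (young_symmetrizer n m))"
  assume nz: "?z \<noteq> 0"
  have "?z = conv n (row_sym n l) (conv n (conv n (col_sym n l) (conv n f (row_sym n m))) (col_sym n m))"
    by (simp add: young_symmetrizer_conv conv_assoc)
  hence le: "sum_list (take k l) \<le> sum_list (take k m)" for k
    using row_conv_col_dominance[OF assms(1,2)] nz by metis
  let ?y = "conv n (col_sym n l) (conv n f (row_sym n m))"
  have "?z = conv n (row_sym n l) (conv n ?y (col_sym n m))"
    by (simp add: young_symmetrizer_conv conv_assoc)
  hence y: "?y \<noteq> 0" using nz by (auto simp: conv_linear)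
  have "gstar n ?y = conv n (row_sym n m) (conv n (gstar n f) (col_sym n l))"
    by (simp add: gstar_conv gstar_fibre_sum is_character_1 is_character_sign conv_assoc)
  moreover have "gstar n ?y \<noteq> 0"
    using y gstar_gstar[of ?y n] by (metis conv_galg fibre_sum_galg gstar_linear(3))
  ultimately have "sum_list (take k m) \<le> sum_list (take k l)" for k
    using row_conv_col_dominance[OF assms(2,1)] by metis
  with le have "l = m" using shape_eqI[OF assms(1,2)] by (meson order_antisym)
  thus False using assms(3) by simp
qed

text \<open>If \<open>id = p \<circ> q\<close>, then \<open>q\<close> keeps the row and the column
  of every cell, so the trivial factorization is the only one.\<close>

lemma young_symmetrizer_id:
  assumes "shape n l"
  shows "young_symmetrizer n l id = 1"
proof -
  have "p = id \<and> q = id" if "p \<in> row_group n l" "q \<in> col_group n l" "id = p \<circ> q" for p q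
  proof -
    have q: "q \<in> symgrp n" and p: "p \<in> symgrp n"
      using that by (auto simp: row_group_def col_group_def)
    have "q k = k" for k
    proof (cases "k < n")
      case True
      have "row_of l (p (q k)) = row_of l (q k)" using that True q by (auto simp: row_group_def)
      moreover have "p (q k) = k" using that(3) by (metis comp_apply id_apply)
      moreover have "col_of l (q k) = col_of l k" using that True by (auto simp: col_group_def)
      ultimately show ?thesis
        using True q assms by - (rule cell_inj[of _ l]; auto simp: shape_def)
    next
      case False thus ?thesis using q by (simp add: symgrp_def permutes_not_in)
    qed
    hence "q = id" by auto
    with that show ?thesis by simp
  qed
  moreover have "id \<in> row_group n l" "id \<in> col_group n l"
    by (simp_all add: row_group_fibre col_group_fibre fibre_group_closed)
  ultimately have "young_symmetrizer n l id =
      (\<Sum>x\<in>row_group n l \<times> col_group n l. if x = (id, id) then 1 else 0)"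
    unfolding young_symmetrizer_def by (intro sum.cong refl) (auto simp: split_beta prod_eq_iff)
  also have "\<dots> = 1"
    using \<open>id \<in> row_group n l\<close> \<open>id \<in> col_group n l\<close>
    by (subst sum.delta) (auto simp: row_group_fibre col_group_fibre)
  finally show ?thesis .
qed

lemma young_symmetrizer_neq_0: "shape n l \<Longrightarrow> young_symmetrizer n l \<noteq> 0"
  using young_symmetrizer_id by fastforce

lemma gstar_young: "gstar n (young_symmetrizer n l) = conv n (col_sym n l) (row_sym n l)"
  by (simp add: young_symmetrizer_conv gstar_conv gstar_fibre_sum is_character_1 is_character_sign)

lemma card_fibre_group_neq_0 [simp]: "card (fibre_group n F) \<noteq> 0"
  using fibre_group_closed(1) finite_fibre_group card_0_eq by blast

text \<open>Makes the symmetrizer a nonzero multiple of an idempotent, so that it acts on its own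
  image by an invertible scalar.\<close>

lemma young_square:
  assumes "shape n l"
  obtains \<mu> where "\<mu> \<noteq> 0"
    "conv n (young_symmetrizer n l) (young_symmetrizer n l) = cscale \<mu> (young_symmetrizer n l)"
proof -
  let ?a = "row_sym n l" and ?b = "col_sym n l" and ?c = "young_symmetrizer n l"
  have "conv n ?c ?c = conv n ?a (conv n (conv n ?b ?a) ?b)"
    by (simp add: young_symmetrizer_conv conv_assoc)
  then obtain \<mu> where \<mu>: "conv n ?c ?c = cscale \<mu> ?c"
    using row_conv_col_scalar[OF assms, of "conv n ?b ?a"] by auto
  \<comment> \<open>By positivity: \<open>(a b a)\<^sup>* (a b a)\<close> is a multiple of \<open>c c a\<close>, and \<open>c c\<^sup>*\<close> one of \<open>a b a\<close>.\<close>
  have "\<mu> \<noteq> 0"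
  proof
    assume "\<mu> = 0"
    hence 0: "conv n ?c ?c = 0" using \<mu> by simp
    let ?d = "conv n ?a (conv n ?b ?a)"
    have aa: "conv n ?a (conv n ?a f) = cscale (of_nat (card (fibre_group n (row_of l)))) (conv n ?a f)" for f
      using conv_fibre_sum_self[OF is_character_1, of n "row_of l"]
      by (simp add: conv_assoc[symmetric] conv_linear)
    have bb: "conv n ?b (conv n ?b f) = cscale (of_nat (card (fibre_group n (col_of l)))) (conv n ?b f)" for f
      using conv_fibre_sum_self[OF is_character_sign, of n "col_of l"]
      by (simp add: conv_assoc[symmetric] conv_linear)
    have "conv n (gstar n ?d) ?d = conv n ?d ?d"
      by (simp add: gstar_conv gstar_fibre_sum is_character_1 is_character_sign conv_assoc)
    also have "\<dots> = cscale (of_nat (card (fibre_group n (row_of l)))) (conv n (conv n ?c ?c) ?a)"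
      by (simp add: conv_assoc aa conv_linear young_symmetrizer_conv)
    finally have "conv n (gstar n ?d) ?d = 0" using 0 by (simp add: conv_linear)
    hence d: "?d = 0" by (rule conv_gstar_eq_0[rotated]) simp
    have "conv n (gstar n (gstar n ?c)) (gstar n ?c) =
        cscale (of_nat (card (fibre_group n (col_of l)))) ?d"
      unfolding gstar_young
      by (simp add: gstar_conv gstar_fibre_sum is_character_1 is_character_sign conv_assoc bb conv_linear)
    hence "conv n (gstar n (gstar n ?c)) (gstar n ?c) = 0" by (simp only: d cfun.scale_zero_right)
    hence "gstar n ?c = 0" by (rule conv_gstar_eq_0[OF galg_closed(6)])
    hence "?c = 0" by (metis gstar_gstar gstar_linear(3) young_symmetrizer_galg)
    thus False using young_symmetrizer_neq_0[OF assms] by simp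
  qed
  with \<mu> that show ?thesis by blast
qed

text \<open>Up to a nonzero scalar \<open>gstar n c\<close> is its own square
  \<open>b a b a\<close>, which contains \<open>c = a b\<close> in the middle; this \<open>c\<close>
  then meets the symmetrizer of the other shape.\<close>

lemma gstar_young_conv_young_neq:
  assumes "shape n l" "shape n m" "l \<noteq> m"
  shows "conv n (gstar n (young_symmetrizer n l)) (conv n f (young_symmetrizer n m)) = 0"
proof -
  let ?c = "young_symmetrizer n l"
  obtain \<mu> where \<mu>: "\<mu> \<noteq> 0" "conv n ?c ?c = cscale \<mu> ?c" by (rule young_square[OF assms(1)])
  have "cscale (cnj \<mu>) (gstar n ?c) = conv n (gstar n ?c) (gstar n ?c)"
    using arg_cong[OF \<mu>(2), of "gstar n"] by (simp add: gstar_linear gstar_conv)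
  also have "\<dots> = conv n (col_sym n l) (conv n ?c (row_sym n l))"
    by (simp add: gstar_young) (simp add: young_symmetrizer_conv conv_assoc)
  finally have "cscale (cnj \<mu>) (conv n (gstar n ?c) (conv n f (young_symmetrizer n m))) =
      conv n (col_sym n l) (conv n ?c (conv n (conv n (row_sym n l) f) (young_symmetrizer n m)))"
    by (metis conv_linear(5) conv_assoc)
  also have "\<dots> = 0" by (simp only: young_conv_young_neq[OF assms] conv_linear)
  finally show ?thesis using \<mu>(1) by simp
qed

text \<open>Both products are multiples of \<open>b c\<close>: between the outer \<open>b\<close>
  and the final \<open>b\<close> stands an expression \<open>a f b\<close>, which is a multiple of
  \<open>c\<close>. Evaluation at \<open>id\<close> identifies the two scalars with the inner
  products. The identity is cross-multiplied to avoid division.\<close>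

lemma gstar_ideal_conv:
  assumes "shape n l"
  shows "cscale (inner_on (symgrp n) (young_symmetrizer n l) (young_symmetrizer n l))
      (conv n (gstar n (conv n f (young_symmetrizer n l))) (conv n g (young_symmetrizer n l))) =
    cscale (inner_on (symgrp n) (conv n f (young_symmetrizer n l)) (conv n g (young_symmetrizer n l)))
      (conv n (gstar n (young_symmetrizer n l)) (young_symmetrizer n l))"
proof -
  let ?a = "row_sym n l" and ?b = "col_sym n l" and ?c = "young_symmetrizer n l"
  let ?h = "conv n (gstar n f) g" and ?N = "of_nat (card (fibre_group n (row_of l))) :: complex"
  have N: "?N \<noteq> 0" by (simp only: of_nat_eq_0_iff) simp
  obtain \<kappa> where \<kappa>: "conv n ?a (conv n (conv n ?h ?a) ?b) = cscale \<kappa> ?c"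
    using row_conv_col_scalar[OF assms] by blast
  have "conv n (gstar n (conv n f ?c)) (conv n g ?c) =
      conv n ?b (conv n ?a (conv n (conv n ?h ?a) ?b))"
    by (simp add: gstar_conv gstar_young) (simp add: young_symmetrizer_conv conv_assoc)
  also have "\<dots> = cscale \<kappa> (conv n ?b ?c)" by (simp only: \<kappa> conv_linear)
  finally have 1: "conv n (gstar n (conv n f ?c)) (conv n g ?c) = cscale \<kappa> (conv n ?b ?c)" .
  have "conv n (gstar n ?c) ?c = conv n ?b (conv n (conv n ?a ?a) ?b)"
    by (simp add: gstar_young) (simp add: young_symmetrizer_conv conv_assoc)
  also have "\<dots> = cscale ?N (conv n ?b ?c)"
    by (simp only: conv_fibre_sum_self[OF is_character_1] conv_linear young_symmetrizer_conv)
  finally have 2: "conv n (gstar n ?c) ?c = cscale ?N (conv n ?b ?c)" .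
  have "inner_on (symgrp n) (conv n f ?c) (conv n g ?c) = \<kappa> * conv n ?b ?c id"
    "inner_on (symgrp n) ?c ?c = ?N * conv n ?b ?c id"
    using 1 2 by (simp_all add: conv_gstar_id[symmetric])
  thus ?thesis by (simp add: 1 2)
qed

section \<open>Completeness\<close>

lemma independent_orthogonal:
  assumes "finite S" "\<And>x. x \<in> S \<Longrightarrow> inner_on I x x \<noteq> 0"
    "\<And>x y. x \<in> S \<Longrightarrow> y \<in> S \<Longrightarrow> x \<noteq> y \<Longrightarrow> inner_on I x y = 0"
  shows "cfun.independent S"
proof (rule cfun.independent_if_scalars_zero[OF assms(1)])
  fix f y assume 0: "(\<Sum>x\<in>S. cscale (f x) x) = 0" and y: "y \<in> S"
  have "0 = inner_on I y (\<Sum>x\<in>S. cscale (f x) x)" by (simp only: 0 inner_on_linear)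
  also have "\<dots> = (\<Sum>x\<in>S. f x * inner_on I y x)"
    by (simp add: inner_on_sum inner_on_linear)
  also have "\<dots> = (\<Sum>x\<in>S. if x = y then f y * inner_on I y y else 0)"
    using assms(3) y by (intro sum.cong refl) auto
  also have "\<dots> = f y * inner_on I y y" using assms(1) y by simp
  finally show "f y = 0" using assms(2)[OF y] by simp
qed

text \<open>An element of \<open>T\<close> outside the span of \<open>S\<close> could be added to
  \<open>S\<close>, giving an independent set larger than the generating set.\<close>

lemma span_subset_of_card_le:
  assumes "finite T" "cfun.independent S" "S \<subseteq> cfun.span T" "card T \<le> card S"
  shows "cfun.span T \<subseteq> cfun.span S"
proof (rule cfun.span_minimal)
  show "T \<subseteq> cfun.span S"
  proof
    fix t assume t: "t \<in> T"
    show "t \<in> cfun.span S"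
    proof (rule ccontr)
      assume nt: "t \<notin> cfun.span S"
      hence "cfun.independent (insert t S)" using assms(2) by (rule cfun.independent_insertI)
      moreover have "insert t S \<subseteq> cfun.span T" using assms(3) t cfun.span_base by auto
      ultimately have "finite (insert t S) \<and> card (insert t S) \<le> card T"
        by (rule cfun.independent_span_bound[OF assms(1)])
      moreover have "t \<notin> S" using nt cfun.span_base by auto
      ultimately show False using assms(4) by auto
    qed
  qed
qed simp

section \<open>Cycle types and conjugacy\<close>

definition is_cycles :: "nat list list \<Rightarrow> nat set \<Rightarrow> (nat \<Rightarrow> nat) \<Rightarrow> bool" where
  "is_cycles L S \<pi> \<longleftrightarrow> distinct L \<and> (\<Union>c\<in>set L. set c) = S \<and>
     (\<forall>c\<in>set L. c \<noteq> [] \<and> distinct c \<and> (\<forall>j<length c. \<pi> (c ! j) = c ! (Suc j mod length c))) \<and>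
     (\<forall>c\<in>set L. \<forall>c'\<in>set L. c \<noteq> c' \<longrightarrow> set c \<inter> set c' = {})"

lemma cycle_of_list_nth:
  assumes "distinct c" "j < length c"
  shows "cycle_of_list c (c ! j) = c ! (Suc j mod length c)"
proof -
  have "map (cycle_of_list c) c = rotate 1 c" using cyclic_rotation[OF assms(1), of 1] by simp
  hence "map (cycle_of_list c) c ! j = rotate 1 c ! j" by simp
  thus ?thesis using assms(2) by (simp add: nth_rotate1)
qed

text \<open>The second conjunct strengthens the induction: it says that the permutation built so far
  fixes the points of the next cycle.\<close>

lemma cycle_decomp_is_cycles: "cycle_decomp S \<pi> \<Longrightarrow> \<exists>L. is_cycles L S \<pi> \<and> (\<forall>x. x \<notin> S \<longrightarrow> \<pi> x = x)"
proof (induction rule: cycle_decomp.induct)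
  case empty
  show ?case by (rule exI[of _ "[]"]) (simp add: is_cycles_def)
next
  case (comp I p cs)
  then obtain L where L: "is_cycles L I p" and fx: "\<And>x. x \<notin> I \<Longrightarrow> p x = x" by blast
  show ?case
  \<comment> \<open>\<open>cycle_decomp\<close> admits empty cycles, whereas
    \<open>is_cycles\<close> excludes them, so that the cycle lengths can be the positive parts of a
    partition.\<close>
  proof (cases "cs = []")
    case True
    thus ?thesis using L fx by (intro exI[of _ L]) auto
  next
    case False
    have sub: "set c \<subseteq> I" if "c \<in> set L" for c using that L by (auto simp: is_cycles_def)
    have out: "cycle_of_list cs y = y" if "y \<in> I" for y
      using that comp.hyps(3) by (intro id_outside_supp) auto
    have "is_cycles (cs # L) (set cs \<union> I) (cycle_of_list cs \<circ> p)"
      unfolding is_cycles_def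
    proof (intro conjI ballI impI allI)
      show "distinct (cs # L)"
        using L sub False comp.hyps(3) unfolding is_cycles_def
        by (metis distinct.simps(2) Int_absorb2 set_empty)
      show "(\<Union>c\<in>set (cs # L). set c) = set cs \<union> I" using L by (auto simp: is_cycles_def)
    next
      fix c assume c: "c \<in> set (cs # L)"
      show "c \<noteq> []" "distinct c" using c L comp.hyps(2) False by (auto simp: is_cycles_def)
      fix j assume j: "j < length c"
      show "(cycle_of_list cs \<circ> p) (c ! j) = c ! (Suc j mod length c)"
      proof (cases "c = cs")
        case True
        hence "c ! j \<in> set cs" using j by simp
        hence "p (c ! j) = c ! j" using comp.hyps(3) by (intro fx) auto
        thus ?thesis using True comp.hyps(2) j by (simp add: cycle_of_list_nth)
      next
        case False
        hence cL: "c \<in> set L" using c by simp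
        hence "p (c ! j) = c ! (Suc j mod length c)" using L j by (auto simp: is_cycles_def)
        moreover have "c ! (Suc j mod length c) \<in> I"
          using sub[OF cL] j by (metis gr_implies_not0 mod_less_divisor neq0_conv nth_mem subsetD)
        ultimately show ?thesis using out by simp
      qed
    next
      fix c c' assume "c \<in> set (cs # L)" "c' \<in> set (cs # L)" "c \<noteq> c'"
      moreover have "set b \<inter> set b' = {}" if "b \<in> set L" "b' \<in> set L" "b \<noteq> b'" for b b'
        using L that by (simp add: is_cycles_def)
      moreover have "set cs \<inter> set b = {}" if "b \<in> set L" for b using sub[OF that] comp.hyps(3) by blast
      ultimately show "set c \<inter> set c' = {}" by (metis inf_commute set_ConsD)
    qed
    moreover have "\<forall>x. x \<notin> set cs \<union> I \<longrightarrow> (cycle_of_list cs \<circ> p) x = x"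
      using fx by (simp add: id_outside_supp)
    ultimately show ?thesis by blast
  qed
qed

definition cells :: "nat list \<Rightarrow> (nat \<times> nat) set" where
  "cells l = {(i, j). i < length l \<and> j < l ! i}"

text \<open>A labelling of the Young diagram in which the permutation shifts every row cyclically.
  Two permutations with such labellings of the same diagram are conjugate by comparing
  labels.\<close>

definition has_cycle_type :: "nat \<Rightarrow> (nat \<Rightarrow> nat) \<Rightarrow> nat list \<Rightarrow> bool" where
  "has_cycle_type n \<pi> l \<longleftrightarrow> (\<exists>F. bij_betw F (cells l) {..<n} \<and>
     (\<forall>(i, j)\<in>cells l. \<pi> (F (i, j)) = F (i, Suc j mod l ! i)))"

lemma cycle_type_exists:
  assumes "\<pi> \<in> symgrp n"
  shows "\<exists>l. shape n l \<and> has_cycle_type n \<pi> l"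
proof -
  have "cycle_decomp {..<n} \<pi>"
    using assms by (intro cycle_decomposition) (auto simp: symgrp_def)
  then obtain L0 where L0: "is_cycles L0 {..<n} \<pi>" using cycle_decomp_is_cycles by blast
  \<comment> \<open>Longest cycles first, so that the list of lengths decreases weakly.\<close>
  define L where "L = rev (sort_key length L0)"
  have L: "is_cycles L {..<n} \<pi>" using L0 by (simp add: L_def is_cycles_def)
  define l where "l = map length L"
  have nth: "L ! i \<in> set L" "l ! i = length (L ! i)" if "i < length L" for i
    using that by (auto simp: l_def)
  have "sum_list l = (\<Sum>c\<in>set L. card (set c))"
    unfolding l_def using L
    by (subst sum_list_distinct_conv_sum_set) (auto simp: is_cycles_def distinct_card)
  also have "\<dots> = card (\<Union>c\<in>set L. set c)"
    by (rule card_UN_disjoint[symmetric]) (use L in \<open>auto simp: is_cycles_def\<close>)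
  also have "\<dots> = n" using L by (simp add: is_cycles_def)
  finally have "sum_list l = n" .
  moreover have "sorted_wrt (\<ge>) l"
  proof -
    have "sorted (map length (sort_key length L0))" by simp
    thus ?thesis by (simp add: l_def L_def rev_map[symmetric] sorted_wrt_rev)
  qed
  moreover have "0 \<notin> set l" using L by (auto simp: l_def is_cycles_def)
  ultimately have "shape n l" by (simp add: shape_def)
  moreover have "has_cycle_type n \<pi> l"
    unfolding has_cycle_type_def
  proof (intro exI conjI ballI)
    let ?F = "\<lambda>(i, j). L ! i ! j"
    show "bij_betw ?F (cells l) {..<n}"
      unfolding bij_betw_def
    proof
      show "inj_on ?F (cells l)"
      proof (rule inj_onI, clarify)
        fix i j i' j' assume ij: "(i, j) \<in> cells l" "(i', j') \<in> cells l" "L ! i ! j = L ! i' ! j'"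
        hence less: "i < length L" "i' < length L" "j < length (L ! i)" "j' < length (L ! i')"
          by (auto simp: cells_def l_def)
        have "L ! i ! j \<in> set (L ! i)" using less by simp
        moreover have "L ! i ! j \<in> set (L ! i')" using ij(3) less by simp
        ultimately have "L ! i = L ! i'" using L nth(1) less unfolding is_cycles_def by blast
        hence "i = i'" using L less by (auto simp: is_cycles_def nth_eq_iff_index_eq)
        moreover have "distinct (L ! i)" using L nth(1) less by (auto simp: is_cycles_def)
        ultimately show "i = i' \<and> j = j'" using ij(3) less by (simp add: nth_eq_iff_index_eq)
      qed
      show "?F ` cells l = {..<n}"
      proof (intro equalityI subsetI)
        fix x assume "x \<in> ?F ` cells l"
        then obtain i j where "i < length L" "j < length (L ! i)" "x = L ! i ! j"
          by (auto simp: cells_def l_def)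
        hence "x \<in> (\<Union>c\<in>set L. set c)" by (metis UN_I nth_mem)
        thus "x \<in> {..<n}" using L unfolding is_cycles_def by metis
      next
        fix x assume "x \<in> {..<n}"
        hence "x \<in> (\<Union>c\<in>set L. set c)" using L unfolding is_cycles_def by metis
        then obtain c where "c \<in> set L" "x \<in> set c" by blast
        then obtain i j where "i < length L" "j < length (L ! i)" "x = L ! i ! j"
          by (metis in_set_conv_nth)
        thus "x \<in> ?F ` cells l" by (intro image_eqI[of _ _ "(i, j)"]) (auto simp: cells_def l_def)
      qed
    qed
    fix p assume "p \<in> cells l"
    thus "case p of (i, j) \<Rightarrow> \<pi> (?F (i, j)) = ?F (i, Suc j mod l ! i)"
      using L nth by (auto simp: cells_def l_def is_cycles_def)
  qed
  ultimately show ?thesis by blast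
qed

text \<open>The conjugating permutation sends the label of each cell under \<open>F\<close> to its
  label under \<open>G\<close>, and fixes everything from \<open>n\<close> on.\<close>

lemma same_cycle_type_conjugate:
  assumes "\<pi> \<in> symgrp n" "\<sigma> \<in> symgrp n" "has_cycle_type n \<pi> l" "has_cycle_type n \<sigma> l"
  shows "\<exists>h\<in>symgrp n. \<sigma> = h \<circ> \<pi> \<circ> inv h"
proof -
  obtain F G where F: "bij_betw F (cells l) {..<n}" "\<forall>(i, j)\<in>cells l. \<pi> (F (i, j)) = F (i, Suc j mod l ! i)"
    and G: "bij_betw G (cells l) {..<n}" "\<forall>(i, j)\<in>cells l. \<sigma> (G (i, j)) = G (i, Suc j mod l ! i)"
    using assms(3,4) by (auto simp: has_cycle_type_def)
  define h where "h x = (if x < n then G (inv_into (cells l) F x) else x)" for x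
  have hF: "h (F p) = G p" if "p \<in> cells l" for p
    using F(1) that bij_betwE[OF F(1)] by (auto simp: h_def bij_betw_def inv_into_f_f)
  have "bij_betw (G \<circ> inv_into (cells l) F) {..<n} {..<n}"
    by (rule bij_betw_trans[OF bij_betw_inv_into[OF F(1)] G(1)])
  hence "bij_betw h {..<n} {..<n}"
    by (rule bij_betw_cong[THEN iffD1, rotated]) (simp add: h_def)
  hence h: "h \<in> symgrp n"
    unfolding symgrp_def mem_Collect_eq by (rule bij_imp_permutes) (simp add: h_def)
  have "h (\<pi> x) = \<sigma> (h x)" for x
  proof (cases "x < n")
    case True
    then obtain i j where ij: "(i, j) \<in> cells l" "x = F (i, j)"
      using F(1) by (metis bij_betw_iff_bijections lessThan_iff surj_pair)
    have "(i, Suc j mod l ! i) \<in> cells l"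
      using ij(1) by (auto simp: cells_def)
    thus ?thesis using ij F(2) G(2) hF by force
  next
    case False
    thus ?thesis using assms(1,2) by (simp add: h_def symgrp_def permutes_not_in)
  qed
  hence "\<sigma> \<circ> h = h \<circ> \<pi>" by auto
  hence "h \<circ> \<pi> \<circ> inv h = (\<sigma> \<circ> h) \<circ> inv h" by (simp only:)
  also have "\<dots> = \<sigma> \<circ> (h \<circ> inv h)" by (rule comp_assoc)
  finally have "\<sigma> = h \<circ> \<pi> \<circ> inv h" using h by simp
  with h show ?thesis by blast
qed

lemma finite_shape: "finite {l. shape n l}"
proof (rule finite_subset)
  show "{l. shape n l} \<subseteq> {l. set l \<subseteq> {..n} \<and> length l \<le> n}"
  proof
    fix l assume "l \<in> {l. shape n l}"
    hence l: "shape n l" by simp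
    have "set l \<subseteq> {..n}" using l member_le_sum_list by (fastforce simp: shape_def)
    moreover have "length l \<le> sum_list l" if "0 \<notin> set l" for l :: "nat list"
      using that by (induction l) auto
    hence "length l \<le> n" using l by (auto simp: shape_def)
    ultimately show "l \<in> {l. set l \<subseteq> {..n} \<and> length l \<le> n}" by simp
  qed
  show "finite {l. set l \<subseteq> {..n} \<and> length l \<le> n}" by (simp add: finite_lists_length_le)
qed

section \<open>The centre of the group algebra\<close>

definition central :: "nat \<Rightarrow> ((nat \<Rightarrow> nat) \<Rightarrow> complex) set" where
  "central n = {f \<in> galg n. \<forall>h\<in>symgrp n. conv n (gdelta h) f = conv n f (gdelta h)}"

lemma central_conjugate:
  assumes "f \<in> central n" "h \<in> symgrp n" "\<pi> \<in> symgrp n"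
  shows "f (h \<circ> \<pi> \<circ> inv h) = f \<pi>"
proof -
  have "conv n (gdelta h) f (h \<circ> \<pi>) = conv n f (gdelta h) (h \<circ> \<pi>)"
    using assms by (simp add: central_def)
  thus ?thesis
    using assms by (simp add: conv_gdelta_right) (simp add: conv_gdelta_left regular_op_def)
qed

text \<open>\<open>SOME\<close> picks one type for each permutation, so these are indicators of
  disjoint blocks, one for each shape. Permutations in one block are conjugate, hence central
  elements are constant on blocks.\<close>

definition cyc_class :: "nat \<Rightarrow> nat list \<Rightarrow> (nat \<Rightarrow> nat) \<Rightarrow> complex" where
  "cyc_class n l = (\<lambda>\<pi>. if \<pi> \<in> symgrp n \<and> (SOME l. shape n l \<and> has_cycle_type n \<pi> l) = l then 1 else 0)"

lemma central_subset_span: "central n \<subseteq> cfun.span (cyc_class n ` {l. shape n l})"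
proof
  fix f assume f: "f \<in> central n"
  define T where "T \<pi> = (SOME l. shape n l \<and> has_cycle_type n \<pi> l)" for \<pi>
  have T: "shape n (T \<pi>)" "has_cycle_type n \<pi> (T \<pi>)" if "\<pi> \<in> symgrp n" for \<pi>
    using someI_ex[OF cycle_type_exists[OF that]] by (auto simp: T_def)
  \<comment> \<open>A representative of each block. For an empty block it is arbitrary, but the
    indicator is then zero.\<close>
  define r where "r l = (SOME \<pi>. \<pi> \<in> symgrp n \<and> T \<pi> = l)" for l
  have r: "r (T \<pi>) \<in> symgrp n" "T (r (T \<pi>)) = T \<pi>" if "\<pi> \<in> symgrp n" for \<pi>
    using someI[of "\<lambda>\<rho>. \<rho> \<in> symgrp n \<and> T \<rho> = T \<pi>" \<pi>] that by (auto simp: r_def)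
  have "f = (\<Sum>l | shape n l. cscale (f (r l)) (cyc_class n l))"
  proof
    fix \<pi>
    show "f \<pi> = (\<Sum>l | shape n l. cscale (f (r l)) (cyc_class n l)) \<pi>"
    proof (cases "\<pi> \<in> symgrp n")
      case True
      have "(\<Sum>l | shape n l. cscale (f (r l)) (cyc_class n l)) \<pi> =
          (\<Sum>l | shape n l. if l = T \<pi> then f (r (T \<pi>)) else 0)"
        unfolding fun_sum_apply using True
        by (intro sum.cong refl) (auto simp: cyc_class_def T_def)
      also have "\<dots> = f (r (T \<pi>))" using T(1)[OF True] finite_shape by simp
      also have "\<dots> = f \<pi>"
      proof -
        have "has_cycle_type n (r (T \<pi>)) (T \<pi>)" using T(2)[OF r(1)[OF True]] r(2)[OF True] by simp
        from same_cycle_type_conjugate[OF True r(1)[OF True] T(2)[OF True] this]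
        show ?thesis using central_conjugate[OF f] True by force
      qed
      finally show ?thesis ..
    next
      case False
      thus ?thesis using f by (simp add: central_def galg_def fun_sum_apply cyc_class_def)
    qed
  qed
  also have "\<dots> \<in> cfun.span (cyc_class n ` {l. shape n l})"
    by (intro cfun.span_sum cfun.span_scale cfun.span_base) auto
  finally show "f \<in> cfun.span (cyc_class n ` {l. shape n l})" .
qed

text \<open>Summing over conjugates moves the symmetrizer into the centre, while each summand stays
  in the two-sided ideal generated by it; so products for different shapes still vanish.\<close>

definition young_central :: "nat \<Rightarrow> nat list \<Rightarrow> (nat \<Rightarrow> nat) \<Rightarrow> complex" where
  "young_central n l = (\<Sum>g\<in>symgrp n. conv n (gdelta g) (conv n (young_symmetrizer n l) (gdelta (inv g))))"

lemma young_central_galg [simp]: "young_central n l \<in> galg n"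
  unfolding young_central_def by (intro galg_sum conv_galg galg_closed symgrp_inv)

lemma young_central_central: "young_central n l \<in> central n"
  unfolding central_def
proof (intro CollectI conjI ballI)
  fix h assume h: "h \<in> symgrp n"
  let ?f = "\<lambda>g. conv n (gdelta g) (conv n (young_symmetrizer n l) (gdelta (inv g)))"
  have "conv n (young_central n l) (gdelta h) = (\<Sum>g\<in>symgrp n. conv n (?f g) (gdelta h))"
    by (simp add: young_central_def conv_sum)
  also have "\<dots> = (\<Sum>g\<in>symgrp n. conv n (?f (h \<circ> g)) (gdelta h))"
    by (rule sum_symgrp_left[OF h, symmetric])
  also have "\<dots> = (\<Sum>g\<in>symgrp n. conv n (gdelta h) (?f g))"
  proof (intro sum.cong refl)
    fix g assume g: "g \<in> symgrp n"
    have "inv g = (inv g \<circ> inv h) \<circ> h" using h by (simp add: comp_assoc)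
    hence "gdelta (inv g) = conv n (gdelta (inv g \<circ> inv h)) (gdelta h)"
      using g h conv_gdelta_gdelta[of "inv g \<circ> inv h" n h] by simp
    thus "conv n (?f (h \<circ> g)) (gdelta h) = conv n (gdelta h) (?f g)"
      using g h by (simp add: conv_assoc symgrp_inv_comp flip: conv_gdelta_gdelta[of h n g])
  qed
  also have "\<dots> = conv n (gdelta h) (young_central n l)"
    by (simp add: young_central_def conv_sum)
  finally show "conv n (gdelta h) (young_central n l) = conv n (young_central n l) (gdelta h)" ..
qed simp

text \<open>Every conjugate has coefficient 1 at \<open>id\<close>, so the coefficient of the sum is
  the order of the group.\<close>

lemma young_central_neq_0:
  assumes "shape n l"
  shows "young_central n l \<noteq> 0"
proof -
  have "conv n (gdelta g) (conv n (young_symmetrizer n l) (gdelta (inv g))) id = 1"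
    if g: "g \<in> symgrp n" for g
  proof -
    have "conv n (gdelta g) (conv n (young_symmetrizer n l) (gdelta (inv g))) id =
        conv n (young_symmetrizer n l) (gdelta (inv g)) (inv g)"
      using g by (simp add: conv_gdelta_left regular_op_def)
    also have "\<dots> = 1" using g assms by (simp add: conv_gdelta_right young_symmetrizer_id)
    finally show ?thesis .
  qed
  hence "young_central n l id = of_nat (card (symgrp n))"
    by (simp add: young_central_def fun_sum_apply)
  moreover have "card (symgrp n) \<noteq> 0" using symgrp_id finite_symgrp card_0_eq by blast
  ultimately show ?thesis by (metis of_nat_eq_0_iff zero_fun_apply)
qed

text \<open>Each product of a starred summand with another summand contains \<open>gstar\<close> of
  one symmetrizer, something, and the symmetrizer of the other shape.\<close>

lemma young_central_orthogonal:
  assumes "shape n l" "shape n m" "l \<noteq> m"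
  shows "inner_on (symgrp n) (young_central n l) (young_central n m) = 0"
proof -
  let ?f = "\<lambda>l g. conv n (gdelta g) (conv n (young_symmetrizer n l) (gdelta (inv g)))"
  have "conv n (gstar n (?f l g)) (?f m h) = 0" if "g \<in> symgrp n" "h \<in> symgrp n" for g h
  proof -
    have "gstar n (?f l g) = conv n (gdelta g) (conv n (gstar n (young_symmetrizer n l)) (gdelta (inv g)))"
      using that by (simp add: gstar_conv gstar_gdelta conv_assoc)
    hence "conv n (gstar n (?f l g)) (?f m h) = conv n (gdelta g) (conv n (conv n
        (gstar n (young_symmetrizer n l)) (conv n (conv n (gdelta (inv g)) (gdelta h)) (young_symmetrizer n m)))
        (gdelta (inv h)))"
      by (simp add: conv_assoc)
    thus ?thesis by (simp only: gstar_young_conv_young_neq[OF assms] conv_linear)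
  qed
  hence "conv n (gstar n (young_central n l)) (young_central n m) = 0"
    unfolding young_central_def gstar_sum conv_sum by (intro sum.neutral ballI) blast
  thus ?thesis by (simp add: conv_gstar_id[symmetric])
qed

lemma central_subset_span_young: "central n \<subseteq> cfun.span (young_central n ` {l. shape n l})"
proof -
  let ?Z = "young_central n ` {l. shape n l}" and ?X = "cyc_class n ` {l. shape n l}"
  have nz: "inner_on (symgrp n) (young_central n l) (young_central n l) \<noteq> 0" if "shape n l" for l
    using that young_central_neq_0 galg_inner_eq_0[OF young_central_galg] by simp
  have inj: "inj_on (young_central n) {l. shape n l}"
    using young_central_orthogonal nz by (intro inj_onI) (metis mem_Collect_eq)
  have "cfun.independent ?Z"
  proof (rule independent_orthogonal[of _ "symgrp n"])
    fix x y assume "x \<in> ?Z" "y \<in> ?Z" "x \<noteq> y"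
    then obtain l m where "shape n l" "shape n m" "l \<noteq> m" "x = young_central n l" "y = young_central n m"
      by auto
    thus "inner_on (symgrp n) x y = 0" using young_central_orthogonal by simp
  qed (use finite_shape nz in auto)
  moreover have "?Z \<subseteq> cfun.span ?X" using young_central_central central_subset_span by blast
  \<comment> \<open>The orthogonal family has exactly one member for each shape, the indicators at
    most one.\<close>
  moreover have "card ?X \<le> card ?Z" using card_image[OF inj] card_image_le[OF finite_shape] by metis
  ultimately have "cfun.span ?X \<subseteq> cfun.span ?Z"
    using finite_shape by (intro span_subset_of_card_le) auto
  thus ?thesis using central_subset_span by blast
qed

lemma gdelta_id_central: "gdelta id \<in> central n"
  by (simp add: central_def)

text \<open>A column longer than \<open>d\<close> contains two equal letters, so antisymmetrizing it gives zero.\<close>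
lemma young_symmetrizer_long:
  assumes "shape n l" "d < length l"
  shows "algebra_op d n (young_symmetrizer n l) x = 0"
proof -
  let ?b = "col_sym n l"
  have "algebra_op d n ?b x a = 0" if a: "a \<in> words d n" for a
  proof -
    have "\<forall>r<length l. \<exists>k<n. row_of l k = r \<and> col_of l k = 0"
    proof (intro allI impI)
      fix r assume "r < length l"
      moreover from this have "0 < l ! r" using assms(1) by (metis gr0I nth_mem shape_def)
      ultimately show "\<exists>k<n. row_of l k = r \<and> col_of l k = 0"
        using cell_exists[of r l 0] assms(1) unfolding shape_def by metis
    qed
    then obtain k where k: "\<And>r. r < length l \<Longrightarrow> k r < n \<and> row_of l (k r) = r \<and> col_of l (k r) = 0"
      by metis
    have "\<not> inj_on (\<lambda>r. a ! k r) {..<length l}"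
    proof
      assume "inj_on (\<lambda>r. a ! k r) {..<length l}"
      moreover have "(\<lambda>r. a ! k r) ` {..<length l} \<subseteq> {..<d}"
        using a k by (auto simp: words_def subset_iff)
      ultimately have "card {..<length l} \<le> card {..<d}" by (rule card_inj_on_le) simp
      thus False using assms(2) by simp
    qed
    then obtain r s where rs: "r < length l" "s < length l" "r \<noteq> s" "a ! k r = a ! k s"
      by (auto simp: inj_on_def)
    let ?t = "transpose (k r) (k s)"
    have neq: "k r \<noteq> k s" using k rs by metis
    have t: "?t \<in> fibre_group n (col_of l)" using k rs by (intro fibre_group_transpose) auto
    have "wact n ?t a = a"
      by (rule nth_equalityI) (use a rs(4) in \<open>auto simp: words_def transpose_def\<close>)
    hence "perm_op d n ?t (algebra_op d n ?b x) a = algebra_op d n ?b x a"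
      using fibre_group_symgrp[OF t] a by (simp add: perm_op_apply)
    moreover have "perm_op d n ?t (algebra_op d n ?b x) = algebra_op d n (conv n (gdelta ?t) ?b) x"
      using fibre_group_symgrp[OF t] by (simp add: algebra_op_conv algebra_op_gdelta)
    moreover have "conv n (gdelta ?t) ?b = cscale (-1) ?b"
      using conv_gdelta_fibre_sum[OF is_character_sign t] neq by (simp add: sign_swap_id)
    ultimately have "algebra_op d n ?b x a = -1 * algebra_op d n ?b x a"
      by (metis algebra_op_linear(2) cscale_apply)
    thus ?thesis by (simp add: complex_eq_iff)
  qed
  hence "algebra_op d n ?b x = 0"
    by (intro ext) (metis algebra_op_apply zero_fun_apply)
  thus ?thesis by (simp add: young_symmetrizer_conv algebra_op_conv algebra_op_linear)
qed

text \<open>An explicit form of the isotypic component: the image of the left ideal generated by the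
  symmetrizer. It is compared with \<open>isotypic\<close> below.\<close>

definition young_component :: "nat \<Rightarrow> nat \<Rightarrow> nat list \<Rightarrow> tensor set" where
  "young_component d n l =
     cfun.span {algebra_op d n (conv n f (young_symmetrizer n l)) x | f x. x \<in> tensor_space d n}"

text \<open>Expand the unit of the group algebra in the central elements and apply it to
  \<open>x\<close>. A summand conjugated by \<open>g\<close> sends \<open>x\<close> into the
  component of its shape, and shapes with more than \<open>d\<close> rows contribute zero.\<close>

lemma tensor_space_span_components:
  "tensor_space d n \<subseteq> cfun.span (\<Union>l\<in>partitions_upto d n. young_component d n l)"
proof
  fix x assume x: "x \<in> tensor_space d n"
  let ?T = "cfun.span (\<Union>l\<in>partitions_upto d n. young_component d n l)"
  let ?W = "{f. algebra_op d n f x \<in> ?T}"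
  have "cfun.subspace ?W"
    unfolding cfun.subspace_def
    by (auto simp: algebra_op_linear cfun.span_zero cfun.span_add cfun.span_scale)
  moreover have "young_central n ` {l. shape n l} \<subseteq> ?W"
  proof clarify
    fix l assume l: "shape n l"
    show "algebra_op d n (young_central n l) x \<in> ?T"
      unfolding young_central_def algebra_op_sum
    proof (rule cfun.span_sum)
      fix g assume g: "g \<in> symgrp n"
      have eq: "algebra_op d n (conv n (gdelta g) (conv n (young_symmetrizer n l) (gdelta (inv g)))) x =
          algebra_op d n (conv n (gdelta g) (young_symmetrizer n l)) (perm_op d n (inv g) x)"
        using g by (simp add: algebra_op_conv algebra_op_gdelta)
      show "algebra_op d n (conv n (gdelta g) (conv n (young_symmetrizer n l) (gdelta (inv g)))) x \<in> ?T"
      proof (cases "d < length l")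
        case True
        thus ?thesis unfolding eq
          by (simp add: algebra_op_conv young_symmetrizer_long[OF l] algebra_op_linear cfun.span_zero)
      next
        case False
        hence "l \<in> partitions_upto d n" using l by (simp add: partitions_upto_shape)
        moreover have "algebra_op d n (conv n (gdelta g) (young_symmetrizer n l)) (perm_op d n (inv g) x)
            \<in> young_component d n l"
          unfolding young_component_def using g by (intro cfun.span_base) auto
        ultimately show ?thesis unfolding eq by (intro cfun.span_base) blast
      qed
    qed
  qed
  ultimately have "cfun.span (young_central n ` {l. shape n l}) \<subseteq> ?W" by (rule cfun.span_minimal[rotated])
  hence "gdelta id \<in> ?W" using central_subset_span_young gdelta_id_central by blast
  thus "x \<in> ?T" using x by simp
qed

section \<open>Isotypic components\<close>

lemma inner_on_span_eq_0:
  assumes "\<And>x y. x \<in> S \<Longrightarrow> y \<in> T \<Longrightarrow> inner_on I x y = 0" "x \<in> cfun.span S" "y \<in> cfun.span T"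
  shows "inner_on I x y = 0"
proof -
  have "cfun.span T \<subseteq> {y. inner_on I x y = 0}" if "x \<in> S" for x
    by (rule cfun.span_minimal) (use assms(1) that in \<open>auto simp: cfun.subspace_def inner_on_linear\<close>)
  hence "cfun.span S \<subseteq> {x. inner_on I x y = 0}"
    by (intro cfun.span_minimal) (use assms(3) in \<open>auto simp: cfun.subspace_def inner_on_linear\<close>)
  thus ?thesis using assms(2) by blast
qed

text \<open>The whole function space may be infinite-dimensional, so finiteness is supplied by a
  finite set \<open>T\<close> that spans a larger space.\<close>

lemma independent_card_le_dim:
  assumes "finite T" "V \<subseteq> cfun.span T" "cfun.independent S" "S \<subseteq> V"
  shows "finite S" "card S \<le> cfun.dim V"
proof -
  obtain B where B: "B \<subseteq> V" "cfun.independent B" "V \<subseteq> cfun.span B" "card B = cfun.dim V"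
    by (rule cfun.basis_exists)
  have "finite B" using cfun.independent_span_bound[OF assms(1) B(2)] B(1) assms(2) by blast
  from cfun.independent_span_bound[OF this assms(3)] assms(4) B(3,4)
  show "finite S" "card S \<le> cfun.dim V" by auto
qed

lemma independent_card_eq_dim_span:
  assumes "finite T" "V \<subseteq> cfun.span T" "cfun.subspace V" "cfun.independent S" "S \<subseteq> V" "cfun.dim V \<le> card S"
  shows "cfun.span S = V"
proof -
  obtain B where B: "B \<subseteq> V" "cfun.independent B" "V \<subseteq> cfun.span B" "card B = cfun.dim V"
    by (rule cfun.basis_exists)
  have "finite B" using cfun.independent_span_bound[OF assms(1) B(2)] B(1) assms(2) by blast
  hence "cfun.span B \<subseteq> cfun.span S"
    using assms B by (intro span_subset_of_card_le) auto
  thus ?thesis using B(3) cfun.span_minimal[OF assms(5,3)] by blast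
qed

lemma tensor_space_span_ket: "tensor_space d n \<subseteq> cfun.span (ket ` words d n)"
proof
  fix x assume "x \<in> tensor_space d n"
  hence "x = (\<Sum>e\<in>words d n. cscale (x e) (ket e))"
    by (intro ext) (auto simp: tensor_space_def ket_def fun_sum_apply if_distrib[of "\<lambda>x. _ * x"] cong: if_cong)
  also have "\<dots> \<in> cfun.span (ket ` words d n)"
    by (intro cfun.span_sum cfun.span_scale cfun.span_base) auto
  finally show "x \<in> cfun.span (ket ` words d n)" .
qed

lemma ket_tensor_space: "e \<in> words d n \<Longrightarrow> ket e \<in> tensor_space d n"
  by (auto simp: tensor_space_def ket_def)

lemma dim_tensor_space: "cfun.dim (tensor_space d n) = d ^ n"
proof (rule cfun.dim_unique[of "ket ` words d n"])
  have inj: "inj_on ket (words d n)"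
    by (rule inj_onI) (metis ket_def zero_neq_one)
  show "card (ket ` words d n) = d ^ n" using card_image[OF inj] card_words by simp
  show "cfun.independent (ket ` words d n)"
  proof (rule independent_orthogonal[of _ "words d n"])
    have k: "inner_on (words d n) (ket e) (ket f) = (if e = f then 1 else 0)" if "e \<in> words d n" for e f
      using that by (simp add: inner_on_def ket_def if_distrib[of "\<lambda>x. x * _"] if_distrib[of cnj] cong: if_cong)
    show "inner_on (words d n) x x \<noteq> 0" if "x \<in> ket ` words d n" for x using that k by auto
    show "inner_on (words d n) x y = 0" if "x \<in> ket ` words d n" "y \<in> ket ` words d n" "x \<noteq> y" for x y
      using that k by auto
  qed simp
qed (auto simp: ket_tensor_space tensor_space_span_ket)

lemma galg_span_gdelta: "galg n \<subseteq> cfun.span (gdelta ` symgrp n)"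
proof
  fix f assume "f \<in> galg n"
  hence "f = (\<Sum>\<pi>\<in>symgrp n. cscale (f \<pi>) (gdelta \<pi>))" by (rule galg_expand)
  also have "\<dots> \<in> cfun.span (gdelta ` symgrp n)"
    by (intro cfun.span_sum cfun.span_scale cfun.span_base) auto
  finally show "f \<in> cfun.span (gdelta ` symgrp n)" .
qed

lemma P_irrep_eq: "P_irrep n l = range (\<lambda>f. conv n f (young_symmetrizer n l))"
proof
  let ?R = "range (\<lambda>f. conv n f (young_symmetrizer n l))"
  have "cfun.subspace ?R"
    unfolding cfun.subspace_def
  proof (intro conjI ballI allI)
    show "0 \<in> ?R" by (rule range_eqI[of _ _ 0]) (simp add: conv_linear)
  qed (auto simp: conv_linear(1,5)[symmetric])
  moreover have "(\<lambda>\<pi>. regular_op \<pi> (young_symmetrizer n l)) ` symgrp n \<subseteq> ?R"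
    by (auto simp: conv_gdelta_left[symmetric])
  ultimately show "P_irrep n l \<subseteq> ?R" unfolding P_irrep_def by (intro cfun.span_minimal)
  show "?R \<subseteq> P_irrep n l"
  proof
    fix w assume "w \<in> ?R"
    then obtain f where "w = conv n f (young_symmetrizer n l)" by blast
    also have "\<dots> = (\<Sum>\<pi>\<in>symgrp n. cscale (f \<pi>) (regular_op \<pi> (young_symmetrizer n l)))"
      unfolding conv_expand[of n f] by (intro sum.cong refl) (simp add: conv_gdelta_left)
    also have "\<dots> \<in> P_irrep n l"
      unfolding P_irrep_def by (intro cfun.span_sum cfun.span_scale cfun.span_base) auto
    finally show "w \<in> P_irrep n l" .
  qed
qed

lemma subspace_P_irrep: "cfun.subspace (P_irrep n l)"
  by (simp add: P_irrep_def)

lemma P_irrep_galg: "P_irrep n l \<subseteq> galg n"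
  by (auto simp: P_irrep_eq)

lemma conv_P_irrep: "w \<in> P_irrep n l \<Longrightarrow> conv n f w \<in> P_irrep n l"
  by (auto simp: P_irrep_eq conv_assoc[symmetric])

lemma young_P_irrep: "young_symmetrizer n l \<in> P_irrep n l"
  unfolding P_irrep_eq by (rule range_eqI[of _ _ "gdelta id"]) simp

lemma subspace_Q_irrep: "cfun.subspace (Q_irrep d n l)"
  unfolding Q_irrep_def cfun.subspace_def
proof (intro conjI ballI allI)
  show "0 \<in> algebra_op d n (young_symmetrizer n l) ` tensor_space d n"
    by (rule image_eqI[of _ _ 0]) (use subspace_tensor_space in \<open>auto simp: algebra_op_linear cfun.subspace_def\<close>)
qed (use subspace_tensor_space[of d n] in
    \<open>auto simp: algebra_op_linear(4,5)[symmetric] cfun.subspace_def intro!: imageI\<close>)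

lemma Q_irrep_tensor_space: "Q_irrep d n l \<subseteq> tensor_space d n"
  by (auto simp: Q_irrep_def)

lemma tensor_pow_op_Q_irrep: "u \<in> Q_irrep d n l \<Longrightarrow> tensor_pow_op d n U u \<in> Q_irrep d n l"
  by (auto simp: Q_irrep_def tensor_pow_op_algebra_op)

lemma Q_irrep_young:
  assumes "conv n (young_symmetrizer n l) (young_symmetrizer n l) = cscale \<mu> (young_symmetrizer n l)"
    "u \<in> Q_irrep d n l"
  shows "algebra_op d n (young_symmetrizer n l) u = cscale \<mu> u"
  using assms by (auto simp: Q_irrep_def algebra_op_conv[symmetric] algebra_op_linear)

text \<open>Taking adjoints puts \<open>gstar n w\<close> next to \<open>w'\<close>;
  \<open>gstar_ideal_conv\<close> replaces this product by a multiple of \<open>gstar n c\<close>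
  times \<open>c\<close>, and \<open>c\<close> acts on \<open>Q_irrep\<close> by
  \<open>\<mu>\<close>. Hence \<open>K\<close> is the squared modulus of \<open>\<mu>\<close>
  divided by the squared norm of \<open>c\<close>.\<close>

lemma inner_P_Q:
  assumes "shape n l"
  obtains K where "K \<noteq> 0"
    "\<And>w w' u u'. w \<in> P_irrep n l \<Longrightarrow> w' \<in> P_irrep n l \<Longrightarrow> u \<in> Q_irrep d n l \<Longrightarrow> u' \<in> Q_irrep d n l \<Longrightarrow>
      inner_on (words d n) (algebra_op d n w u) (algebra_op d n w' u') =
      K * inner_on (symgrp n) w w' * inner_on (words d n) u u'"
proof -
  let ?c = "young_symmetrizer n l"
  let ?C = "inner_on (symgrp n) ?c ?c"
  obtain \<mu> where \<mu>: "\<mu> \<noteq> 0" "conv n ?c ?c = cscale \<mu> ?c" by (rule young_square[OF assms])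
  have C: "?C \<noteq> 0"
    using galg_inner_eq_0[OF young_symmetrizer_galg] young_symmetrizer_neq_0[OF assms] by blast
  show ?thesis
  proof
    show "cnj \<mu> * \<mu> / ?C \<noteq> 0" using \<mu> C by simp
    fix w w' u u'
    assume w: "w \<in> P_irrep n l" "w' \<in> P_irrep n l" and u: "u \<in> Q_irrep d n l" "u' \<in> Q_irrep d n l"
    from w obtain f g where fg: "w = conv n f ?c" "w' = conv n g ?c" by (auto simp: P_irrep_eq)
    have adj: "inner_on (words d n) (algebra_op d n v u) (algebra_op d n v' u') =
        inner_on (words d n) u (algebra_op d n (conv n (gstar n v) v') u')" for v v'
      by (simp add: algebra_op_adjoint algebra_op_conv)
    have "?C * inner_on (words d n) (algebra_op d n w u) (algebra_op d n w' u') =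
        inner_on (words d n) u (algebra_op d n (cscale ?C (conv n (gstar n w) w')) u')"
      unfolding adj by (simp add: algebra_op_linear inner_on_linear)
    also have "\<dots> = inner_on (symgrp n) w w' *
        inner_on (words d n) (algebra_op d n ?c u) (algebra_op d n ?c u')"
      unfolding adj fg gstar_ideal_conv[OF assms] by (simp add: algebra_op_linear inner_on_linear)
    also have "\<dots> = inner_on (symgrp n) w w' * (cnj \<mu> * \<mu> * inner_on (words d n) u u')"
      using Q_irrep_young[OF \<mu>(2)] u by (simp add: inner_on_linear)
    finally show "inner_on (words d n) (algebra_op d n w u) (algebra_op d n w' u') =
        cnj \<mu> * \<mu> / ?C * inner_on (symgrp n) w w' * inner_on (words d n) u u'"
      using C by (simp add: field_simps)
  qed
qed

text \<open>By the product formula the squared norm of \<open>w u\<close> is \<open>K\<close> times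
  the squared norms of \<open>w\<close> and \<open>u\<close>. This supplies all the injectivity
  needed below.\<close>

lemma P_Q_eq_0:
  assumes "shape n l" "w \<in> P_irrep n l" "u \<in> Q_irrep d n l" "algebra_op d n w u = 0"
  shows "w = 0 \<or> u = 0"
proof -
  obtain K where K: "K \<noteq> 0"
    "\<And>w w' u u'. w \<in> P_irrep n l \<Longrightarrow> w' \<in> P_irrep n l \<Longrightarrow> u \<in> Q_irrep d n l \<Longrightarrow> u' \<in> Q_irrep d n l \<Longrightarrow>
      inner_on (words d n) (algebra_op d n w u) (algebra_op d n w' u') =
      K * inner_on (symgrp n) w w' * inner_on (words d n) u u'"
    by (rule inner_P_Q[OF assms(1)]) blast
  have "K * inner_on (symgrp n) w w * inner_on (words d n) u u = 0"
    using K(2)[OF assms(2,2,3,3)] assms(4) by (simp add: inner_on_linear)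
  hence "inner_on (symgrp n) w w = 0 \<or> inner_on (words d n) u u = 0" using K(1) by simp
  moreover have "w \<in> galg n" "u \<in> tensor_space d n"
    using P_irrep_galg Q_irrep_tensor_space assms(2,3) by blast+
  ultimately show ?thesis using galg_inner_eq_0 tensor_inner_eq_0 by blast
qed

text \<open>The natural maps start at the model representation and end in the tensor space, opposite
  to the direction in which \<open>rep_iso\<close> is used; this lemma turns them round.\<close>

lemma rep_iso_inverse:
  assumes bij: "bij_betw \<psi> W V" and W: "cfun.subspace W"
    and add: "\<And>x y. x \<in> W \<Longrightarrow> y \<in> W \<Longrightarrow> \<psi> (x + y) = \<psi> x + \<psi> y"
    and scale: "\<And>c x. x \<in> W \<Longrightarrow> \<psi> (cscale c x) = cscale c (\<psi> x)"
    and inv: "\<And>g x. g \<in> G \<Longrightarrow> x \<in> W \<Longrightarrow> \<sigma> g x \<in> W"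
    and equi: "\<And>g x. g \<in> G \<Longrightarrow> x \<in> W \<Longrightarrow> \<psi> (\<sigma> g x) = \<rho> g (\<psi> x)"
  shows "rep_iso G \<rho> V \<sigma> W"
  unfolding rep_iso_def
proof (intro exI conjI ballI allI)
  let ?\<phi> = "inv_into W \<psi>"
  show "bij_betw ?\<phi> V W" by (rule bij_betw_inv_into[OF bij])
  have \<phi>: "?\<phi> x \<in> W" "\<psi> (?\<phi> x) = x" if "x \<in> V" for x
    using that bij bij_betw_inv_into_right[OF bij] bij_betwE[OF bij_betw_inv_into[OF bij]] by auto
  have \<phi>': "?\<phi> (\<psi> x) = x" if "x \<in> W" for x using that bij by (rule bij_betw_inv_into_left[rotated])
  show "?\<phi> (x + y) = ?\<phi> x + ?\<phi> y" if "x \<in> V" "y \<in> V" for x y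
  proof -
    have "\<psi> (?\<phi> x + ?\<phi> y) = x + y" using \<phi> that by (simp add: add)
    moreover have "?\<phi> x + ?\<phi> y \<in> W" using \<phi> that W by (simp add: cfun.subspace_add)
    ultimately show ?thesis using \<phi>' by metis
  qed
  show "?\<phi> (cscale c x) = cscale c (?\<phi> x)" if "x \<in> V" for c x
  proof -
    have "\<psi> (cscale c (?\<phi> x)) = cscale c x" using \<phi> that by (simp add: scale)
    moreover have "cscale c (?\<phi> x) \<in> W" using \<phi> that W by (simp add: cfun.subspace_scale)
    ultimately show ?thesis using \<phi>' by metis
  qed
  show "?\<phi> (\<rho> g x) = \<sigma> g (?\<phi> x)" if "g \<in> G" "x \<in> V" for g x
    using \<phi>[OF that(2)] \<phi>' inv equi that(1) by metis
qed

text \<open>For a fixed nonzero \<open>u\<close> the map \<open>w \<mapsto> w u\<close> commutes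
  with permutations and is injective by \<open>P_Q_eq_0\<close>.\<close>

lemma P_rep_iso:
  assumes l: "shape n l" and u: "u \<in> Q_irrep d n l" "u \<noteq> 0"
  defines "W \<equiv> (\<lambda>w. algebra_op d n w u) ` P_irrep n l"
  shows "subrep (symgrp n) (perm_op d n) (tensor_space d n) W"
    "rep_iso (symgrp n) (perm_op d n) W regular_op (P_irrep n l)"
proof -
  have equi: "algebra_op d n (regular_op g w) u = perm_op d n g (algebra_op d n w u)"
    if "g \<in> symgrp n" for g w
    using that by (simp add: conv_gdelta_left[symmetric] algebra_op_conv algebra_op_gdelta)
  have inv: "regular_op g w \<in> P_irrep n l" if "g \<in> symgrp n" "w \<in> P_irrep n l" for g w
    using that by (simp add: conv_gdelta_left[symmetric] conv_P_irrep)
  note sub = subspace_P_irrep[of n l, unfolded cfun.subspace_def]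
  show "subrep (symgrp n) (perm_op d n) (tensor_space d n) W"
    unfolding subrep_def cfun.subspace_def W_def
  proof (intro conjI ballI allI)
    show "0 \<in> (\<lambda>w. algebra_op d n w u) ` P_irrep n l"
      by (rule image_eqI[of _ _ 0]) (use sub in \<open>auto simp: algebra_op_linear\<close>)
  qed (use sub inv in \<open>auto simp: algebra_op_linear(1,2)[symmetric] equi[symmetric] intro!: imageI\<close>)
  show "rep_iso (symgrp n) (perm_op d n) W regular_op (P_irrep n l)"
  proof (rule rep_iso_inverse)
    have "inj_on (\<lambda>w. algebra_op d n w u) (P_irrep n l)"
    proof (rule inj_onI)
      fix w w' assume w: "w \<in> P_irrep n l" "w' \<in> P_irrep n l" "algebra_op d n w u = algebra_op d n w' u"
      have "algebra_op d n (w + cscale (-1) w') u = 0"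
        using w(3) by (simp only: algebra_op_linear) (auto simp: fun_eq_iff)
      moreover have "w + cscale (-1) w' \<in> P_irrep n l" using w sub by blast
      ultimately have "w + cscale (-1) w' = 0" using P_Q_eq_0[OF l _ u(1)] u(2) by blast
      thus "w = w'" by (auto simp: fun_eq_iff)
    qed
    thus "bij_betw (\<lambda>w. algebra_op d n w u) (P_irrep n l) W" by (simp add: bij_betw_def W_def)
  qed (simp_all add: subspace_P_irrep algebra_op_linear inv equi)
qed

text \<open>The counterpart with \<open>w\<close> fixed. \<open>G\<close> may be any set of
  matrices, since the group algebra commutes with every \<open>tensor_pow_op\<close>.\<close>

lemma Q_rep_iso:
  fixes d :: nat
  assumes l: "shape n l" and w: "w \<in> P_irrep n l" "w \<noteq> 0"
  defines "W \<equiv> algebra_op d n w ` Q_irrep d n l"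
  shows "subrep G (tensor_pow_op d n) (tensor_space d n) W"
    "rep_iso G (tensor_pow_op d n) W (tensor_pow_op d n) (Q_irrep d n l)"
proof -
  note sub = subspace_Q_irrep[of d n l, unfolded cfun.subspace_def]
  show "subrep G (tensor_pow_op d n) (tensor_space d n) W"
    unfolding subrep_def cfun.subspace_def W_def
  proof (intro conjI ballI allI)
    show "0 \<in> algebra_op d n w ` Q_irrep d n l"
      by (rule image_eqI[of _ _ 0]) (use sub in \<open>auto simp: algebra_op_linear\<close>)
  qed (use sub tensor_pow_op_Q_irrep in
      \<open>auto simp: algebra_op_linear(4,5)[symmetric] tensor_pow_op_algebra_op intro!: imageI\<close>)
  show "rep_iso G (tensor_pow_op d n) W (tensor_pow_op d n) (Q_irrep d n l)"
  proof (rule rep_iso_inverse)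
    have "inj_on (algebra_op d n w) (Q_irrep d n l)"
    proof (rule inj_onI)
      fix u u' assume u: "u \<in> Q_irrep d n l" "u' \<in> Q_irrep d n l" "algebra_op d n w u = algebra_op d n w u'"
      have "algebra_op d n w (u + cscale (-1) u') = 0"
        using u(3) by (simp only: algebra_op_linear) (auto simp: fun_eq_iff)
      moreover have "u + cscale (-1) u' \<in> Q_irrep d n l" using u sub by blast
      ultimately have "u + cscale (-1) u' = 0" using P_Q_eq_0[OF l w(1)] w(2) by blast
      thus "u = u'" by (auto simp: fun_eq_iff)
    qed
    thus "bij_betw (algebra_op d n w) (Q_irrep d n l) W" by (simp add: bij_betw_def W_def)
  qed (simp_all add: subspace_Q_irrep algebra_op_linear tensor_pow_op_algebra_op tensor_pow_op_Q_irrep)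
qed

lemma rep_iso_algebra_op:
  assumes W: "subrep (symgrp n) (perm_op d n) (tensor_space d n) W" "x \<in> W"
    and add: "\<And>x y. x \<in> W \<Longrightarrow> y \<in> W \<Longrightarrow> \<phi> (x + y) = \<phi> x + \<phi> y"
    and scale: "\<And>c x. x \<in> W \<Longrightarrow> \<phi> (cscale c x) = cscale c (\<phi> x)"
    and equi: "\<And>g x. g \<in> symgrp n \<Longrightarrow> x \<in> W \<Longrightarrow> \<phi> (perm_op d n g x) = regular_op g (\<phi> x)"
  shows "algebra_op d n f x \<in> W" "\<phi> (algebra_op d n f x) = conv n f (\<phi> x)"
proof -
  have sub: "cfun.subspace W" and inv: "\<And>g. g \<in> symgrp n \<Longrightarrow> perm_op d n g x \<in> W"
    using W by (auto simp: subrep_def)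
  show "algebra_op d n f x \<in> W"
    unfolding algebra_op_def using sub inv by (intro cfun.subspace_sum cfun.subspace_scale) auto
  have zero: "\<phi> 0 = 0" using scale[of 0 0] sub by (simp add: cfun.subspace_0)
  \<comment> \<open>\<open>\<phi>\<close> is additive only on \<open>W\<close>, so the sum is built
    up term by term with all partial sums kept inside \<open>W\<close>.\<close>
  have "\<phi> (\<Sum>\<pi>\<in>A. cscale (f \<pi>) (perm_op d n \<pi> x)) = (\<Sum>\<pi>\<in>A. cscale (f \<pi>) (regular_op \<pi> (\<phi> x)))"
    if "finite A" "A \<subseteq> symgrp n" for A
    using that
  proof (induction A)
    case empty
    show ?case by (simp only: sum.empty zero)
  next
    case (insert a A)
    have "(\<Sum>\<pi>\<in>A. cscale (f \<pi>) (perm_op d n \<pi> x)) \<in> W"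
      using insert.prems inv sub by (intro cfun.subspace_sum cfun.subspace_scale) auto
    moreover have "cscale (f a) (perm_op d n a x) \<in> W"
      using insert.prems inv sub by (intro cfun.subspace_scale) auto
    moreover have "\<phi> (cscale (f a) (perm_op d n a x)) = cscale (f a) (regular_op a (\<phi> x))"
      using insert.prems inv W(2) by (simp add: scale equi)
    moreover have "\<phi> (\<Sum>\<pi>\<in>A. cscale (f \<pi>) (perm_op d n \<pi> x)) =
        (\<Sum>\<pi>\<in>A. cscale (f \<pi>) (regular_op \<pi> (\<phi> x)))"
      using insert by blast
    ultimately show ?case
      by (simp only: sum.insert[OF insert.hyps] add)
  qed
  from this[OF finite_symgrp order_refl]
  have "\<phi> (algebra_op d n f x) = (\<Sum>\<pi>\<in>symgrp n. cscale (f \<pi>) (regular_op \<pi> (\<phi> x)))"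
    by (simp only: algebra_op_def)
  also have "\<dots> = conv n f (\<phi> x)"
    unfolding conv_expand[of n f] by (intro sum.cong refl) (simp add: conv_gdelta_left)
  finally show "\<phi> (algebra_op d n f x) = conv n f (\<phi> x)" .
qed

text \<open>From right to left: up to a scalar \<open>f c x\<close> equals \<open>(f c) u\<close>
  with \<open>u = c x\<close>, and it lies in the copy of \<open>P_irrep\<close> obtained from
  \<open>u\<close>. From left to right: in any copy \<open>W\<close> the preimage \<open>w\<close>
  of \<open>c\<close> generates \<open>W\<close> and satisfies \<open>c w = \<mu> w\<close>, so
  every element has the form \<open>f w = (f c) w / \<mu>\<close>.\<close>

lemma isotypic_eq_young_component:
  assumes l: "shape n l"
  shows "isotypic d n l = young_component d n l"
proof
  let ?c = "young_symmetrizer n l"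
  obtain \<mu> where \<mu>: "\<mu> \<noteq> 0" "conv n ?c ?c = cscale \<mu> ?c" by (rule young_square[OF l])
  show "young_component d n l \<subseteq> isotypic d n l"
    unfolding young_component_def
  proof (rule cfun.span_minimal, clarify)
    fix f x assume x: "x \<in> tensor_space d n"
    let ?u = "algebra_op d n ?c x"
    have eq: "algebra_op d n (conv n f ?c) x = algebra_op d n (cscale (1 / \<mu>) (conv n f ?c)) ?u"
      using \<mu> by (simp add: algebra_op_conv[symmetric] conv_assoc conv_linear)
    have Q: "?u \<in> Q_irrep d n l" using x by (auto simp: Q_irrep_def)
    have "algebra_op d n (cscale (1 / \<mu>) (conv n f ?c)) ?u \<in> isotypic d n l"
    proof (cases "?u = 0")
      case True
      thus ?thesis by (simp add: algebra_op_linear isotypic_def cfun.span_zero)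
    next
      case False
      have "cscale (1 / \<mu>) (conv n f ?c) \<in> P_irrep n l"
        using subspace_P_irrep by (rule cfun.subspace_scale) (simp add: P_irrep_eq)
      thus ?thesis unfolding isotypic_def
        by (intro cfun.span_base UnionI[of "(\<lambda>w. algebra_op d n w ?u) ` P_irrep n l"])
           (use P_rep_iso[OF l Q False] in auto)
    qed
    thus "algebra_op d n (conv n f ?c) x \<in> isotypic d n l" unfolding eq .
  qed (simp add: isotypic_def)
  show "isotypic d n l \<subseteq> young_component d n l"
    unfolding isotypic_def
  proof (rule cfun.span_minimal, safe)
    fix W x assume W: "subrep (symgrp n) (perm_op d n) (tensor_space d n) W"
      and iso: "rep_iso (symgrp n) (perm_op d n) W regular_op (P_irrep n l)" and x: "x \<in> W"
    obtain \<phi> where bij: "bij_betw \<phi> W (P_irrep n l)"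
      and \<phi>: "\<And>x y. x \<in> W \<Longrightarrow> y \<in> W \<Longrightarrow> \<phi> (x + y) = \<phi> x + \<phi> y"
        "\<And>c x. x \<in> W \<Longrightarrow> \<phi> (cscale c x) = cscale c (\<phi> x)"
        "\<And>g x. g \<in> symgrp n \<Longrightarrow> x \<in> W \<Longrightarrow> \<phi> (perm_op d n g x) = regular_op g (\<phi> x)"
      using iso by (auto simp: rep_iso_def)
    note alg = rep_iso_algebra_op[OF W _ \<phi>]
    have inj: "x = y" if "x \<in> W" "y \<in> W" "\<phi> x = \<phi> y" for x y
      using bij that by (auto simp: bij_betw_def inj_on_def)
    obtain w where w: "w \<in> W" "\<phi> w = ?c"
      using bij young_P_irrep by (auto simp: bij_betw_def image_iff) (metis imageE)
    have sub: "cfun.subspace W" using W by (simp add: subrep_def)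
    \<comment> \<open>Checked after applying the injective map \<open>\<phi>\<close>, where it reads
      \<open>c c = \<mu> c\<close>.\<close>
    have "algebra_op d n ?c w = cscale \<mu> w"
      using w \<mu> sub by (intro inj) (auto simp: alg \<phi> cfun.subspace_scale)
    hence w': "w = cscale (1 / \<mu>) (algebra_op d n ?c w)" using \<mu> by simp
    have "\<phi> x \<in> P_irrep n l" using bij x by (auto simp: bij_betw_def)
    then obtain f where f: "\<phi> x = conv n f ?c" by (auto simp: P_irrep_eq)
    have "x = algebra_op d n f w" by (rule inj) (use x w f alg in auto)
    also have "\<dots> = algebra_op d n (conv n f ?c) (cscale (1 / \<mu>) w)"
      by (subst w') (simp add: algebra_op_conv algebra_op_linear)
    finally have x': "x = algebra_op d n (conv n f ?c) (cscale (1 / \<mu>) w)" .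
    have "cscale (1 / \<mu>) w \<in> tensor_space d n"
      using w(1) W subspace_tensor_space[of d n] by (auto simp: subrep_def intro!: cfun.subspace_scale)
    hence "algebra_op d n (conv n f ?c) (cscale (1 / \<mu>) w) \<in> young_component d n l"
      unfolding young_component_def by (intro cfun.span_base) blast
    thus "x \<in> young_component d n l" using x' by simp
  qed (simp add: young_component_def)
qed

lemma young_component_orthogonal:
  assumes "shape n l" "shape n m" "l \<noteq> m" "x \<in> young_component d n l" "y \<in> young_component d n m"
  shows "inner_on (words d n) x y = 0"
proof (rule inner_on_span_eq_0[OF _ assms(4,5)[unfolded young_component_def]], clarify)
  fix f x g y
  let ?w = "conv n f (young_symmetrizer n l)" and ?w' = "conv n g (young_symmetrizer n m)"
  have "conv n (gstar n ?w) ?w' = conv n (gstar n (young_symmetrizer n l))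
      (conv n (conv n (gstar n f) g) (young_symmetrizer n m))"
    by (simp add: gstar_conv conv_assoc)
  hence "conv n (gstar n ?w) ?w' = 0" by (simp only: gstar_young_conv_young_neq[OF assms(1-3)])
  thus "inner_on (words d n) (algebra_op d n ?w x) (algebra_op d n ?w' y) = 0"
    unfolding algebra_op_adjoint algebra_op_conv[symmetric] by (simp add: algebra_op_linear inner_on_linear)
qed

text \<open>If \<open>c\<close> killed every tensor, then \<open>z = (b a) (ket e)\<close> would
  have norm zero for each word \<open>e\<close>. Take for \<open>e\<close> the word that writes the
  row number into each cell: row permutations fix it, and the identity is the only column
  permutation that does, so \<open>z\<close> is a positive multiple of a vector with coefficient 1
  at \<open>e\<close>.\<close>

lemma Q_irrep_neq_0:
  assumes l: "shape n l" "length l \<le> d"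
  shows "\<exists>u\<in>Q_irrep d n l. u \<noteq> 0"
proof (rule ccontr)
  assume "\<not> ?thesis"
  hence 0: "algebra_op d n (young_symmetrizer n l) x = 0" if "x \<in> tensor_space d n" for x
    using that by (auto simp: Q_irrep_def)
  \<comment> \<open>The length bound on \<open>l\<close> makes the row numbers admissible
    letters.\<close>
  define e where "e = map (row_of l) [0..<n]"
  have e: "e \<in> words d n"
    using row_of_bounds(3)[of _ l] l by (fastforce simp: e_def words_def shape_def)
  let ?z = "algebra_op d n (gstar n (young_symmetrizer n l)) (ket e)"
  have "inner_on (words d n) ?z ?z = 0"
    by (simp add: algebra_op_adjoint 0 inner_on_linear)
  hence z: "?z = 0" by (simp add: tensor_inner_eq_0)
  have fx: "wact n p e = e" if "p \<in> row_group n l" for p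
    using that by (intro nth_equalityI) (auto simp: e_def row_group_def)
  have row: "algebra_op d n (row_sym n l) (ket e) = cscale (of_nat (card (row_group n l))) (ket e)"
  proof -
    have "algebra_op d n (row_sym n l) (ket e) = (\<Sum>p\<in>row_group n l. ket e)"
      unfolding fibre_sum_def algebra_op_sum row_group_fibre
      by (intro sum.cong refl)
         (simp add: algebra_op_gdelta fibre_group_symgrp perm_op_ket e fx row_group_fibre fibre_group_closed)
    thus ?thesis by (auto simp: fun_sum_apply)
  qed
  have "algebra_op d n (col_sym n l) (ket e) e = (\<Sum>q\<in>col_group n l. if q = id then 1 else 0)"
    unfolding fibre_sum_def algebra_op_sum fun_sum_apply col_group_fibre
  proof (intro sum.cong refl)
    fix q assume q: "q \<in> fibre_group n (col_of l)"
    hence q': "q \<in> symgrp n" by (rule fibre_group_symgrp)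
    have "wact n q e = e \<longleftrightarrow> q = id"
    proof
      assume eq: "wact n q e = e"
      have "q k = k" for k
      proof (cases "k < n")
        case True
        have "wact n q e ! k = e ! k" by (simp only: eq)
        hence "row_of l (q k) = row_of l k" using True q' by (simp add: e_def)
        moreover have "col_of l (q k) = col_of l k" using q True by (simp add: fibre_group_def)
        ultimately show ?thesis
          using True q' l by - (rule cell_inj[of _ l]; auto simp: shape_def)
      next
        case False thus ?thesis using q' by (simp add: symgrp_def permutes_not_in)
      qed
      thus "q = id" by auto
    qed (use e in simp)
    thus "algebra_op d n (cscale (of_int (sign q)) (gdelta q)) (ket e) e = (if q = id then 1 else 0)"
      using q' e by (simp add: algebra_op_linear algebra_op_gdelta perm_op_apply ket_def)
  qed
  also have "\<dots> = 1" using fibre_group_closed(1) by (simp add: col_group_fibre)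
  finally have "algebra_op d n (col_sym n l) (ket e) \<noteq> 0" by auto
  moreover have "?z = cscale (of_nat (card (row_group n l))) (algebra_op d n (col_sym n l) (ket e))"
    by (simp add: gstar_young algebra_op_conv row algebra_op_linear)
  moreover have "of_nat (card (row_group n l)) \<noteq> (0 :: complex)"
    unfolding of_nat_eq_0_iff by (simp add: row_group_fibre)
  ultimately show False using z by simp
qed

section \<open>Integer orthogonal bases\<close>

lemma Ints_cnj: "x \<in> \<int> \<Longrightarrow> cnj x = x" for x :: complex
  by (auto elim: Ints_cases)

lemma inner_on_Ints:
  assumes "\<And>e. x e \<in> \<int>" "\<And>e. y e \<in> \<int>"
  shows "inner_on I x y \<in> \<int>"
  unfolding inner_on_def by (intro Ints_sum Ints_mult) (use assms in \<open>auto simp: Ints_cnj\<close>)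

lemma sum_cscale_Ints:
  assumes "\<And>e. e \<in> E \<Longrightarrow> g e x \<in> \<int>"
  shows "(\<Sum>e\<in>E. cscale (of_int (a e)) (g e)) x \<in> \<int>"
  unfolding fun_sum_apply by (intro Ints_sum) (use assms in auto)

text \<open>The coefficients \<open>a\<close> are recorded along with the vectors, because the
  certificate stores preimages under the symmetrizer. The clause on \<open>cls\<close> will say that
  each preimage lies in one weight space.\<close>

definition int_orthogonalizes ::
  "'a set \<Rightarrow> 'b set \<Rightarrow> ('b \<Rightarrow> 'a \<Rightarrow> complex) \<Rightarrow> ('b \<Rightarrow> 'k) \<Rightarrow> nat \<Rightarrow> (nat \<Rightarrow> 'b \<Rightarrow> int) \<Rightarrow>
    (nat \<Rightarrow> 'a \<Rightarrow> complex) \<Rightarrow> bool" where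
  "int_orthogonalizes I E g cls r a h \<longleftrightarrow>
    (\<forall>i<r. h i = (\<Sum>e\<in>E. cscale (of_int (a i e)) (g e))) \<and>
    (\<forall>i<r. h i \<noteq> 0) \<and> (\<forall>i<r. \<exists>k. \<forall>e\<in>E. a i e \<noteq> 0 \<longrightarrow> cls e = k) \<and>
    (\<forall>i<r. \<forall>j<r. i \<noteq> j \<longrightarrow> inner_on I (h i) (h j) = 0) \<and>
    cfun.span (h ` {..<r}) = cfun.span (g ` E)"

lemma int_orthogonalizesD:
  assumes "int_orthogonalizes I E g cls r a h"
  shows "\<And>i. i < r \<Longrightarrow> h i = (\<Sum>e\<in>E. cscale (of_int (a i e)) (g e))"
    "\<And>i. i < r \<Longrightarrow> h i \<noteq> 0"
    "\<And>i. i < r \<Longrightarrow> \<exists>k. \<forall>e\<in>E. a i e \<noteq> 0 \<longrightarrow> cls e = k"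
    "\<And>i j. i < r \<Longrightarrow> j < r \<Longrightarrow> i \<noteq> j \<Longrightarrow> inner_on I (h i) (h j) = 0"
    "cfun.span (h ` {..<r}) = cfun.span (g ` E)"
  using assms unfolding int_orthogonalizes_def by blast+

text \<open>Gram--Schmidt with denominators cleared; vectors of different classes are orthogonal from the
  start, so the procedure never mixes them.\<close>
lemma int_gram_schmidt:
  fixes g :: "'b \<Rightarrow> 'a \<Rightarrow> complex" and cls :: "'b \<Rightarrow> 'k"
  assumes "finite E" "finite I" "\<And>e x. e \<in> E \<Longrightarrow> x \<notin> I \<Longrightarrow> g e x = 0"
    "\<And>e x. e \<in> E \<Longrightarrow> g e x \<in> \<int>"
    "\<And>e f. e \<in> E \<Longrightarrow> f \<in> E \<Longrightarrow> cls e \<noteq> cls f \<Longrightarrow> inner_on I (g e) (g f) = 0"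
  shows "\<exists>r a h. int_orthogonalizes I E g cls r a h"
  using assms(1,3,4,5)
proof (induction E)
  case empty
  show ?case by (rule exI[of _ 0]) (simp add: int_orthogonalizes_def)
next
  case (insert e0 E)
  have "\<exists>r a h. int_orthogonalizes I E g cls r a h"
    by (rule insert.IH) (use insert.prems in auto)
  then obtain r a h where gs: "int_orthogonalizes I E g cls r a h" by blast
  note h = int_orthogonalizesD(1)[OF gs] and h0 = int_orthogonalizesD(2)[OF gs]
    and cl = int_orthogonalizesD(3)[OF gs] and orth = int_orthogonalizesD(4)[OF gs]
    and span = int_orthogonalizesD(5)[OF gs]
  have hI: "h i x = 0" if "i < r" "x \<notin> I" for i x
    unfolding h[OF that(1)] fun_sum_apply by (intro sum.neutral) (use insert.prems(1) that in auto)
  have hint: "h i x \<in> \<int>" if "i < r" for i x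
    unfolding h[OF that] by (rule sum_cscale_Ints) (use insert.prems(2) in auto)
  have "\<exists>N :: int. inner_on I (h i) (h i) = of_int N" if "i < r" for i
    using inner_on_Ints[of "h i" "h i" I] hint[OF that] by (auto elim: Ints_cases)
  then obtain N :: "nat \<Rightarrow> int" where N: "\<And>i. i < r \<Longrightarrow> inner_on I (h i) (h i) = of_int (N i)" by metis
  have "\<exists>M :: int. inner_on I (h i) (g e0) = of_int M" if "i < r" for i
    using inner_on_Ints[of "h i" "g e0" I] hint[OF that] insert.prems(2) by (auto elim: Ints_cases)
  then obtain M :: "nat \<Rightarrow> int" where M: "\<And>i. i < r \<Longrightarrow> inner_on I (h i) (g e0) = of_int (M i)" by metis
  have Nnz: "N i \<noteq> 0" if "i < r" for i
    using N[OF that] h0[OF that] inner_on_self_eq_0[OF assms(2) hI[OF that]] by auto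
  \<comment> \<open>\<open>P\<close> clears the denominators of the projections: \<open>P\<close>
    times \<open>M i / N i\<close> is \<open>R i * M i\<close>, where \<open>R i\<close> omits the
    factor \<open>N i\<close>.\<close>
  define P where "P = (\<Prod>i<r. N i)"
  define R where "R i = (\<Prod>j\<in>{..<r} - {i}. N j)" for i
  have PR: "P = N i * R i" if "i < r" for i
    unfolding P_def R_def by (rule prod.remove) (use that in auto)
  have Pnz: "P \<noteq> 0" using Nnz by (simp add: P_def)
  define h' where "h' = cscale (of_int P) (g e0) - (\<Sum>i<r. cscale (of_int (R i * M i)) (h i))"
  define b where "b e = (if e = e0 then P else - (\<Sum>i<r. R i * M i * a i e))" for e
  have h'_b: "h' = (\<Sum>e\<in>insert e0 E. cscale (of_int (b e)) (g e))"
  proof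
    fix x
    have "(\<Sum>i<r. of_int (R i * M i) * h i x) = (\<Sum>e\<in>E. (\<Sum>i<r. of_int (R i * M i * a i e)) * g e x)"
    proof -
      have "(\<Sum>i<r. of_int (R i * M i) * h i x) = (\<Sum>i<r. \<Sum>e\<in>E. of_int (R i * M i * a i e) * g e x)"
        by (intro sum.cong refl) (simp add: h fun_sum_apply sum_distrib_left mult.assoc)
      thus ?thesis by (subst (asm) sum.swap) (simp add: sum_distrib_right)
    qed
    moreover have "(\<Sum>e\<in>E. of_int (b e) * g e x) = - (\<Sum>e\<in>E. (\<Sum>i<r. of_int (R i * M i * a i e)) * g e x)"
      unfolding sum_negf[symmetric] using insert.hyps(2) by (intro sum.cong refl) (auto simp: b_def)
    ultimately show "h' x = (\<Sum>e\<in>insert e0 E. cscale (of_int (b e)) (g e)) x"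
      using insert.hyps by (simp add: h'_def fun_sum_apply b_def)
  qed
  have orth': "inner_on I (h i) h' = 0" if i: "i < r" for i
  proof -
    have "(\<Sum>j<r. of_int (R j * M j) * inner_on I (h i) (h j)) =
        (\<Sum>j<r. if j = i then of_int (R i * M i * N i) else 0)"
      by (intro sum.cong refl) (use orth i N in auto)
    also have "\<dots> = of_int (P * M i)" using i PR[OF i] by (simp add: mult_ac)
    finally show ?thesis
      unfolding h'_def by (simp add: inner_on_linear inner_on_sum M i)
  qed
  \<comment> \<open>If \<open>e\<close> occurs in \<open>h'\<close>, it occurs in some
    \<open>h i\<close> with \<open>M i \<noteq> 0\<close>. All of \<open>h i\<close> has the class
    of \<open>e\<close>; were this not the class of \<open>e0\<close>, every term of
    \<open>M i\<close> would vanish.\<close>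
  have cl': "cls e = cls e0" if e_in: "e \<in> insert e0 E" and b_e: "b e \<noteq> 0" for e
  proof (cases "e = e0")
    case False
    hence e: "e \<in> E" using e_in by simp
    obtain i where i: "i < r" "M i \<noteq> 0" "a i e \<noteq> 0"
    proof (rule ccontr)
      assume *: "\<not> thesis"
      have "(\<Sum>i<r. R i * M i * a i e) = 0" by (intro sum.neutral) (use * that in auto)
      thus False using b_e False by (simp add: b_def)
    qed
    obtain k where k: "\<And>e. e \<in> E \<Longrightarrow> a i e \<noteq> 0 \<Longrightarrow> cls e = k" using cl[OF i(1)] by blast
    show ?thesis
    proof (rule ccontr)
      assume neq: "cls e \<noteq> cls e0"
      have "of_int (M i) = (\<Sum>e\<in>E. of_int (a i e) * inner_on I (g e) (g e0))"
        unfolding M[OF i(1), symmetric] h[OF i(1)] by (simp add: inner_on_sum inner_on_linear)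
      also have "\<dots> = 0"
      proof (intro sum.neutral ballI)
        fix f assume f: "f \<in> E"
        show "of_int (a i f) * inner_on I (g f) (g e0) = 0"
        proof (cases "a i f = 0")
          case False
          hence "cls f = cls e" using k f e i(3) by metis
          thus ?thesis using insert.prems(3)[of f e0] f neq by simp
        qed simp
      qed
      finally show False using i(2) by simp
    qed
  qed simp
  let ?a = "\<lambda>i e. if e = e0 then 0 else a i e"
  have h_a: "h i = (\<Sum>e\<in>insert e0 E. cscale (of_int (?a i e)) (g e))" if "i < r" for i
  proof
    fix x
    have "(\<Sum>e\<in>E. of_int (?a i e) * g e x) = h i x"
      unfolding h[OF that] fun_sum_apply using insert.hyps(2) by (intro sum.cong refl) auto
    thus "h i x = (\<Sum>e\<in>insert e0 E. cscale (of_int (?a i e)) (g e)) x"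
      using insert.hyps by (simp add: fun_sum_apply)
  qed
  have cl_a: "\<exists>k. \<forall>e\<in>insert e0 E. ?a i e \<noteq> 0 \<longrightarrow> cls e = k" if "i < r" for i
    using cl[OF that] by auto
  have lin: "(\<Sum>i<r. cscale (of_int (R i * M i)) (h i)) \<in> cfun.span (h ` {..<r})"
    by (intro cfun.span_sum cfun.span_scale cfun.span_base) auto
  have g0: "g e0 = cscale (1 / of_int P) (h' + (\<Sum>i<r. cscale (of_int (R i * M i)) (h i)))"
    using Pnz by (auto simp: h'_def fun_eq_iff)
  show ?case
  \<comment> \<open>A zero remainder means that \<open>g e0\<close> already lies in the span; it is
    dropped, and the old vectors get coefficient 0 at \<open>e0\<close>.\<close>
  proof (cases "h' = 0")
    case True
    have "g e0 \<in> cfun.span (h ` {..<r})"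
      unfolding g0 True by (intro cfun.span_scale cfun.span_add cfun.span_zero lin)
    hence "cfun.span (g ` insert e0 E) = cfun.span (h ` {..<r})"
      unfolding span by (simp add: cfun.span_redundant)
    hence "int_orthogonalizes I (insert e0 E) g cls r ?a h"
      unfolding int_orthogonalizes_def using h_a cl_a h0 orth by blast
    thus ?thesis by blast
  next
    case False
    define H where "H i = (if i < r then h i else h')" for i
    define A where "A i = (if i < r then ?a i else b)" for i
    have img: "H ` {..<Suc r} = insert h' (h ` {..<r})"
      by (auto simp: H_def lessThan_Suc)
    have "h' \<in> cfun.span (g ` insert e0 E)"
      unfolding h'_b by (intro cfun.span_sum cfun.span_scale cfun.span_base) auto
    moreover have "h ` {..<r} \<subseteq> cfun.span (g ` insert e0 E)"
      using span cfun.span_base[of _ "h ` {..<r}"] cfun.span_mono[of "g ` E" "g ` insert e0 E"] by blast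
    moreover have "g e0 \<in> cfun.span (insert h' (h ` {..<r}))"
      unfolding g0 using lin cfun.span_mono[of "h ` {..<r}" "insert h' (h ` {..<r})"]
      by (intro cfun.span_scale cfun.span_add) (auto intro: cfun.span_base)
    moreover have "g ` E \<subseteq> cfun.span (insert h' (h ` {..<r}))"
      using span cfun.span_base[of _ "g ` E"] cfun.span_mono[of "h ` {..<r}" "insert h' (h ` {..<r})"] by blast
    ultimately have "cfun.span (H ` {..<Suc r}) = cfun.span (g ` insert e0 E)"
      unfolding img by (intro equalityI cfun.span_minimal) auto
    moreover have "\<forall>i<Suc r. H i = (\<Sum>e\<in>insert e0 E. cscale (of_int (A i e)) (g e))"
      using h_a h'_b by (auto simp: H_def A_def)
    moreover have "\<forall>i<Suc r. H i \<noteq> 0" using h0 False by (simp add: H_def)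
    moreover have "\<exists>k. \<forall>e\<in>insert e0 E. A i e \<noteq> 0 \<longrightarrow> cls e = k" for i
    proof (cases "i < r")
      case True thus ?thesis using cl_a[of i] by (simp only: A_def if_True)
    next
      case False thus ?thesis using cl' by (metis A_def)
    qed
    moreover have "\<forall>i<Suc r. \<forall>j<Suc r. i \<noteq> j \<longrightarrow> inner_on I (H i) (H j) = 0"
    proof -
      have "inner_on I h' (h i) = 0" if "i < r" for i
        using orth'[OF that] inner_on_cnj[of I "h i" h'] by simp
      thus ?thesis using orth orth' by (auto simp: H_def less_Suc_eq)
    qed
    ultimately have "int_orthogonalizes I (insert e0 E) g cls (Suc r) A H"
      unfolding int_orthogonalizes_def by blast
    thus ?thesis by blast
  qed
qed

lemma inj_on_orthogonal:
  assumes "\<And>i. i \<in> J \<Longrightarrow> inner_on I (h i) (h i) \<noteq> 0"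
    "\<And>i j. i \<in> J \<Longrightarrow> j \<in> J \<Longrightarrow> i \<noteq> j \<Longrightarrow> inner_on I (h i) (h j) = 0"
  shows "inj_on h J"
  using assms by (intro inj_onI) metis

lemma orthogonal_family:
  assumes "finite J" "\<And>i. i \<in> J \<Longrightarrow> inner_on I (h i) (h i) \<noteq> 0"
    "\<And>i j. i \<in> J \<Longrightarrow> j \<in> J \<Longrightarrow> i \<noteq> j \<Longrightarrow> inner_on I (h i) (h j) = 0"
  shows "cfun.independent (h ` J)" "card (h ` J) = card J"
proof -
  show "cfun.independent (h ` J)"
  proof (rule independent_orthogonal[of _ I])
    fix x y assume "x \<in> h ` J" "y \<in> h ` J" "x \<noteq> y"
    thus "inner_on I x y = 0" using assms(3) by (metis imageE)
  qed (use assms in auto)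
  show "card (h ` J) = card J" by (rule card_image[OF inj_on_orthogonal[OF assms(2,3)]])
qed

lemma young_symmetrizer_Ints: "young_symmetrizer n l \<sigma> \<in> \<int>"
  unfolding young_symmetrizer_def by (intro Ints_sum) auto

lemma mset_wact:
  assumes "\<pi> \<in> symgrp n" "e \<in> words d n"
  shows "mset (wact n \<pi> e) = mset e"
proof -
  have "length e = n" using assms(2) by (simp add: words_def)
  hence "wact n \<pi> e = permute_list \<pi> e" by (simp add: wact_def permute_list_def)
  thus ?thesis using assms \<open>length e = n\<close> by (simp add: symgrp_def)
qed

text \<open>Permutations only rearrange letters, so the image of a ket stays in its weight space.
  Hence images of kets with different letters have disjoint supports.\<close>

lemma algebra_op_ket_mset:
  assumes "e \<in> words d n" "algebra_op d n f (ket e) x \<noteq> 0"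
  shows "mset x = mset e"
proof -
  have x: "x \<in> words d n" using assms(2) by (auto simp: algebra_op_apply split: if_splits)
  have "\<exists>\<pi>\<in>symgrp n. wact n \<pi> x = e"
  proof (rule ccontr)
    assume "\<not> ?thesis"
    hence "algebra_op d n f (ket e) x = 0" by (auto simp: algebra_op_apply ket_def intro!: sum.neutral)
    thus False using assms(2) by simp
  qed
  thus ?thesis using mset_wact x by metis
qed

text \<open>Gram--Schmidt on the images of all kets under the symmetrizer, with the letter multiset
  as class.\<close>

lemma Q_basis:
  obtains a :: "nat \<Rightarrow> nat list \<Rightarrow> int" and u where
    "\<And>i. i < cfun.dim (Q_irrep d n l) \<Longrightarrow>
      u i = algebra_op d n (young_symmetrizer n l) (\<Sum>e\<in>words d n. cscale (of_int (a i e)) (ket e))"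
    "\<And>i. i < cfun.dim (Q_irrep d n l) \<Longrightarrow> u i \<noteq> 0"
    "\<And>i. i < cfun.dim (Q_irrep d n l) \<Longrightarrow> \<exists>k. \<forall>e\<in>words d n. a i e \<noteq> 0 \<longrightarrow> mset e = k"
    "\<And>i j. i < cfun.dim (Q_irrep d n l) \<Longrightarrow> j < cfun.dim (Q_irrep d n l) \<Longrightarrow> i \<noteq> j \<Longrightarrow>
      inner_on (words d n) (u i) (u j) = 0"
    "cfun.span (u ` {..<cfun.dim (Q_irrep d n l)}) = Q_irrep d n l"
proof -
  let ?c = "young_symmetrizer n l"
  let ?g = "\<lambda>e. algebra_op d n ?c (ket e)"
  have "\<exists>r a h. int_orthogonalizes (words d n) (words d n) ?g mset r a h"
  proof (rule int_gram_schmidt)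
    fix e f assume ef: "e \<in> words d n" "f \<in> words d n" "mset e \<noteq> mset f"
    have "?g e x = 0 \<or> ?g f x = 0" for x using algebra_op_ket_mset ef by metis
    thus "inner_on (words d n) (?g e) (?g f) = 0"
      unfolding inner_on_def by (intro sum.neutral) auto
  next
    fix e x assume "e \<in> words d n"
    show "?g e x \<in> \<int>"
      unfolding algebra_op_apply using young_symmetrizer_Ints
      by (auto simp: ket_def intro!: Ints_sum)
  qed (auto simp: algebra_op_apply)
  then obtain r a h where gs: "int_orthogonalizes (words d n) (words d n) ?g mset r a h" by blast
  note h = int_orthogonalizesD(1)[OF gs] and h0 = int_orthogonalizesD(2)[OF gs]
    and cl = int_orthogonalizesD(3)[OF gs] and orth = int_orthogonalizesD(4)[OF gs]
    and span = int_orthogonalizesD(5)[OF gs]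
  have eq: "h i = algebra_op d n ?c (\<Sum>e\<in>words d n. cscale (of_int (a i e)) (ket e))" if "i < r" for i
    unfolding h[OF that] algebra_op_sum algebra_op_linear by (rule refl)
  have Q: "cfun.span (?g ` words d n) = Q_irrep d n l"
  proof
    show "cfun.span (?g ` words d n) \<subseteq> Q_irrep d n l"
      by (intro cfun.span_minimal subspace_Q_irrep) (auto simp: Q_irrep_def ket_tensor_space)
    have "cfun.span (ket ` words d n) \<subseteq> {x. algebra_op d n ?c x \<in> cfun.span (?g ` words d n)}"
      by (intro cfun.span_minimal)
         (auto simp: cfun.subspace_def algebra_op_linear cfun.span_zero cfun.span_add cfun.span_scale
            intro: cfun.span_base)
    thus "Q_irrep d n l \<subseteq> cfun.span (?g ` words d n)"
      using tensor_space_span_ket unfolding Q_irrep_def by blast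
  qed
  have nz: "inner_on (words d n) (h i) (h i) \<noteq> 0" if "i < r" for i
    using tensor_inner_eq_0[of "h i" d n] h0[OF that] eq[OF that] by simp
  have "cfun.independent (h ` {..<r})" "card (h ` {..<r}) = r"
    using orthogonal_family[of "{..<r}" "words d n" h] nz orth by auto
  \<comment> \<open>The number of vectors that survive orthogonalization is the dimension, since
    they are independent and span.\<close>
  hence "cfun.dim (Q_irrep d n l) = r"
    using cfun.dim_span_eq_card_independent span Q by metis
  thus ?thesis using that[of h a] eq h0 cl orth span Q by simp
qed

text \<open>The same on the left translates of the symmetrizer. There are no weights to preserve
  here, so all translates belong to one class.\<close>

lemma P_basis:
  obtains b :: "nat \<Rightarrow> (nat \<Rightarrow> nat) \<Rightarrow> int" and w where
    "\<And>i. i < cfun.dim (P_irrep n l) \<Longrightarrow>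
      w i = conv n (\<Sum>\<pi>\<in>symgrp n. cscale (of_int (b i \<pi>)) (gdelta \<pi>)) (young_symmetrizer n l)"
    "\<And>i. i < cfun.dim (P_irrep n l) \<Longrightarrow> w i \<noteq> 0"
    "\<And>i j. i < cfun.dim (P_irrep n l) \<Longrightarrow> j < cfun.dim (P_irrep n l) \<Longrightarrow> i \<noteq> j \<Longrightarrow>
      inner_on (symgrp n) (w i) (w j) = 0"
    "cfun.span (w ` {..<cfun.dim (P_irrep n l)}) = P_irrep n l"
proof -
  let ?c = "young_symmetrizer n l"
  let ?g = "\<lambda>\<pi>. conv n (gdelta \<pi>) ?c"
  have "\<exists>r a h. int_orthogonalizes (symgrp n) (symgrp n) ?g (\<lambda>_. ()) r a h"
  proof (rule int_gram_schmidt)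
    fix \<pi> \<sigma> assume \<pi>: "\<pi> \<in> symgrp n"
    show "?g \<pi> \<sigma> \<in> \<int>"
      using \<pi> by (simp add: conv_gdelta_left regular_op_def young_symmetrizer_Ints)
    show "?g \<pi> \<sigma> = 0" if "\<sigma> \<notin> symgrp n"
    proof -
      have "?g \<pi> \<in> galg n" by simp
      thus ?thesis using that by (simp add: galg_def)
    qed
  qed auto
  then obtain r a h where gs: "int_orthogonalizes (symgrp n) (symgrp n) ?g (\<lambda>_. ()) r a h" by blast
  note h = int_orthogonalizesD(1)[OF gs] and h0 = int_orthogonalizesD(2)[OF gs]
    and cl = int_orthogonalizesD(3)[OF gs] and orth = int_orthogonalizesD(4)[OF gs]
    and span = int_orthogonalizesD(5)[OF gs]
  have eq: "h i = conv n (\<Sum>e\<in>symgrp n. cscale (of_int (a i e)) (gdelta e)) ?c" if "i < r" for i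
    unfolding h[OF that] conv_sum conv_linear by (rule refl)
  have P: "cfun.span (?g ` symgrp n) = P_irrep n l"
    unfolding P_irrep_def by (intro arg_cong[of _ _ cfun.span] image_cong refl conv_gdelta_left)
  have nz: "inner_on (symgrp n) (h i) (h i) \<noteq> 0" if "i < r" for i
    using galg_inner_eq_0[of "h i" n] h0[OF that] eq[OF that] by simp
  have "cfun.independent (h ` {..<r})" "card (h ` {..<r}) = r"
    using orthogonal_family[of "{..<r}" "symgrp n" h] nz orth by auto
  hence "cfun.dim (P_irrep n l) = r"
    using cfun.dim_span_eq_card_independent span P by metis
  thus ?thesis using that[of h a] eq h0 orth span P by simp
qed

section \<open>Schur bases from orthogonal data\<close>

lemma finite_partitions_upto [simp]: "finite (partitions_upto d n)"
  by (rule finite_subset[OF _ finite_shape[of n]]) (auto simp: partitions_upto_shape)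

lemma algebra_op_span:
  assumes "w \<in> cfun.span A" "u \<in> cfun.span B"
  shows "algebra_op d n w u \<in> cfun.span {algebra_op d n a b | a b. a \<in> A \<and> b \<in> B}" (is "_ \<in> cfun.span ?T")
proof -
  have "cfun.span B \<subseteq> {u. algebra_op d n a u \<in> cfun.span ?T}" if "a \<in> A" for a
    using that
    by (intro cfun.span_minimal)
       (auto simp: cfun.subspace_def algebra_op_linear cfun.span_zero cfun.span_add cfun.span_scale
          intro!: cfun.span_base)
  hence "cfun.span A \<subseteq> {w. algebra_op d n w u \<in> cfun.span ?T}"
    using assms(2)
    by (intro cfun.span_minimal)
       (auto simp: cfun.subspace_def algebra_op_linear cfun.span_zero cfun.span_add cfun.span_scale)
  thus ?thesis using assms(1) by blast
qed

text \<open>A second \<open>c\<close> can be inserted before \<open>x\<close> at the cost of a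
  scalar, the reciprocal of the one in \<open>young_square\<close>. This rewrites
  \<open>(f c) x\<close> as an element of \<open>P_irrep\<close> acting on an element of
  \<open>Q_irrep\<close>.\<close>

lemma young_ideal_action:
  assumes "shape n l"
  obtains \<mu> where "\<mu> \<noteq> 0" "\<And>f x. algebra_op d n (conv n f (young_symmetrizer n l)) x =
    cscale \<mu> (algebra_op d n (conv n f (young_symmetrizer n l)) (algebra_op d n (young_symmetrizer n l) x))"
proof -
  let ?c = "young_symmetrizer n l"
  obtain \<mu> where \<mu>: "\<mu> \<noteq> 0" "conv n ?c ?c = cscale \<mu> ?c" by (rule young_square[OF assms])
  show ?thesis
  proof (rule that[of "1 / \<mu>"])
    show "algebra_op d n (conv n f ?c) x =
        cscale (1 / \<mu>) (algebra_op d n (conv n f ?c) (algebra_op d n ?c x))" for f x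
      using \<mu> by (simp add: algebra_op_conv[symmetric] conv_assoc conv_linear algebra_op_linear)
  qed (use \<mu> in simp)
qed

lemma algebra_op_Q_P_component:
  assumes "w \<in> P_irrep n l" "u \<in> Q_irrep d n l"
  shows "algebra_op d n w u \<in> young_component d n l"
proof -
  obtain f where f: "w = conv n f (young_symmetrizer n l)" using assms(1) by (auto simp: P_irrep_eq)
  have "u \<in> tensor_space d n" using assms(2) Q_irrep_tensor_space by blast
  thus ?thesis unfolding young_component_def f by (intro cfun.span_base) blast
qed

lemma young_component_eq_span:
  assumes l: "shape n l" and w: "cfun.span (w ` J) = P_irrep n l" and u: "cfun.span (u ` I) = Q_irrep d n l"
  shows "young_component d n l = cfun.span {algebra_op d n (w j) (u i) | i j. i \<in> I \<and> j \<in> J}" (is "_ = cfun.span ?T")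
proof
  obtain \<mu> where \<mu>: "\<mu> \<noteq> 0" "\<And>f x. algebra_op d n (conv n f (young_symmetrizer n l)) x =
      cscale \<mu> (algebra_op d n (conv n f (young_symmetrizer n l)) (algebra_op d n (young_symmetrizer n l) x))"
    by (rule young_ideal_action[OF l, of d]) blast
  show "young_component d n l \<subseteq> cfun.span ?T"
    unfolding young_component_def
  proof (rule cfun.span_minimal, clarify)
    fix f x assume x: "x \<in> tensor_space d n"
    have "conv n f (young_symmetrizer n l) \<in> cfun.span (w ` J)" unfolding w by (simp add: P_irrep_eq)
    moreover have "algebra_op d n (young_symmetrizer n l) x \<in> cfun.span (u ` I)"
      unfolding u using x by (simp add: Q_irrep_def)
    ultimately have "algebra_op d n (conv n f (young_symmetrizer n l)) (algebra_op d n (young_symmetrizer n l) x)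
        \<in> cfun.span {algebra_op d n a b | a b. a \<in> w ` J \<and> b \<in> u ` I}"
      by (rule algebra_op_span)
    also have "{algebra_op d n a b | a b. a \<in> w ` J \<and> b \<in> u ` I} = ?T" by blast
    finally show "algebra_op d n (conv n f (young_symmetrizer n l)) x \<in> cfun.span ?T"
      by (subst \<mu>(2)) (rule cfun.span_scale)
  qed simp
  show "cfun.span ?T \<subseteq> young_component d n l"
  proof (rule cfun.span_minimal, clarify)
    fix i j assume "i \<in> I" "j \<in> J"
    hence "w j \<in> P_irrep n l" "u i \<in> Q_irrep d n l"
      unfolding w[symmetric] u[symmetric] by (auto intro: cfun.span_base)
    thus "algebra_op d n (w j) (u i) \<in> young_component d n l" by (rule algebra_op_Q_P_component)
  qed (simp add: young_component_def)
qed

text \<open>An unnormalized basis vector, computed from preimages of both factors with a single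
  symmetrizer in between. It is a nonzero multiple of the product of \<open>Y c\<close> in
  \<open>P_irrep\<close> with \<open>c X\<close> in \<open>Q_irrep\<close>.\<close>

definition young_vec ::
  "nat \<Rightarrow> nat \<Rightarrow> (nat list \<Rightarrow> nat \<Rightarrow> tensor) \<Rightarrow> (nat list \<Rightarrow> nat \<Rightarrow> (nat \<Rightarrow> nat) \<Rightarrow> complex) \<Rightarrow>
    nat list \<times> nat \<times> nat \<Rightarrow> tensor" where
  "young_vec d n X Y = (\<lambda>(l, i, j). algebra_op d n (conv n (Y l j) (young_symmetrizer n l)) (X l i))"

text \<open>The mathematical content of a certificate, free of dimensions and of irreducible
  representations. The closure conditions make the labels of each shape a rectangle with a corner at
  \<open>(0, 0)\<close>.\<close>

definition schur_data ::
  "nat \<Rightarrow> nat \<Rightarrow> (nat list \<times> nat \<times> nat) set \<Rightarrow> (nat list \<Rightarrow> nat \<Rightarrow> tensor) \<Rightarrow>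
    (nat list \<Rightarrow> nat \<Rightarrow> (nat \<Rightarrow> nat) \<Rightarrow> complex) \<Rightarrow> bool" where
  "schur_data d n S X Y \<longleftrightarrow> finite S \<and> card S = d ^ n \<and>
     (\<forall>l i j. (l, i, j) \<in> S \<longrightarrow> l \<in> partitions_upto d n \<and> X l i \<in> tensor_space d n) \<and>
     (\<forall>l i j. (l, Suc i, j) \<in> S \<longrightarrow> (l, i, j) \<in> S) \<and>
     (\<forall>l i j. (l, i, Suc j) \<in> S \<longrightarrow> (l, i, j) \<in> S) \<and>
     (\<forall>l i j i' j'. (l, i, j) \<in> S \<longrightarrow> (l, i', j') \<in> S \<longrightarrow> (l, i, j') \<in> S) \<and>
     (\<forall>s\<in>S. young_vec d n X Y s \<noteq> 0) \<and>
     (\<forall>s\<in>S. \<forall>t\<in>S. s \<noteq> t \<longrightarrow> inner_on (words d n) (young_vec d n X Y s) (young_vec d n X Y t) = 0)"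

lemma schur_dataD:
  assumes "schur_data d n S X Y"
  shows "finite S" "card S = d ^ n"
    "\<And>l i j. (l, i, j) \<in> S \<Longrightarrow> l \<in> partitions_upto d n"
    "\<And>l i j. (l, i, j) \<in> S \<Longrightarrow> X l i \<in> tensor_space d n"
    "\<And>l i j. (l, Suc i, j) \<in> S \<Longrightarrow> (l, i, j) \<in> S"
    "\<And>l i j. (l, i, Suc j) \<in> S \<Longrightarrow> (l, i, j) \<in> S"
    "\<And>l i j i' j'. (l, i, j) \<in> S \<Longrightarrow> (l, i', j') \<in> S \<Longrightarrow> (l, i, j') \<in> S"
    "\<And>s. s \<in> S \<Longrightarrow> young_vec d n X Y s \<noteq> 0"
    "\<And>s t. s \<in> S \<Longrightarrow> t \<in> S \<Longrightarrow> s \<noteq> t \<Longrightarrow>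
      inner_on (words d n) (young_vec d n X Y s) (young_vec d n X Y t) = 0"
proof -
  note D = assms[unfolded schur_data_def]
  have D4: "\<forall>l i j. (l, i, j) \<in> S \<longrightarrow> l \<in> partitions_upto d n \<and> X l i \<in> tensor_space d n"
    and D5: "\<forall>l i j. (l, Suc i, j) \<in> S \<longrightarrow> (l, i, j) \<in> S"
    and D6: "\<forall>l i j. (l, i, Suc j) \<in> S \<longrightarrow> (l, i, j) \<in> S"
    and D7: "\<forall>l i j i' j'. (l, i, j) \<in> S \<longrightarrow> (l, i', j') \<in> S \<longrightarrow> (l, i, j') \<in> S"
    and D8: "\<forall>s\<in>S. young_vec d n X Y s \<noteq> 0"
    and D9: "\<forall>s\<in>S. \<forall>t\<in>S. s \<noteq> t \<longrightarrow> inner_on (words d n) (young_vec d n X Y s) (young_vec d n X Y t) = 0"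
    using D by - (elim conjE, assumption)+
  show "finite S" "card S = d ^ n" using D by - (elim conjE, assumption)+
  show "l \<in> partitions_upto d n" "X l i \<in> tensor_space d n" if "(l, i, j) \<in> S" for l i j
    using D4 that by blast+
  show "(l, i, j) \<in> S" if "(l, Suc i, j) \<in> S" for l i j using D5 that by blast
  show "(l, i, j) \<in> S" if "(l, i, Suc j) \<in> S" for l i j using D6 that by blast
  show "(l, i, j') \<in> S" if "(l, i, j) \<in> S" "(l, i', j') \<in> S" for l i j i' j' using D7 that by blast
  show "young_vec d n X Y s \<noteq> 0" if "s \<in> S" for s using D8 that by blast
  show "inner_on (words d n) (young_vec d n X Y s) (young_vec d n X Y t) = 0"
    if "s \<in> S" "t \<in> S" "s \<noteq> t" for s t using D9 that by blast
qed

lemma schur_labels_Sigma: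
  "schur_labels d n = Sigma (partitions_upto d n)
     (\<lambda>l. {..<cfun.dim (Q_irrep d n l)} \<times> {..<cfun.dim (P_irrep n l)})"
  by (auto simp: schur_labels_def)

lemma finite_schur_labels [simp]: "finite (schur_labels d n)"
  by (simp add: schur_labels_Sigma)

lemma card_schur_labels:
  "card (schur_labels d n) = (\<Sum>l\<in>partitions_upto d n. cfun.dim (Q_irrep d n l) * cfun.dim (P_irrep n l))"
  by (simp add: schur_labels_Sigma card_SigmaI)

text \<open>The products of the two integer bases are orthogonal by \<open>inner_P_Q\<close> within
  a shape and by orthogonality of the components across shapes. They span by completeness, so they
  are a basis and their number is \<open>d ^ n\<close>.\<close>

lemma schur_data_exists:
  obtains a :: "nat list \<Rightarrow> nat \<Rightarrow> nat list \<Rightarrow> int" and b :: "nat list \<Rightarrow> nat \<Rightarrow> (nat \<Rightarrow> nat) \<Rightarrow> int" where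
    "schur_data d n (schur_labels d n) (\<lambda>l i. \<Sum>e\<in>words d n. cscale (of_int (a l i e)) (ket e))
       (\<lambda>l j. \<Sum>\<pi>\<in>symgrp n. cscale (of_int (b l j \<pi>)) (gdelta \<pi>))"
    "\<And>l i. i < cfun.dim (Q_irrep d n l) \<Longrightarrow> \<exists>k. \<forall>e\<in>words d n. a l i e \<noteq> 0 \<longrightarrow> mset e = k"
proof -
  let ?q = "\<lambda>l. cfun.dim (Q_irrep d n l)" and ?p = "\<lambda>l. cfun.dim (P_irrep n l)"
  define X where "X a l i = (\<Sum>e\<in>words d n. cscale (of_int (a l i e)) (ket e))"
    for a :: "nat list \<Rightarrow> nat \<Rightarrow> nat list \<Rightarrow> int" and l :: "nat list" and i :: nat
  define Y where "Y b l j = (\<Sum>\<pi>\<in>symgrp n. cscale (of_int (b l j \<pi>)) (gdelta \<pi>))"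
    for b :: "nat list \<Rightarrow> nat \<Rightarrow> (nat \<Rightarrow> nat) \<Rightarrow> int" and l :: "nat list" and j :: nat
  \<comment> \<open>\<open>A\<close>, and likewise \<open>B\<close> below, packages the conclusions
    of a basis lemma as one predicate, so that the choice over all shapes is a single step.\<close>
  define A where "A l a u \<longleftrightarrow> (\<forall>i<?q l. u i = algebra_op d n (young_symmetrizer n l)
        (\<Sum>e\<in>words d n. cscale (of_int (a i e)) (ket e))) \<and> (\<forall>i<?q l. u i \<noteq> 0) \<and>
      (\<forall>i<?q l. \<exists>k. \<forall>e\<in>words d n. a i e \<noteq> 0 \<longrightarrow> mset e = k) \<and>
      (\<forall>i<?q l. \<forall>j<?q l. i \<noteq> j \<longrightarrow> inner_on (words d n) (u i) (u j) = 0) \<and>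
      cfun.span (u ` {..<?q l}) = Q_irrep d n l" 
    for l and a :: "nat \<Rightarrow> nat list \<Rightarrow> int" and u :: "nat \<Rightarrow> tensor"
  have "\<exists>a u. A l a u" for l
    by (rule Q_basis[of d n l]) (unfold A_def, blast)
  then obtain a u where "\<And>l. A l (a l) (u l)" by metis
  note au = this[unfolded A_def]
  define B where "B l b w \<longleftrightarrow> (\<forall>i<?p l. w i = conv n
        (\<Sum>\<pi>\<in>symgrp n. cscale (of_int (b i \<pi>)) (gdelta \<pi>)) (young_symmetrizer n l)) \<and> (\<forall>i<?p l. w i \<noteq> 0) \<and>
      (\<forall>i<?p l. \<forall>j<?p l. i \<noteq> j \<longrightarrow> inner_on (symgrp n) (w i) (w j) = 0) \<and>
      cfun.span (w ` {..<?p l}) = P_irrep n l" 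
    for l and b :: "nat \<Rightarrow> (nat \<Rightarrow> nat) \<Rightarrow> int" and w :: "nat \<Rightarrow> (nat \<Rightarrow> nat) \<Rightarrow> complex"
  have "\<exists>b w. B l b w" for l
    by (rule P_basis[of n l]) (unfold B_def, blast)
  then obtain b w where "\<And>l. B l (b l) (w l)" by metis
  note bw = this[unfolded B_def]
  have u: "u l i = algebra_op d n (young_symmetrizer n l) (X a l i)" if "i < ?q l" for l i
    using au[of l] that unfolding X_def by blast
  have w: "w l j = conv n (Y b l j) (young_symmetrizer n l)" if "j < ?p l" for l j
    using bw[of l] that unfolding Y_def by blast
  have u0: "u l i \<noteq> 0" and uQ: "u l i \<in> Q_irrep d n l" if "i < ?q l" for l i
    using au[of l] that cfun.span_base[of "u l i" "u l ` {..<?q l}"] by auto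
  have w0: "w l j \<noteq> 0" and wP: "w l j \<in> P_irrep n l" if "j < ?p l" for l j
    using bw[of l] that cfun.span_base[of "w l j" "w l ` {..<?p l}"] by auto
  have u_orth: "inner_on (words d n) (u l i) (u l i') = 0" if "i < ?q l" "i' < ?q l" "i \<noteq> i'" for l i i'
    using au[of l] that by blast
  have w_orth: "inner_on (symgrp n) (w l j) (w l j') = 0" if "j < ?p l" "j' < ?p l" "j \<noteq> j'" for l j j'
    using bw[of l] that by blast
  let ?v = "young_vec d n (X a) (Y b)"
  let ?z = "\<lambda>(l, i, j). algebra_op d n (w l j) (u l i)"
  have S: "shape n l" "l \<in> partitions_upto d n" "i < ?q l" "j < ?p l" if "(l, i, j) \<in> schur_labels d n" for l i j
    using that by (auto simp: schur_labels_def partitions_upto_shape)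
  have v: "\<exists>\<mu>. \<mu> \<noteq> 0 \<and> ?v s = cscale \<mu> (?z s)" if "s \<in> schur_labels d n" for s
  proof -
    obtain l i j where s: "s = (l, i, j)" by (cases s)
    note * = S[OF that[unfolded s]]
    obtain \<mu> where \<mu>: "\<mu> \<noteq> 0" "\<And>f x. algebra_op d n (conv n f (young_symmetrizer n l)) x =
      cscale \<mu> (algebra_op d n (conv n f (young_symmetrizer n l)) (algebra_op d n (young_symmetrizer n l) x))"
      by (rule young_ideal_action[OF *(1), of d]) blast
    have "?v s = cscale \<mu> (?z s)"
      using \<mu>(2)[of "Y b l j" "X a l i"] * by (simp add: s young_vec_def u w)
    with \<mu>(1) show ?thesis by blast
  qed
  have z0: "?z s \<noteq> 0" if "s \<in> schur_labels d n" for s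
  proof -
    obtain l i j where s: "s = (l, i, j)" by (cases s)
    note * = S[OF that[unfolded s]]
    show ?thesis using P_Q_eq_0[OF *(1) wP[OF *(4)] uQ[OF *(3)]] u0[OF *(3)] w0[OF *(4)] by (auto simp: s)
  qed
  have z_orth: "inner_on (words d n) (?z s) (?z t) = 0"
    if st: "s \<in> schur_labels d n" "t \<in> schur_labels d n" "s \<noteq> t" for s t
  proof -
    obtain l i j l' i' j' where s: "s = (l, i, j)" "t = (l', i', j')" by (cases s, cases t)
    note * = S[OF st(1)[unfolded s]] S[OF st(2)[unfolded s]]
    show ?thesis
    proof (cases "l = l'")
      case False
      have "algebra_op d n (w l j) (u l i) \<in> young_component d n l"
        "algebra_op d n (w l' j') (u l' i') \<in> young_component d n l'"
        using * wP uQ by (auto intro: algebra_op_Q_P_component)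
      from young_component_orthogonal[OF *(1,5) False this] show ?thesis by (simp add: s)
    next
      case True
      obtain K where K: "K \<noteq> 0"
        "\<And>w w' u u'. w \<in> P_irrep n l \<Longrightarrow> w' \<in> P_irrep n l \<Longrightarrow> u \<in> Q_irrep d n l \<Longrightarrow> u' \<in> Q_irrep d n l \<Longrightarrow>
          inner_on (words d n) (algebra_op d n w u) (algebra_op d n w' u') =
          K * inner_on (symgrp n) w w' * inner_on (words d n) u u'"
        by (rule inner_P_Q[OF *(1)]) blast
      \<comment> \<open>Distinct labels of one shape differ in \<open>i\<close> or in
        \<open>j\<close>, so one factor of the product formula vanishes.\<close>
      have "inner_on (symgrp n) (w l j) (w l j') = 0 \<or> inner_on (words d n) (u l i) (u l i') = 0"
        using u_orth w_orth * st(3) True by (auto simp: s)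
      moreover have "inner_on (words d n) (?z s) (?z t) =
          K * inner_on (symgrp n) (w l j) (w l j') * inner_on (words d n) (u l i) (u l i')"
        using K(2) wP uQ * True by (simp add: s)
      ultimately show ?thesis by auto
    qed
  qed
  have v0: "?v s \<noteq> 0" if "s \<in> schur_labels d n" for s
    using v[OF that] z0[OF that] by auto
  have v_orth: "inner_on (words d n) (?v s) (?v t) = 0"
    if "s \<in> schur_labels d n" "t \<in> schur_labels d n" "s \<noteq> t" for s t
    using v[OF that(1)] v[OF that(2)] z_orth[OF that] by (auto simp: inner_on_linear)
  have zV: "?z s \<in> tensor_space d n" for s by (cases s) simp
  have nz: "inner_on (words d n) (?z s) (?z s) \<noteq> 0" if "s \<in> schur_labels d n" for s
    using z0[OF that] tensor_inner_eq_0[OF zV[of s]] by simp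
  have ind: "cfun.independent (?z ` schur_labels d n)" "card (?z ` schur_labels d n) = card (schur_labels d n)"
    using orthogonal_family[of "schur_labels d n" "words d n" ?z] nz z_orth by simp_all
  have "tensor_space d n \<subseteq> cfun.span (?z ` schur_labels d n)"
  proof -
    have "young_component d n l \<subseteq> cfun.span (?z ` schur_labels d n)" if "l \<in> partitions_upto d n" for l
    proof -
      have "young_component d n l = cfun.span {algebra_op d n (w l j) (u l i) | i j. i \<in> {..<?q l} \<and> j \<in> {..<?p l}}"
        by (rule young_component_eq_span) (use that au[of l] bw[of l] in \<open>auto simp: partitions_upto_shape\<close>)
      also have "\<dots> \<subseteq> cfun.span (?z ` schur_labels d n)"
        by (rule cfun.span_mono) (use that in \<open>force simp: schur_labels_def\<close>)
      finally show ?thesis .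
    qed
    hence "cfun.span (\<Union>l\<in>partitions_upto d n. young_component d n l) \<subseteq> cfun.span (?z ` schur_labels d n)"
      by (intro cfun.span_minimal) auto
    thus ?thesis using tensor_space_span_components by blast
  qed
  hence "card (?z ` schur_labels d n) = cfun.dim (tensor_space d n)"
    using zV ind(1) by (intro cfun.basis_card_eq_dim) blast+
  hence card: "card (schur_labels d n) = d ^ n" using ind(2) dim_tensor_space by simp
  have XV: "X a l i \<in> tensor_space d n" for l i
    unfolding X_def
    by (intro cfun.subspace_sum cfun.subspace_scale subspace_tensor_space ket_tensor_space)
  have "schur_data d n (schur_labels d n) (X a) (Y b)"
    unfolding schur_data_def
  proof (intro conjI)
    show "card (schur_labels d n) = d ^ n" by (rule card)
    show "\<forall>s\<in>schur_labels d n. ?v s \<noteq> 0" using v0 by blast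
    show "\<forall>s\<in>schur_labels d n. \<forall>t\<in>schur_labels d n. s \<noteq> t \<longrightarrow> inner_on (words d n) (?v s) (?v t) = 0"
      using v_orth by blast
    show "finite (schur_labels d n)" by simp
  qed (use XV in \<open>auto simp: schur_labels_def\<close>)
  thus ?thesis unfolding X_def[abs_def] Y_def[abs_def] using au by (intro that[of a b]) blast+
qed

lemma card_schur_labels_eq: "card (schur_labels d n) = d ^ n"
  by (rule schur_data_exists[of d n]) (simp add: schur_data_def)

text \<open>The dimension count forces the bounds \<open>q \<le> dim Q\<close>, \<open>p \<le> dim P\<close> given by orthogonality to be
  equalities.\<close>
lemma schur_data_labels:
  assumes "schur_data d n S X Y"
  shows "S = schur_labels d n"
    "\<And>l. l \<in> partitions_upto d n \<Longrightarrow>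
      cfun.span ((\<lambda>i. algebra_op d n (young_symmetrizer n l) (X l i)) ` {..<cfun.dim (Q_irrep d n l)}) = Q_irrep d n l"
    "\<And>l. l \<in> partitions_upto d n \<Longrightarrow>
      cfun.span ((\<lambda>j. conv n (Y l j) (young_symmetrizer n l)) ` {..<cfun.dim (P_irrep n l)}) = P_irrep n l"
proof -
  let ?q = "\<lambda>l. cfun.dim (Q_irrep d n l)" and ?p = "\<lambda>l. cfun.dim (P_irrep n l)"
  let ?v = "young_vec d n X Y"
  note dest = schur_dataD[OF assms]
  note fin = dest(1) and card = dest(2) and part = dest(3) and XV = dest(4) and down1 = dest(5)
    and down2 = dest(6) and rect = dest(7) and v0 = dest(8) and orth = dest(9)
  define u where "u l i = algebra_op d n (young_symmetrizer n l) (X l i)" for l i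
  define w where "w l j = conv n (Y l j) (young_symmetrizer n l)" for l j
  define I where "I l = {i. \<exists>j. (l, i, j) \<in> S}" for l
  define J where "J l = {j. \<exists>i. (l, i, j) \<in> S}" for l
  have IJ: "(l, i, j) \<in> S \<longleftrightarrow> i \<in> I l \<and> j \<in> J l" for l i j
  proof
    assume "i \<in> I l \<and> j \<in> J l"
    then obtain i' j' where "(l, i, j') \<in> S" "(l, i', j) \<in> S" by (auto simp: I_def J_def)
    thus "(l, i, j) \<in> S" by (rule rect)
  qed (auto simp: I_def J_def)
  have fin_I: "finite (I l)" for l
    by (rule finite_subset[of _ "(\<lambda>(l, i, j). i) ` S"]) (use fin in \<open>force simp: I_def\<close>)+
  have fin_J: "finite (J l)" for l
    by (rule finite_subset[of _ "(\<lambda>(l, i, j). j) ` S"]) (use fin in \<open>force simp: J_def\<close>)+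
  have I_eq: "I l = {..<card (I l)}" for l
  proof (rule downclosed_eq_lessThan[OF fin_I])
    fix x y assume "x \<in> I l" "y \<le> x"
    from \<open>y \<le> x\<close> \<open>x \<in> I l\<close> show "y \<in> I l"
      by (induction rule: inc_induct) (use down1 in \<open>auto simp: I_def\<close>)
  qed
  have J_eq: "J l = {..<card (J l)}" for l
  proof (rule downclosed_eq_lessThan[OF fin_J])
    fix x y assume "x \<in> J l" "y \<le> x"
    from \<open>y \<le> x\<close> \<open>x \<in> J l\<close> show "y \<in> J l"
      by (induction rule: inc_induct) (use down2 in \<open>auto simp: J_def\<close>)
  qed
  have P: "w l j \<in> P_irrep n l" for l j by (simp add: w_def P_irrep_eq)
  have Q: "u l i \<in> Q_irrep d n l" if "i \<in> I l" for l i
    using that XV by (auto simp: I_def u_def Q_irrep_def)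
  \<comment> \<open>The product formula separates the two families: fixing one \<open>j\<close>, for
    which \<open>w l j\<close> has nonzero norm, makes the \<open>u l i\<close> orthogonal, and
    symmetrically. An index from the other family must exist for this, so both sets are assumed
    nonempty.\<close>
  have bounds: "card (I l) \<le> ?q l \<and> card (J l) \<le> ?p l \<and> cfun.independent (u l ` I l) \<and>
      cfun.independent (w l ` J l) \<and> card (u l ` I l) = card (I l) \<and> card (w l ` J l) = card (J l)"
    if l: "l \<in> partitions_upto d n" and ne: "I l \<noteq> {}" "J l \<noteq> {}" for l
  proof -
    have shape: "shape n l" using l by (simp add: partitions_upto_shape)
    obtain \<mu> where \<mu>: "\<mu> \<noteq> 0" "\<And>f x. algebra_op d n (conv n f (young_symmetrizer n l)) x =
      cscale \<mu> (algebra_op d n (conv n f (young_symmetrizer n l)) (algebra_op d n (young_symmetrizer n l) x))"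
      by (rule young_ideal_action[OF shape, of d]) blast
    obtain K where K: "K \<noteq> 0"
      "\<And>w w' u u'. w \<in> P_irrep n l \<Longrightarrow> w' \<in> P_irrep n l \<Longrightarrow> u \<in> Q_irrep d n l \<Longrightarrow> u' \<in> Q_irrep d n l \<Longrightarrow>
        inner_on (words d n) (algebra_op d n w u) (algebra_op d n w' u') =
        K * inner_on (symgrp n) w w' * inner_on (words d n) u u'"
      by (rule inner_P_Q[OF shape]) blast
    have v: "?v (l, i, j) = cscale \<mu> (algebra_op d n (w l j) (u l i))" for i j
      using \<mu>(2)[of "Y l j" "X l i"] by (simp add: young_vec_def u_def w_def)
    have inner: "inner_on (words d n) (?v (l, i, j)) (?v (l, i', j')) =
        cnj \<mu> * \<mu> * K * inner_on (symgrp n) (w l j) (w l j') * inner_on (words d n) (u l i) (u l i')"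
      if "i \<in> I l" "i' \<in> I l" for i i' j j'
      using K(2)[OF P P Q[OF that(1)] Q[OF that(2)]] by (simp add: v inner_on_linear)
    have u0: "u l i \<noteq> 0" and w0: "w l j \<noteq> 0" if "i \<in> I l" "j \<in> J l" for i j
      using v0[of "(l, i, j)"] IJ that v by (auto simp: algebra_op_linear)
    have uu: "inner_on (words d n) (u l i) (u l i) \<noteq> 0" if "i \<in> I l" for i
      using u0 that ne Q[OF that] Q_irrep_tensor_space tensor_inner_eq_0 by blast
    have ww: "inner_on (symgrp n) (w l j) (w l j) \<noteq> 0" if "j \<in> J l" for j
      using w0 that ne P P_irrep_galg galg_inner_eq_0 by blast
    have "inner_on (words d n) (u l i) (u l i') = 0" if i: "i \<in> I l" "i' \<in> I l" "i \<noteq> i'" for i i'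
    proof -
      obtain j where j: "j \<in> J l" using ne by blast
      have "inner_on (words d n) (?v (l, i, j)) (?v (l, i', j)) = 0" using i j IJ by (intro orth) auto
      thus ?thesis using inner[OF i(1,2), of j j] ww[OF j] K(1) \<mu>(1) by simp
    qed
    from orthogonal_family[of "I l" "words d n" "u l", OF fin_I uu this]
    have u_ind: "cfun.independent (u l ` I l)" "card (u l ` I l) = card (I l)" by simp_all
    have "inner_on (symgrp n) (w l j) (w l j') = 0" if j: "j \<in> J l" "j' \<in> J l" "j \<noteq> j'" for j j'
    proof -
      obtain i where i: "i \<in> I l" using ne by blast
      have "inner_on (words d n) (?v (l, i, j)) (?v (l, i, j')) = 0" using i j IJ by (intro orth) auto
      thus ?thesis using inner[OF i i, of j j'] uu[OF i] K(1) \<mu>(1) by simp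
    qed
    from orthogonal_family[of "J l" "symgrp n" "w l", OF fin_J ww this]
    have w_ind: "cfun.independent (w l ` J l)" "card (w l ` J l) = card (J l)" by simp_all
    have "card (u l ` I l) \<le> ?q l"
      by (rule independent_card_le_dim(2)[of "ket ` words d n"])
         (use u_ind Q Q_irrep_tensor_space tensor_space_span_ket in blast)+
    moreover have "card (w l ` J l) \<le> ?p l"
      by (rule independent_card_le_dim(2)[of "gdelta ` symgrp n"])
         (use w_ind P P_irrep_galg galg_span_gdelta in blast)+
    ultimately show ?thesis using u_ind w_ind by simp
  qed
  have prod_le: "card (I l) * card (J l) \<le> ?q l * ?p l" if "l \<in> partitions_upto d n" for l
    using bounds[OF that] mult_le_mono by (cases "I l = {} \<or> J l = {}") auto
  have "S = Sigma (partitions_upto d n) (\<lambda>l. I l \<times> J l)"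
    using part IJ by auto
  hence "card S = (\<Sum>l\<in>partitions_upto d n. card (I l) * card (J l))"
    using fin_I fin_J by (simp add: card_SigmaI card_cartesian_product)
  hence sums: "(\<Sum>l\<in>partitions_upto d n. card (I l) * card (J l)) = (\<Sum>l\<in>partitions_upto d n. ?q l * ?p l)"
    using card card_schur_labels_eq card_schur_labels by metis
  \<comment> \<open>Termwise inequalities between sums that agree are equalities.\<close>
  have prod_eq: "card (I l) * card (J l) = ?q l * ?p l" if "l \<in> partitions_upto d n" for l
    by (rule sum_mono_inv[OF sums prod_le that finite_partitions_upto])
  have eq: "card (I l) = ?q l \<and> card (J l) = ?p l \<and> I l \<noteq> {} \<and> J l \<noteq> {}"
    if l: "l \<in> partitions_upto d n" for l
  proof -
    have shape: "shape n l" "length l \<le> d" using l by (simp_all add: partitions_upto_shape)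
    have pos: "0 < cfun.dim V" if "finite T" "V \<subseteq> cfun.span T" "x \<in> V" "x \<noteq> 0"
      for T V and x :: "'z \<Rightarrow> complex"
      using independent_card_le_dim(2)[OF that(1,2), of "{x}"] that(3,4) by simp
    obtain x where "x \<in> Q_irrep d n l" "x \<noteq> 0" using Q_irrep_neq_0[OF shape] by blast
    hence q: "0 < ?q l"
      using Q_irrep_tensor_space tensor_space_span_ket by (intro pos[of "ket ` words d n" _ x]) blast+
    have p: "0 < ?p l"
      using P_irrep_galg galg_span_gdelta young_P_irrep young_symmetrizer_neq_0[OF shape(1)]
      by (intro pos[of "gdelta ` symgrp n" _ "young_symmetrizer n l"]) blast+
    have ne: "I l \<noteq> {}" "J l \<noteq> {}" using prod_eq[OF l] p q by auto
    have le: "card (I l) \<le> ?q l" "card (J l) \<le> ?p l" using bounds[OF l ne] by auto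
    \<comment> \<open>Both dimensions are positive, so a strict inequality in one factor would make
      the product strictly smaller.\<close>
    have "card (I l) = ?q l"
    proof (rule ccontr)
      assume "card (I l) \<noteq> ?q l"
      hence "card (I l) * card (J l) < ?q l * ?p l"
        using le p by (intro mult_less_le_imp_less) (use ne fin_J in \<open>auto simp: card_gt_0_iff\<close>)
      thus False using prod_eq[OF l] by simp
    qed
    moreover from this have "card (J l) = ?p l" using prod_eq[OF l] q by simp
    ultimately show ?thesis using ne by simp
  qed
  show "S = schur_labels d n"
    using part IJ eq I_eq J_eq by (auto simp: schur_labels_def) (metis lessThan_iff)+
  fix l assume l: "l \<in> partitions_upto d n"
  have ne: "I l \<noteq> {}" "J l \<noteq> {}" using eq[OF l] by auto
  note b = bounds[OF l ne]
  have "cfun.span (u l ` I l) = Q_irrep d n l"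
  proof (rule independent_card_eq_dim_span)
    show "finite (ket ` words d n)" by simp
    show "Q_irrep d n l \<subseteq> cfun.span (ket ` words d n)"
      using Q_irrep_tensor_space tensor_space_span_ket by blast
    show "u l ` I l \<subseteq> Q_irrep d n l" using Q by blast
    show "cfun.dim (Q_irrep d n l) \<le> card (u l ` I l)" using b eq[OF l] by simp
  qed (use b subspace_Q_irrep in simp_all)
  thus "cfun.span ((\<lambda>i. algebra_op d n (young_symmetrizer n l) (X l i)) ` {..<?q l}) = Q_irrep d n l"
    using eq[OF l] I_eq[of l] unfolding u_def[abs_def] by simp
  have "cfun.span (w l ` J l) = P_irrep n l"
  proof (rule independent_card_eq_dim_span)
    show "finite (gdelta ` symgrp n)" by simp
    show "P_irrep n l \<subseteq> cfun.span (gdelta ` symgrp n)"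
      using P_irrep_galg galg_span_gdelta by blast
    show "w l ` J l \<subseteq> P_irrep n l" using P by blast
    show "cfun.dim (P_irrep n l) \<le> card (w l ` J l)" using b eq[OF l] by simp
  qed (use b subspace_P_irrep in simp_all)
  thus "cfun.span ((\<lambda>j. conv n (Y l j) (young_symmetrizer n l)) ` {..<?p l}) = P_irrep n l"
    using eq[OF l] J_eq[of l] unfolding w_def[abs_def] by simp
qed

lemma span_scaled:
  assumes "\<And>i. P i \<Longrightarrow> r i \<noteq> 0"
  shows "cfun.span {cscale (r i) (f i) | i. P i} = cfun.span {f i | i. P i}"
proof (intro equalityI cfun.span_minimal subsetI)
  fix x assume "x \<in> {cscale (r i) (f i) | i. P i}"
  then obtain i where i: "x = cscale (r i) (f i)" "P i" by blast
  hence "f i \<in> cfun.span {f i | i. P i}" by (intro cfun.span_base) blast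
  thus "x \<in> cfun.span {f i | i. P i}" unfolding i(1) by (rule cfun.span_scale)
next
  fix x assume "x \<in> {f i | i. P i}"
  then obtain i where i: "x = f i" "P i" by blast
  hence "x = cscale (1 / r i) (cscale (r i) (f i))" using assms by simp
  also have "\<dots> \<in> cfun.span {cscale (r i) (f i) | i. P i}"
    using i(2) by (intro cfun.span_scale cfun.span_base) blast
  finally show "x \<in> cfun.span {cscale (r i) (f i) | i. P i}" .
qed simp_all

lemma schur_data_basis:
  assumes data: "schur_data d n S X Y"
    and B: "\<And>s. s \<in> S \<Longrightarrow> \<exists>r. r \<noteq> 0 \<and> B s = cscale r (young_vec d n X Y s)"
  shows "schur_basis d n B"
proof -
  let ?q = "\<lambda>l. cfun.dim (Q_irrep d n l)" and ?p = "\<lambda>l. cfun.dim (P_irrep n l)"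
  define u where "u l i = algebra_op d n (young_symmetrizer n l) (X l i)" for l i
  define w where "w l j = conv n (Y l j) (young_symmetrizer n l)" for l j
  note lab = schur_data_labels[OF data, folded u_def w_def]
  have "\<exists>r. r \<noteq> 0 \<and> B (l, i, j) = cscale r (algebra_op d n (w l j) (u l i))"
    if "l \<in> partitions_upto d n" "i < ?q l" "j < ?p l" for l i j
  proof -
    have "(l, i, j) \<in> S" using that lab(1) by (simp add: schur_labels_def)
    then obtain r where r: "r \<noteq> 0" "B (l, i, j) = cscale r (young_vec d n X Y (l, i, j))" using B by blast
    have shape: "shape n l" using that by (simp add: partitions_upto_shape)
    obtain \<mu> where \<mu>: "\<mu> \<noteq> 0" "\<And>f x. algebra_op d n (conv n f (young_symmetrizer n l)) x =
      cscale \<mu> (algebra_op d n (conv n f (young_symmetrizer n l)) (algebra_op d n (young_symmetrizer n l) x))"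
      by (rule young_ideal_action[OF shape, of d]) blast
    have "B (l, i, j) = cscale (r * \<mu>) (algebra_op d n (w l j) (u l i))"
      using r(2) \<mu>(2)[of "Y l j" "X l i"] by (simp add: young_vec_def u_def w_def)
    thus ?thesis using r(1) \<mu>(1) by (intro exI[of _ "r * \<mu>"]) simp
  qed
  then obtain r where r: "\<And>l i j. l \<in> partitions_upto d n \<Longrightarrow> i < ?q l \<Longrightarrow> j < ?p l \<Longrightarrow>
      r l i j \<noteq> 0 \<and> B (l, i, j) = cscale (r l i j) (algebra_op d n (w l j) (u l i))" by metis
  have v0: "w l j \<noteq> 0 \<and> u l i \<noteq> 0" if "l \<in> partitions_upto d n" "i < ?q l" "j < ?p l" for l i j
  proof -
    have "(l, i, j) \<in> S" using that lab(1) by (simp add: schur_labels_def)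
    hence "young_vec d n X Y (l, i, j) \<noteq> 0" by (rule schur_dataD(8)[OF data])
    thus ?thesis by (auto simp: young_vec_def w_def u_def algebra_op_conv algebra_op_linear)
       (metis algebra_op_conv algebra_op_linear(3))
  qed
  have uQ: "u l i \<in> Q_irrep d n l" and wP: "w l j \<in> P_irrep n l"
    if "l \<in> partitions_upto d n" "i < ?q l" "j < ?p l" for l i j
    using lab(2,3)[OF that(1)] that(2,3) cfun.span_base[of "u l i" "u l ` {..<?q l}"]
      cfun.span_base[of "w l j" "w l ` {..<?p l}"] by auto
  show ?thesis
    unfolding schur_basis_def Let_def
  proof (intro conjI ballI allI impI)
    fix l assume l: "l \<in> partitions_upto d n"
    have shape: "shape n l" using l by (simp add: partitions_upto_shape)
    have pos: "?q l > 0" "?p l > 0"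
    proof -
      obtain x where x: "x \<in> Q_irrep d n l" "x \<noteq> 0"
        using Q_irrep_neq_0[of n l d] l by (auto simp: partitions_upto_shape)
      show "?q l > 0"
      proof (rule ccontr)
        assume "\<not> ?q l > 0"
        hence "Q_irrep d n l = {0}" using lab(2)[OF l] by simp
        thus False using x by simp
      qed
      show "?p l > 0"
      proof (rule ccontr)
        assume "\<not> ?p l > 0"
        hence "P_irrep n l = {0}" using lab(3)[OF l] by simp
        thus False using young_P_irrep young_symmetrizer_neq_0[OF shape] by blast
      qed
    qed
    show "isotypic d n l = cfun.span {B (l, i, j) | i j. i < ?q l \<and> j < ?p l}"
    proof -
      \<comment> \<open>The two indices are combined into a pair, as \<open>span_scaled\<close>
        handles a single index.\<close>
      have "{B (l, i, j) | i j. i < ?q l \<and> j < ?p l} =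
          {cscale (case p of (i, j) \<Rightarrow> r l i j) (case p of (i, j) \<Rightarrow> algebra_op d n (w l j) (u l i)) | p.
             case p of (i, j) \<Rightarrow> i < ?q l \<and> j < ?p l}"
        using r[OF l] by auto (metis case_prod_conv)
      hence "cfun.span {B (l, i, j) | i j. i < ?q l \<and> j < ?p l} =
          cfun.span {case p of (i, j) \<Rightarrow> algebra_op d n (w l j) (u l i) | p. case p of (i, j) \<Rightarrow> i < ?q l \<and> j < ?p l}"
        using r[OF l] by (simp only:) (rule span_scaled, auto)
      also have "{case p of (i, j) \<Rightarrow> algebra_op d n (w l j) (u l i) | p. case p of (i, j) \<Rightarrow> i < ?q l \<and> j < ?p l} =
          {algebra_op d n (w l j) (u l i) | i j. i \<in> {..<?q l} \<and> j \<in> {..<?p l}}" by auto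
      also have "cfun.span \<dots> = young_component d n l"
        by (rule young_component_eq_span[OF shape lab(3,2)[OF l], symmetric])
      finally show ?thesis by (rule trans[OF isotypic_eq_young_component[OF shape] sym])
    qed
    {
      fix j assume j: "j < ?p l"
      have "{B (l, i, j) | i. i < ?q l} = {cscale (r l i j) (algebra_op d n (w l j) (u l i)) | i. i < ?q l}"
        using r[OF l] j by auto metis
      hence "cfun.span {B (l, i, j) | i. i < ?q l} = cfun.span {algebra_op d n (w l j) (u l i) | i. i < ?q l}"
        using r[OF l _ j] by (simp only:) (rule span_scaled, auto)
      also have "\<dots> = algebra_op d n (w l j) ` Q_irrep d n l"
      proof
        \<comment> \<open>The empty set of matrices is enough here, as only the subspace part of
          \<open>subrep\<close> is extracted.\<close>
        have "cfun.subspace (algebra_op d n (w l j) ` Q_irrep d n l)"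
          using Q_rep_iso(1)[OF shape wP[OF l pos(1) j], where G = "{}" and d = d] v0[OF l pos(1) j] by (simp add: subrep_def)
        thus "cfun.span {algebra_op d n (w l j) (u l i) | i. i < ?q l} \<subseteq> algebra_op d n (w l j) ` Q_irrep d n l"
          using uQ[OF l _ j] by (intro cfun.span_minimal) auto
        have "cfun.span (u l ` {..<?q l}) \<subseteq>
            {x. algebra_op d n (w l j) x \<in> cfun.span {algebra_op d n (w l j) (u l i) | i. i < ?q l}}"
          by (intro cfun.span_minimal)
             (auto simp: cfun.subspace_def algebra_op_linear cfun.span_zero cfun.span_add cfun.span_scale
                intro!: cfun.span_base)
        thus "algebra_op d n (w l j) ` Q_irrep d n l \<subseteq> cfun.span {algebra_op d n (w l j) (u l i) | i. i < ?q l}"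
          unfolding lab(2)[OF l] by blast
      qed
      finally have *: "cfun.span {B (l, i, j) | i. i < ?q l} = algebra_op d n (w l j) ` Q_irrep d n l" .
      show "subrep (unitary_grp d) (tensor_pow_op d n) (tensor_space d n) (cfun.span {B (l, i, j) | i. i < ?q l})"
        "rep_iso (unitary_grp d) (tensor_pow_op d n) (cfun.span {B (l, i, j) | i. i < ?q l}) (tensor_pow_op d n) (Q_irrep d n l)"
        unfolding * using Q_rep_iso[OF shape wP[OF l pos(1) j]] v0[OF l pos(1) j] by blast+
    }
    {
      fix i assume i: "i < ?q l"
      have "{B (l, i, j) | j. j < ?p l} = {cscale (r l i j) (algebra_op d n (w l j) (u l i)) | j. j < ?p l}"
        using r[OF l i] by auto metis
      hence "cfun.span {B (l, i, j) | j. j < ?p l} = cfun.span {algebra_op d n (w l j) (u l i) | j. j < ?p l}"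
        using r[OF l i] by (simp only:) (rule span_scaled, auto)
      also have "\<dots> = (\<lambda>w. algebra_op d n w (u l i)) ` P_irrep n l"
      proof
        have "cfun.subspace ((\<lambda>w. algebra_op d n w (u l i)) ` P_irrep n l)"
          using P_rep_iso(1)[OF shape uQ[OF l i pos(2)]] v0[OF l i pos(2)] by (simp add: subrep_def)
        thus "cfun.span {algebra_op d n (w l j) (u l i) | j. j < ?p l} \<subseteq> (\<lambda>w. algebra_op d n w (u l i)) ` P_irrep n l"
          using wP[OF l i] by (intro cfun.span_minimal) auto
        have "cfun.span (w l ` {..<?p l}) \<subseteq>
            {x. algebra_op d n x (u l i) \<in> cfun.span {algebra_op d n (w l j) (u l i) | j. j < ?p l}}"
          by (intro cfun.span_minimal)
             (auto simp: cfun.subspace_def algebra_op_linear cfun.span_zero cfun.span_add cfun.span_scale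
                intro!: cfun.span_base)
        thus "(\<lambda>w. algebra_op d n w (u l i)) ` P_irrep n l \<subseteq> cfun.span {algebra_op d n (w l j) (u l i) | j. j < ?p l}"
          unfolding lab(3)[OF l] by blast
      qed
      finally have *: "cfun.span {B (l, i, j) | j. j < ?p l} = (\<lambda>w. algebra_op d n w (u l i)) ` P_irrep n l" .
      show "subrep (symgrp n) (perm_op d n) (tensor_space d n) (cfun.span {B (l, i, j) | j. j < ?p l})"
        "rep_iso (symgrp n) (perm_op d n) (cfun.span {B (l, i, j) | j. j < ?p l}) regular_op (P_irrep n l)"
        unfolding * using P_rep_iso[OF shape uQ[OF l i pos(2)]] v0[OF l i pos(2)] by blast+
    }
  qed
qed

lemma schur_data_orthonormal:
  assumes data: "schur_data d n S X Y"
    and B: "\<And>s. s \<in> S \<Longrightarrow> B s = cscale (1 / of_real (sqrt (\<Sum>e\<in>words d n. (cmod (young_vec d n X Y s e))\<^sup>2))) (young_vec d n X Y s)"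
  shows "orthonormal_basis d n S B" "\<And>s. s \<in> S \<Longrightarrow> \<exists>r. r \<noteq> 0 \<and> B s = cscale r (young_vec d n X Y s)"
proof -
  let ?v = "young_vec d n X Y"
  define N where "N s = (\<Sum>e\<in>words d n. (cmod (?v s e))\<^sup>2)" for s
  have vV: "?v s \<in> tensor_space d n" for s by (cases s) (simp add: young_vec_def)
  have orth: "inner_on (words d n) (?v s) (?v t) = (if s = t then of_real (N s) else 0)"
    if "s \<in> S" "t \<in> S" for s t
    using that schur_dataD(9)[OF data] by (auto simp: N_def inner_on_self)
  have Npos: "N s > 0" if "s \<in> S" for s
  proof -
    have "N s \<ge> 0" by (auto simp: N_def intro: sum_nonneg)
    moreover have "N s \<noteq> 0"
    proof
      assume "N s = 0"
      hence "inner_on (words d n) (?v s) (?v s) = 0" using orth[OF that that] by simp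
      hence "?v s = 0" using tensor_inner_eq_0[OF vV] by blast
      thus False using schur_dataD(8)[OF data that] by simp
    qed
    ultimately show ?thesis by simp
  qed
  have Bv: "B s = cscale (1 / of_real (sqrt (N s))) (?v s)" if "s \<in> S" for s
    using B[OF that] by (simp add: N_def)
  show "\<exists>r. r \<noteq> 0 \<and> B s = cscale r (?v s)" if "s \<in> S" for s
    using Bv[OF that] Npos[OF that] by (intro exI[of _ "1 / of_real (sqrt (N s))"]) auto
  have BV: "B s \<in> tensor_space d n" if "s \<in> S" for s
    unfolding Bv[OF that] by (intro cfun.subspace_scale subspace_tensor_space vV)
  have B_orth: "inner_on (words d n) (B s) (B t) = (if s = t then 1 else 0)" if st: "s \<in> S" "t \<in> S" for s t
  proof -
    define k where "k s = 1 / sqrt (N s)" for s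
    have "inner_on (words d n) (B s) (B t) = of_real (k s) * (of_real (k t) * (if s = t then of_real (N s) else 0))"
      unfolding Bv[OF st(1)] Bv[OF st(2)] inner_on_linear orth[OF st] by (simp add: k_def)
    also have "\<dots> = (if s = t then of_real (k s * (k s * N s)) else 0)" by simp
    also have "k s * (k s * N s) = 1"
      using Npos[OF st(1)] by (simp add: k_def field_simps)
    finally show ?thesis by simp
  qed
  have fin: "finite S" "card S = d ^ n" by (rule schur_dataD[OF data])+
  have "cfun.independent (B ` S)" "card (B ` S) = card S"
    using orthogonal_family[of S "words d n" B] fin B_orth by auto
  \<comment> \<open>Spanning follows from counting: \<open>d ^ n\<close> independent vectors in a
    space of that dimension.\<close>
  hence "cfun.span (B ` S) = tensor_space d n"
    using fin BV dim_tensor_space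
    by (intro independent_card_eq_dim_span[of "ket ` words d n"] subspace_tensor_space)
       (auto simp: tensor_space_span_ket)
  thus "orthonormal_basis d n S B"
    unfolding orthonormal_basis_def tinner_inner_on using BV B_orth by blast
qed

text \<open>Words with the same letters differ by a permutation of positions, so a tensor in one
  weight space lies in the span of a single orbit. This span is stable under permutations, hence
  under the group algebra.\<close>

lemma span_ket_orbit:
  assumes "x \<in> tensor_space d n" "v \<in> words d n" "\<And>e. x e \<noteq> 0 \<Longrightarrow> mset e = mset v"
  shows "algebra_op d n f x \<in> cfun.span {perm_op d n \<pi> (ket v) | \<pi>. \<pi> \<in> symgrp n}" (is "_ \<in> cfun.span ?T")
proof -
  have inv: "perm_op d n \<sigma> y \<in> cfun.span ?T" if \<sigma>: "\<sigma> \<in> symgrp n" and y: "y \<in> cfun.span ?T" for \<sigma> y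
  proof -
    have T: "perm_op d n \<sigma> (perm_op d n \<pi> (ket v)) \<in> ?T" if "\<pi> \<in> symgrp n" for \<pi>
      unfolding perm_op_comp[OF \<sigma> that, symmetric] using symgrp_comp[OF \<sigma> that] by blast
    have zero: "perm_op d n \<sigma> 0 = 0"
      using \<sigma> by (intro ext) (simp add: perm_op_apply)
    have "cfun.span ?T \<subseteq> {y. perm_op d n \<sigma> y \<in> cfun.span ?T}"
    proof (rule cfun.span_minimal)
      show "?T \<subseteq> {y. perm_op d n \<sigma> y \<in> cfun.span ?T}"
      proof
        fix y assume "y \<in> ?T"
        then obtain \<pi> where "y = perm_op d n \<pi> (ket v)" "\<pi> \<in> symgrp n" by blast
        thus "y \<in> {y. perm_op d n \<sigma> y \<in> cfun.span ?T}" using cfun.span_base[OF T] by simp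
      qed
      show "cfun.subspace {y. perm_op d n \<sigma> y \<in> cfun.span ?T}"
        using \<sigma> zero by (simp add: cfun.subspace_def perm_op_linear cfun.span_zero cfun.span_add cfun.span_scale)
    qed
    thus ?thesis using y by blast
  qed
  have "cscale (x e) (ket e) \<in> cfun.span ?T" if e: "e \<in> words d n" for e
  proof (cases "x e = 0")
    case False
    hence "mset v = mset e" using assms(3) by simp
    then obtain \<pi> where \<pi>: "\<pi> permutes {..<length e}" "permute_list \<pi> e = v"
      by (rule mset_eq_permutation)
    have "length e = n" using e by (simp add: words_def)
    hence \<pi>': "\<pi> \<in> symgrp n" and "wact n \<pi> e = v" using \<pi> by (auto simp: symgrp_def wact_def permute_list_def)
    hence "ket e = perm_op d n \<pi> (ket v)" using e assms(2) by (simp add: perm_op_ket wact_comp) (metis wact_inv(2))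
    thus ?thesis using \<pi>' by (intro cfun.span_scale cfun.span_base) blast
  qed (simp add: cfun.span_zero)
  moreover have "x = (\<Sum>e\<in>words d n. cscale (x e) (ket e))"
    using assms(1)
    by (intro ext) (auto simp: tensor_space_def ket_def fun_sum_apply if_distrib[of "\<lambda>x. _ * x"] cong: if_cong)
  ultimately have "x \<in> cfun.span ?T" by (metis (no_types, lifting) cfun.span_sum)
  thus ?thesis
    unfolding algebra_op_def by (intro cfun.span_sum cfun.span_scale inv)
qed

section \<open>Computable functions\<close>

definition computable :: "(nat \<Rightarrow> nat) \<Rightarrow> bool" where
  "computable f \<longleftrightarrow> (\<exists>A. \<forall>x. computes A [x] (f x))"

definition computable2 :: "(nat \<Rightarrow> nat \<Rightarrow> nat) \<Rightarrow> bool" where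
  "computable2 f \<longleftrightarrow> (\<exists>A. \<forall>x y. computes A [x, y] (f x y))"

lemma computes_Comp1: "computes g xs y \<Longrightarrow> computes f [y] z \<Longrightarrow> computes (Comp f [g]) xs z"
  by (rule computes.comp[of xs "[g]" "[y]"]) auto

lemma computes_Comp2:
  "computes g xs y \<Longrightarrow> computes h xs y' \<Longrightarrow> computes f [y, y'] z \<Longrightarrow> computes (Comp f [g, h]) xs z"
  by (rule computes.comp[of xs "[g, h]" "[y, y']"]) auto

lemma computes_Proj: "i < length xs \<Longrightarrow> xs ! i = y \<Longrightarrow> computes (Proj i) xs y"
  using computes.proj by blast

lemma computes_PrimRec:
  assumes "computes F xs (a 0)" "\<And>k. computes G (k # a k # xs) (a (Suc k))"
  shows "computes (PrimRec F G) (k # xs) (a k)"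
  by (induction k) (auto intro: computes.prim_0 computes.prim_Suc assms)

lemma computable_comp: "computable f \<Longrightarrow> computable g \<Longrightarrow> computable (\<lambda>x. f (g x))"
  unfolding computable_def by (meson computes_Comp1)

lemma computable2_comp: "computable2 f \<Longrightarrow> computable g \<Longrightarrow> computable h \<Longrightarrow> computable (\<lambda>x. f (g x) (h x))"
  unfolding computable_def computable2_def by (meson computes_Comp2)

lemma computable2_comp2: "computable2 f \<Longrightarrow> computable2 g \<Longrightarrow> computable2 h \<Longrightarrow> computable2 (\<lambda>x y. f (g x y) (h x y))"
  unfolding computable2_def by (meson computes_Comp2)

lemma computable_comp2: "computable f \<Longrightarrow> computable2 g \<Longrightarrow> computable2 (\<lambda>x y. f (g x y))"
  unfolding computable_def computable2_def by (meson computes_Comp1)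

lemma computable2_proj: "computable2 (\<lambda>x y. x)" "computable2 (\<lambda>x y. y)"
proof -
  show "computable2 (\<lambda>x y. x)" unfolding computable2_def by (rule exI[of _ "Proj 0"]) (simp add: computes_Proj)
  show "computable2 (\<lambda>x y. y)" unfolding computable2_def by (rule exI[of _ "Proj 1"]) (simp add: computes_Proj)
qed

lemma computable_id: "computable (\<lambda>x. x)"
  unfolding computable_def by (rule exI[of _ "Proj 0"]) (simp add: computes_Proj)

lemma computable_Suc': "computable Suc"
  unfolding computable_def using computes.succ by blast

lemma computable_const: "computable (\<lambda>x. c)"
proof (induction c)
  case 0
  show ?case unfolding computable_def using computes.zero by blast
next
  case (Suc c)
  show ?case using computable_comp[OF computable_Suc' Suc] .
qed

text \<open>The step function does not see the recursion index. This form is enough for the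
  arithmetic on which pairing is built.\<close>

lemma computable2_rec:
  assumes "computable f" "computable2 g"
  shows "computable2 (\<lambda>k x. rec_nat (f x) (\<lambda>_ r. g r x) k)"
proof -
  from assms obtain F G where FG: "\<And>x. computes F [x] (f x)" "\<And>x y. computes G [x, y] (g x y)"
    by (auto simp: computable_def computable2_def)
  have "computes (PrimRec F (Comp G [Proj 1, Proj 2])) [k, x] (rec_nat (f x) (\<lambda>_ r. g r x) k)" for k x
    by (rule computes_PrimRec) (auto intro!: FG computes_Comp2 computes_Proj)
  thus ?thesis unfolding computable2_def by blast
qed

lemma computable2_add: "computable2 (+)"
proof -
  have "rec_nat x (\<lambda>_. Suc) k = k + x" for k x by (induction k) auto
  thus ?thesis using computable2_rec[OF computable_id computable_comp2[OF computable_Suc' computable2_proj(1)]] by simp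
qed

lemma computable2_mult: "computable2 (*)"
proof -
  have "rec_nat 0 (\<lambda>_ r. r + x) k = k * x" for k x by (induction k) auto
  thus ?thesis using computable2_rec[OF computable_const[of 0] computable2_add] by simp
qed

lemma computable_pred: "computable (\<lambda>x. x - 1)"
proof -
  \<comment> \<open>The step returns the recursion index, so the value at \<open>Suc k\<close> is
    \<open>k\<close>.\<close>
  have "computes (PrimRec Zero (Proj 0)) (k # []) (k - 1)" for k
    by (rule computes_PrimRec) (auto intro: computes.zero computes_Proj)
  thus ?thesis unfolding computable_def by blast
qed

lemma computable2_diff: "computable2 (-)"
proof -
  \<comment> \<open>The recursion runs over the subtrahend, so the arguments first come out in the
    wrong order and are exchanged at the end.\<close>
  have "rec_nat x (\<lambda>_ r. r - 1) k = x - k" for k x by (induction k) auto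
  hence "computable2 (\<lambda>k x. x - k)" using computable2_rec[OF computable_id computable_comp2[OF computable_pred computable2_proj(1)]] by simp
  from computable2_def[THEN iffD1, OF this] obtain A where A: "\<And>k x. computes A [k, x] (x - k)" by blast
  have "computes (Comp A [Proj 1, Proj 0]) [x, k] (x - k)" for x k
    by (rule computes_Comp2[OF _ _ A]) (auto intro: computes_Proj)
  thus ?thesis unfolding computable2_def by blast
qed

named_theorems computable_intros
declare computable_const [computable_intros] computable_id [computable_intros]

lemmas computable_add [computable_intros] = computable2_comp[OF computable2_add]
lemmas computable_mult [computable_intros] = computable2_comp[OF computable2_mult]
lemmas computable_diff [computable_intros] = computable2_comp[OF computable2_diff]
lemmas computable_Suc [computable_intros] = computable_comp[OF computable_Suc']

definition decidable :: "(nat \<Rightarrow> bool) \<Rightarrow> bool" where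
  "decidable P \<longleftrightarrow> computable (\<lambda>x. if P x then 1 else 0)"

lemma computable_If [computable_intros]:
  assumes "decidable P" "computable f" "computable g"
  shows "computable (\<lambda>x. if P x then f x else g x)"
proof -
  let ?c = "\<lambda>x. if P x then 1 else 0 :: nat"
  have "computable (\<lambda>x. ?c x * f x + (1 - ?c x) * g x)"
    using assms by (intro computable_intros computable_const) (auto simp: decidable_def)
  moreover have "(\<lambda>x. ?c x * f x + (1 - ?c x) * g x) = (\<lambda>x. if P x then f x else g x)" by auto
  ultimately show ?thesis by simp
qed

lemma decidable_le [computable_intros]:
  assumes "computable f" "computable g"
  shows "decidable (\<lambda>x. f x \<le> g x)"
proof -
  have "computable (\<lambda>x. 1 - (f x - g x))" using assms by (intro computable_intros computable_const)
  moreover have "(\<lambda>x. 1 - (f x - g x)) = (\<lambda>x. if f x \<le> g x then 1 else 0)" by auto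
  ultimately show ?thesis by (simp add: decidable_def)
qed

lemma decidableI:
  assumes "computable f" "\<And>x. f x = (if P x then 1 else 0)"
  shows "decidable P"
proof -
  have "f = (\<lambda>x. if P x then 1 else 0)" by (rule ext) (rule assms(2))
  thus ?thesis using assms(1) by (simp only: decidable_def)
qed

lemma decidable_not [computable_intros]:
  assumes "decidable P" shows "decidable (\<lambda>x. \<not> P x)"
  by (rule decidableI[OF computable_If[OF assms computable_const[of 0] computable_const[of 1]]]) simp

lemma decidable_conj [computable_intros]:
  assumes "decidable P" "decidable Q" shows "decidable (\<lambda>x. P x \<and> Q x)"
  by (rule decidableI[OF computable_If[OF assms(1) assms(2)[unfolded decidable_def] computable_const[of 0]]]) simp

lemma decidable_imp [computable_intros]:
  assumes "decidable P" "decidable Q" shows "decidable (\<lambda>x. P x \<longrightarrow> Q x)"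
  by (rule decidableI[OF computable_If[OF assms(1) assms(2)[unfolded decidable_def] computable_const[of 1]]]) simp

lemma decidable_less [computable_intros]:
  assumes "computable f" "computable g"
  shows "decidable (\<lambda>x. f x < g x)"
  using decidable_not[OF decidable_le[OF assms(2,1)]] by (simp add: not_le)

lemma decidable_eq [computable_intros]:
  assumes "computable f" "computable g"
  shows "decidable (\<lambda>x. f x = g x)"
  using decidable_conj[OF decidable_le[OF assms] decidable_le[OF assms(2,1)]] by (simp add: eq_iff)

section \<open>Pairing, its inverse, and recursion with parameters\<close>

definition pair :: "nat \<Rightarrow> nat \<Rightarrow> nat" where
  "pair a b = prod_encode (a, b)"

definition pfst :: "nat \<Rightarrow> nat" where
  "pfst z = fst (prod_decode z)"

definition psnd :: "nat \<Rightarrow> nat" where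
  "psnd z = snd (prod_decode z)"

lemma pair_simps [simp]: "pfst (pair a b) = a" "psnd (pair a b) = b" "pair (pfst z) (psnd z) = z"
  by (simp_all add: pair_def pfst_def psnd_def)

text \<open>Recursion with an index but without parameters, for \<open>triangle\<close> and
  \<open>tri_root\<close>: the general rule \<open>computable_rec\<close> presupposes pairing, which
  is built from these.\<close>

lemma computable2_rec_index:
  assumes "computable2 g"
  shows "computable (\<lambda>k. rec_nat c (\<lambda>k r. g k r) k)"
proof -
  from assms obtain G where G: "\<And>x y. computes G [x, y] (g x y)" by (auto simp: computable2_def)
  from computable_const[of c, unfolded computable_def] obtain C where C: "\<And>x. computes C [x] c" by blast
  have "computes (PrimRec C (Comp G [Proj 0, Proj 1])) [k, x] (rec_nat c (\<lambda>k r. g k r) k)" for k x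
    by (rule computes_PrimRec) (auto intro!: C G computes_Comp2 computes_Proj)
  \<comment> \<open>The input is duplicated, since the unary constant function takes a dummy
    parameter.\<close>
  hence "computes (Comp (PrimRec C (Comp G [Proj 0, Proj 1])) [Proj 0, Proj 0]) [k] (rec_nat c (\<lambda>k r. g k r) k)" for k
    by (rule computes_Comp2[rotated 2]) (auto intro: computes_Proj)
  thus ?thesis unfolding computable_def by blast
qed

lemma computable_triangle: "computable triangle"
proof -
  have "rec_nat 0 (\<lambda>k r. k + r + 1) k = triangle k" for k by (induction k) auto
  hence eq: "rec_nat 0 (\<lambda>k r. k + r + 1) = triangle" by (rule ext)
  have "computable2 (\<lambda>k r. k + r + 1)"
    using computable_comp2[OF computable_Suc' computable2_comp2[OF computable2_add computable2_proj]] by simp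
  from computable2_rec_index[OF this, of 0] show ?thesis by (simp only: eq)
qed

lemma computable_pair [computable_intros]: "computable f \<Longrightarrow> computable g \<Longrightarrow> computable (\<lambda>x. pair (f x) (g x))"
  unfolding pair_def prod_encode_def by (simp add: computable_add computable_comp[OF computable_triangle])

lemma computable2_If:
  assumes "computable2 f" "computable2 g" "computable2 h"
  shows "computable2 (\<lambda>x y. if f x y = 0 then g x y else h x y)"
proof -
  have one: "computable2 (\<lambda>x y. 1)" using computable_comp2[OF computable_const computable2_proj(1)] .
  have "computable2 (\<lambda>x y. (1 - f x y) * g x y + (1 - (1 - f x y)) * h x y)"
    by (intro computable2_comp2[OF computable2_add] computable2_comp2[OF computable2_mult] computable2_comp2[OF computable2_diff] one assms)
  moreover have "(\<lambda>x y. (1 - f x y) * g x y + (1 - (1 - f x y)) * h x y) =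
      (\<lambda>x y. if f x y = 0 then g x y else h x y)" by (auto simp: fun_eq_iff)
  ultimately show ?thesis by simp
qed

text \<open>The largest \<open>r\<close> with \<open>triangle r \<le> z\<close>; it grows by at most
  one when \<open>z\<close> does. The comparison is a truncated difference tested for 0, as
  \<open>computable2_If\<close> expects.\<close>

definition tri_root :: "nat \<Rightarrow> nat" where
  "tri_root = rec_nat 0 (\<lambda>k r. if triangle (r + 1) - (k + 1) = 0 then r + 1 else r)"

lemma tri_root: "triangle (tri_root z) \<le> z \<and> z < triangle (tri_root z + 1)"
  by (induction z) (auto simp: tri_root_def)

lemma prod_decode_tri_root:
  "prod_decode z = (z - triangle (tri_root z), tri_root z - (z - triangle (tri_root z)))"
proof -
  let ?m = "z - triangle (tri_root z)" and ?n = "tri_root z - (z - triangle (tri_root z))"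
  have "?m \<le> tri_root z" using tri_root[of z] by auto
  hence "prod_encode (?m, ?n) = z" using tri_root[of z] by (simp add: prod_encode_def)
  thus ?thesis by (metis prod_encode_inverse)
qed

lemma computable_tri_root: "computable tri_root"
proof -
  have r1: "computable2 (\<lambda>k r. r + 1)" using computable_comp2[OF computable_Suc' computable2_proj(2)] by simp
  have k1: "computable2 (\<lambda>k r. k + 1)" using computable_comp2[OF computable_Suc' computable2_proj(1)] by simp
  have "computable2 (\<lambda>k r. if triangle (r + 1) - (k + 1) = 0 then r + 1 else r)"
    by (intro computable2_If computable2_comp2[OF computable2_diff] computable_comp2[OF computable_triangle] r1 k1 computable2_proj)
  from computable2_rec_index[OF this, of 0] show ?thesis by (simp add: tri_root_def)
qed

lemma computable_pfst [computable_intros]: "computable f \<Longrightarrow> computable (\<lambda>x. pfst (f x))"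
  unfolding pfst_def prod_decode_tri_root fst_conv
  by (intro computable_intros computable_comp[OF computable_triangle] computable_comp[OF computable_tri_root])

lemma computable_psnd [computable_intros]: "computable f \<Longrightarrow> computable (\<lambda>x. psnd (f x))"
  unfolding psnd_def prod_decode_tri_root snd_conv
  by (intro computable_intros computable_comp[OF computable_triangle] computable_comp[OF computable_tri_root])

text \<open>In the premises of the rules for operators that bind a variable, the bound variable and the
  remaining context are the components of a pair.\<close>
lemma computable_rec [computable_intros]:
  assumes "computable b" "computable f" "computable (\<lambda>z. g (pfst z) (pfst (psnd z)) (psnd (psnd z)))"
  shows "computable (\<lambda>x. rec_nat (f x) (\<lambda>k r. g k r x) (b x))"
proof -
  from assms obtain B F G where BFG: "\<And>x. computes B [x] (b x)" "\<And>x. computes F [x] (f x)"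
    "\<And>z. computes G [z] (g (pfst z) (pfst (psnd z)) (psnd (psnd z)))" unfolding computable_def by blast
  have "computable2 pair"
    unfolding pair_def prod_encode_def prod.case
    by (intro computable2_comp2[OF computable2_add] computable_comp2[OF computable_triangle] computable2_proj)
  then obtain P where P: "\<And>x y. computes P [x, y] (pair x y)" unfolding computable2_def by blast
  let ?G = "Comp G [Comp P [Proj 0, Comp P [Proj 1, Proj 2]]]"
  have G: "computes ?G [k, r, x] (g k r x)" for k r x
    by (rule computes_Comp1[OF _ BFG(3)[of "pair k (pair r x)", simplified]])
       (rule computes_Comp2[OF _ computes_Comp2[OF _ _ P] P]; rule computes_Proj; simp)
  have "computes (PrimRec F ?G) [k, x] (rec_nat (f x) (\<lambda>k r. g k r x) k)" for k x
  proof (rule computes_PrimRec[where a = "\<lambda>k. rec_nat (f x) (\<lambda>k r. g k r x) k"])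
    show "computes F [x] (rec_nat (f x) (\<lambda>k r. g k r x) 0)" using BFG(2) by simp
    show "computes ?G (j # rec_nat (f x) (\<lambda>k r. g k r x) j # [x]) (rec_nat (f x) (\<lambda>k r. g k r x) (Suc j))" for j
      using G[of j "rec_nat (f x) (\<lambda>k r. g k r x) j" x] by simp
  qed
  hence "computes (Comp (PrimRec F ?G) [B, Proj 0]) [x] (rec_nat (f x) (\<lambda>k r. g k r x) (b x))" for x
    by (rule computes_Comp2[OF BFG(1), rotated]) (simp add: computes_Proj)
  thus ?thesis unfolding computable_def by blast
qed

text \<open>Bounded quantifiers, division and lengths of coded lists are all reduced to bounded
  sums.\<close>

lemma computable_sum [computable_intros]:
  assumes "computable b" "computable (\<lambda>z. g (pfst z) (psnd z))"
  shows "computable (\<lambda>x. \<Sum>k<b x. g k x)"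
proof -
  have "(\<Sum>k<n. g k x) = rec_nat 0 (\<lambda>k r. r + g k x) n" for n x by (induction n) auto
  moreover have "computable (\<lambda>z. g (pfst z) (psnd (psnd z)))"
    using computable_comp[OF assms(2), of "\<lambda>z. pair (pfst z) (psnd (psnd z))"] by (simp add: computable_intros)
  ultimately show ?thesis using assms(1) by (simp only:) (intro computable_intros computable_intros)
qed

lemma decidable_ball [computable_intros]:
  assumes "computable b" "decidable (\<lambda>z. P (pfst z) (psnd z))"
  shows "decidable (\<lambda>x. \<forall>k<b x. P k x)"
proof (rule decidableI)
  let ?f = "\<lambda>x. if (\<Sum>k<b x. if P k x then 0 else 1 :: nat) = 0 then 1 else 0"
  show "computable ?f" using assms by (intro computable_intros)
  show "?f x = (if \<forall>k<b x. P k x then 1 else 0)" for x by auto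
qed

lemma decidable_bex [computable_intros]:
  assumes "computable b" "decidable (\<lambda>z. P (pfst z) (psnd z))"
  shows "decidable (\<lambda>x. \<exists>k<b x. P k x)"
  using decidable_not[OF decidable_ball[OF assms(1) decidable_not[OF assms(2)]]] by simp

lemma computable_power [computable_intros]:
  assumes "computable f" "computable g"
  shows "computable (\<lambda>x. f x ^ g x)"
proof -
  have "a ^ n = rec_nat 1 (\<lambda>k r. a * r) n" for a n :: nat by (induction n) auto
  thus ?thesis using assms by (simp only:) (intro computable_intros computable_comp[OF assms(1)])
qed

text \<open>The quotient counts the positive multiples of the divisor up to the dividend; the test
  \<open>0 < b\<close> gives 0 for division by zero.\<close>

lemma computable_div [computable_intros]:
  assumes "computable f" "computable g"
  shows "computable (\<lambda>x. f x div g x)"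
proof -
  have "a div b = (\<Sum>k<a. if 0 < b \<and> Suc k * b \<le> a then 1 else 0)" for a b :: nat
  proof (cases "b = 0")
    case False
    hence "Suc k * b \<le> a \<longleftrightarrow> k < a div b" for k
      by (metis Suc_le_eq less_eq_div_iff_mult_less_eq neq0_conv)
    hence "(\<Sum>k<a. if 0 < b \<and> Suc k * b \<le> a then 1 else 0) = (\<Sum>k<a. if k < a div b then 1 else 0)"
      using False by simp
    also have "\<dots> = card {k\<in>{..<a}. k < a div b}" by (simp add: sum.If_cases Int_def)
    also have "{k\<in>{..<a}. k < a div b} = {..<a div b}"
      using div_le_dividend[of a b] by (auto simp del: div_le_dividend)
    finally show ?thesis by simp
  qed simp
  thus ?thesis using assms by (simp only:) (intro computable_intros computable_comp[OF assms(1)] computable_comp[OF assms(2)])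
qed

lemma computable_mod [computable_intros]: "computable f \<Longrightarrow> computable g \<Longrightarrow> computable (\<lambda>x. f x mod g x)"
  unfolding modulo_nat_def by (intro computable_intros)

text \<open>Integer functions are represented as differences of computable ones, so that sums and
  products need no case distinction on signs.\<close>

definition int_computable :: "(nat \<Rightarrow> int) \<Rightarrow> bool" where
  "int_computable f \<longleftrightarrow> (\<exists>p q. computable p \<and> computable q \<and> (\<forall>x. f x = int (p x) - int (q x)))"

lemma int_computableI: "computable p \<Longrightarrow> computable q \<Longrightarrow> (\<And>x. f x = int (p x) - int (q x)) \<Longrightarrow> int_computable f"
  unfolding int_computable_def by blast

lemma int_computable_uminus [computable_intros]: "int_computable f \<Longrightarrow> int_computable (\<lambda>x. - f x)"
  unfolding int_computable_def by (metis minus_diff_eq)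

lemma int_computable_mult [computable_intros]:
  assumes "int_computable f" "int_computable g" shows "int_computable (\<lambda>x. f x * g x)"
proof -
  from assms obtain p q r s where *: "computable p" "computable q" "computable r" "computable s" "\<And>x. f x = int (p x) - int (q x)"
    "\<And>x. g x = int (r x) - int (s x)" unfolding int_computable_def by blast
  show ?thesis
    by (rule int_computableI[of "\<lambda>x. p x * r x + q x * s x" "\<lambda>x. p x * s x + q x * r x"])
       (auto intro!: computable_intros * simp: * algebra_simps)
qed

lemma int_computable_sum [computable_intros]:
  assumes "computable b" "int_computable (\<lambda>z. g (pfst z) (psnd z))"
  shows "int_computable (\<lambda>x. \<Sum>k<b x. g k x)"
proof -
  from assms(2) obtain p q where pq: "computable p" "computable q" "\<And>z. g (pfst z) (psnd z) = int (p z) - int (q z)"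
    unfolding int_computable_def by blast
  have "g k x = int (p (pair k x)) - int (q (pair k x))" for k x using pq(3)[of "pair k x"] by simp
  thus ?thesis
    using pq(1,2) assms(1)
    by (intro int_computableI[of "\<lambda>x. \<Sum>k<b x. p (pair k x)" "\<lambda>x. \<Sum>k<b x. q (pair k x)"])
       (auto simp: sum_subtractf intro!: computable_sum intro: computable_comp[OF pq(1)] computable_comp[OF pq(2)] computable_intros)
qed

lemma int_computable_If [computable_intros]:
  assumes "decidable P" "int_computable f" "int_computable g" shows "int_computable (\<lambda>x. if P x then f x else g x)"
proof -
  from assms obtain p q r s where *: "computable p" "computable q" "computable r" "computable s" "\<And>x. f x = int (p x) - int (q x)"
    "\<And>x. g x = int (r x) - int (s x)" unfolding int_computable_def by blast
  show ?thesis
    by (rule int_computableI[of "\<lambda>x. if P x then p x else r x" "\<lambda>x. if P x then q x else s x"])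
       (auto intro!: computable_intros * assms simp: *)
qed

lemma decidable_int_eq [computable_intros]:
  assumes "int_computable f" "int_computable g" shows "decidable (\<lambda>x. f x = g x)"
proof -
  from assms obtain p q r s where *: "computable p" "computable q" "computable r" "computable s" "\<And>x. f x = int (p x) - int (q x)"
    "\<And>x. g x = int (r x) - int (s x)" unfolding int_computable_def by blast
  have "(f x = g x) = (p x + s x = r x + q x)" for x using * by auto
  thus ?thesis using * by (simp only:) (intro computable_intros)
qed

lemma int_computable_int_decode [computable_intros]: "computable f \<Longrightarrow> int_computable (\<lambda>x. int_decode (f x))"
  by (rule int_computableI[of "\<lambda>x. if f x mod 2 = 0 then f x div 2 else 0" "\<lambda>x. if f x mod 2 = 0 then 0 else f x div 2 + 1"])
     (auto intro!: computable_intros simp: int_decode_def sum_decode_def even_iff_mod_2_eq_zero)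

lemma computable_int_encode [computable_intros]:
  assumes "int_computable f" shows "computable (\<lambda>x. int_encode (f x))"
proof -
  from assms obtain p q where *: "computable p" "computable q" "\<And>x. f x = int (p x) - int (q x)"
    unfolding int_computable_def by blast
  have "int_encode (f x) = (if q x \<le> p x then 2 * (p x - q x) else 2 * (q x - p x - 1) + 1)" for x
    unfolding int_encode_def sum_encode_def *(3) by (auto simp: nat_diff_distrib')
  thus ?thesis using * by (simp only:) (intro computable_intros)
qed

lemma computable_nat_abs [computable_intros]:
  assumes "int_computable f" shows "computable (\<lambda>x. nat \<bar>f x\<bar>)"
proof -
  from assms obtain p q where *: "computable p" "computable q" "\<And>x. f x = int (p x) - int (q x)"
    unfolding int_computable_def by blast
  have "nat \<bar>f x\<bar> = (p x - q x) + (q x - p x)" for x using * by auto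
  thus ?thesis using * by (simp only:) (intro computable_intros)
qed

text \<open>A nonempty list is coded as \<open>Suc\<close> of the pair of its head and the code of
  its tail. The empty list has code 0 and \<open>psnd 0 = 0\<close>, so running past the end stays
  at 0, and \<open>lookup\<close> gives 0 there.\<close>

definition tail_code :: "nat \<Rightarrow> nat \<Rightarrow> nat" where
  "tail_code t i = rec_nat t (\<lambda>_ r. psnd (r - 1)) i"

definition lookup :: "nat \<Rightarrow> nat \<Rightarrow> nat" where
  "lookup t i = pfst (tail_code t i - 1)"

lemma pair_0 [simp]: "pfst 0 = 0" "psnd 0 = 0"
proof -
  have "pair 0 0 = 0" by (simp add: pair_def prod_encode_def)
  thus "pfst 0 = 0" "psnd 0 = 0" by (metis pair_simps)+
qed

lemma tail_code_list_encode: "tail_code (list_encode xs) i = list_encode (drop i xs)"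
proof (induction i)
  case (Suc i)
  show ?case
  proof (cases "drop i xs")
    case (Cons y ys)
    hence "drop (Suc i) xs = ys" by (metis drop_Suc tl_drop list.sel(3))
    thus ?thesis using Suc Cons by (simp add: tail_code_def psnd_def)
  qed (use Suc in \<open>simp add: tail_code_def drop_Suc tl_drop\<close>)
qed (simp add: tail_code_def)

lemma lookup_list_encode: "lookup (list_encode xs) i = (if i < length xs then xs ! i else 0)"
proof (cases "i < length xs")
  case True
  thus ?thesis
    by (simp add: lookup_def tail_code_list_encode Cons_nth_drop_Suc[symmetric]) (simp add: pfst_def)
qed (simp add: lookup_def tail_code_list_encode)

lemma lookup_nth [simp]: "i < length xs \<Longrightarrow> lookup (list_encode xs) i = xs ! i"
  by (simp add: lookup_list_encode)

lemma computable_tail_code [computable_intros]: "computable f \<Longrightarrow> computable g \<Longrightarrow> computable (\<lambda>x. tail_code (f x) (g x))"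
  unfolding tail_code_def by (intro computable_intros)

lemma computable_lookup [computable_intros]: "computable f \<Longrightarrow> computable g \<Longrightarrow> computable (\<lambda>x. lookup (f x) (g x))"
  unfolding lookup_def by (intro computable_intros)

lemma length_le_list_encode: "length xs \<le> list_encode xs"
proof (induction xs)
  case (Cons x xs)
  have "list_encode xs \<le> prod_encode (x, list_encode xs)" by (rule le_prod_encode_2)
  thus ?case using Cons by simp
qed simp

lemma list_encode_eq_0: "list_encode xs = 0 \<longleftrightarrow> xs = []"
  by (cases xs) auto

text \<open>Counts the nonempty tails; a list is never longer than its code, which bounds the
  search.\<close>

lemma length_list_decode: "length (list_decode t) = (\<Sum>i<t. if tail_code t i = 0 then 0 else 1)"
proof -
  define xs where "xs = list_decode t"
  have t: "t = list_encode xs" by (simp add: xs_def)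
  have "(\<Sum>i<t. if tail_code t i = 0 then 0 else 1) = (\<Sum>i<t. if i < length xs then 1 else 0 :: nat)"
    unfolding t tail_code_list_encode list_encode_eq_0 by (intro sum.cong refl) auto
  also have "\<dots> = card {i\<in>{..<t}. i < length xs}" by (simp add: sum.If_cases Int_def)
  also have "{i\<in>{..<t}. i < length xs} = {..<length xs}"
    using length_le_list_encode[of xs] t by auto
  finally show ?thesis by (simp add: xs_def)
qed

lemma computable_length_list_decode [computable_intros]:
  assumes "computable f" shows "computable (\<lambda>x. length (list_decode (f x)))"
  unfolding length_list_decode by (intro assms computable_intros computable_comp[OF assms])

text \<open>Lists are built by prepending, so step \<open>k\<close> of the recursion has to supply
  the entry \<open>N - Suc k\<close>.\<close>

lemma list_encode_map_upt:
  "list_encode (map f [0..<N]) = rec_nat 0 (\<lambda>k r. Suc (pair (f (N - Suc k)) r)) N"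
proof -
  have "rec_nat 0 (\<lambda>k r. Suc (pair (f (N - Suc k)) r)) k = list_encode (map f [N - k..<N])" if "k \<le> N" for k
    using that
  proof (induction k)
    case (Suc k)
    have "[N - Suc k..<N] = (N - Suc k) # [N - k..<N]"
      using Suc.prems by (simp add: upt_conv_Cons Suc_diff_Suc)
    thus ?case using Suc by (simp add: pair_def)
  qed simp
  from this[of N] show ?thesis by simp
qed

lemma computable_list_encode_map [computable_intros]:
  assumes "computable b" "computable (\<lambda>z. g (pfst z) (psnd z))"
  shows "computable (\<lambda>x. list_encode (map (\<lambda>k. g k x) [0..<b x]))"
  unfolding list_encode_map_upt
proof (intro computable_rec assms(1) computable_const computable_Suc computable_pair computable_pfst computable_psnd computable_id)
  have "computable (\<lambda>z. pair (b (psnd (psnd z)) - Suc (pfst z)) (psnd (psnd z)))"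
    by (intro computable_intros computable_comp[OF assms(1)])
  from computable_comp[OF assms(2) this] show "computable (\<lambda>z. g (b (psnd (psnd z)) - Suc (pfst z)) (psnd (psnd z)))"
    by simp
qed

lemma computable_list_encode_Cons [computable_intros]:
  "computable f \<Longrightarrow> computable (\<lambda>x. list_encode (g x)) \<Longrightarrow> computable (\<lambda>x. list_encode (f x # g x))"
  unfolding list_encode.simps pair_def[symmetric] by (intro computable_intros)

text \<open>Unbounded search for the least \<open>t\<close>. One algorithm serves all inputs, and it
  halts on every input for which some \<open>t\<close> exists.\<close>

lemma search_computable:
  assumes check: "decidable (\<lambda>z. R (pfst z) (pfst (psnd z)) (psnd (psnd z)))"
    and out: "computable (\<lambda>z. F (pfst z) (pfst (psnd z)) (psnd (psnd z)))"
  shows "\<exists>A. \<forall>d n. (\<exists>t. R d n t) \<longrightarrow> (\<exists>t. R d n t \<and> computes A [d, n] (F d n t))"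
proof -
  have "computable2 pair"
    unfolding pair_def prod_encode_def prod.case
    by (intro computable2_comp2[OF computable2_add] computable_comp2[OF computable_triangle] computable2_proj)
  then obtain P where P: "\<And>x y. computes P [x, y] (pair x y)" unfolding computable2_def by blast
  \<comment> \<open>\<open>Mu\<close> looks for the value 0, so the negated predicate is
    evaluated.\<close>
  from decidable_not[OF check, unfolded decidable_def] obtain C where
    C: "\<And>z. computes C [z] (if \<not> R (pfst z) (pfst (psnd z)) (psnd (psnd z)) then 1 else 0)"
    unfolding computable_def by blast
  from out obtain Q where Q: "\<And>z. computes Q [z] (F (pfst z) (pfst (psnd z)) (psnd (psnd z)))"
    unfolding computable_def by blast
  \<comment> \<open>\<open>Mu\<close> puts the candidate in front of \<open>d\<close> and
    \<open>n\<close>, whereas the predicate expects it last.\<close>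
  let ?C = "Comp C [Comp P [Proj 1, Comp P [Proj 2, Proj 0]]]"
  let ?O = "Comp Q [Comp P [Proj 0, Comp P [Proj 1, Mu ?C]]]"
  have C': "computes ?C [t, d, n] (if \<not> R d n t then 1 else 0)" for t d n
    by (rule computes_Comp1[OF _ C[of "pair d (pair n t)", unfolded pair_simps]])
       (rule computes_Comp2[OF _ computes_Comp2[OF _ _ P] P]; rule computes_Proj; simp)
  show ?thesis
  proof (intro exI allI impI)
    fix d n assume "\<exists>t. R d n t"
    define t where "t = (LEAST t. R d n t)"
    have t: "R d n t" unfolding t_def by (rule LeastI_ex) fact
    have "computes (Mu ?C) [d, n] t"
    proof (rule computes.mu)
      show "computes ?C [t, d, n] 0" using C'[of t d n] t by simp
      show "\<forall>z<t. \<exists>v>0. computes ?C [z, d, n] v"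
      proof (intro allI impI)
        fix z assume "z < t"
        hence "\<not> R d n z" unfolding t_def by (rule not_less_Least)
        thus "\<exists>v>0. computes ?C [z, d, n] v" using C'[of z d n] by (intro exI[of _ 1]) simp
      qed
    qed
    hence "computes ?O [d, n] (F d n t)"
      by (intro computes_Comp1[OF _ Q[of "pair d (pair n t)", unfolded pair_simps]]
          computes_Comp2[OF _ computes_Comp2[OF _ _ P] P]) (simp_all add: computes_Proj)
    with t show "R d n t \<and> computes ?O [d, n] (F d n t)" by blast
  qed
qed

section \<open>Decidable certificates\<close>

definition digit :: "nat \<Rightarrow> nat \<Rightarrow> nat \<Rightarrow> nat" where
  "digit m a k = a div m ^ k mod m"

definition base_sum :: "nat \<Rightarrow> nat \<Rightarrow> (nat \<Rightarrow> nat) \<Rightarrow> nat" where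
  "base_sum m n e = (\<Sum>k<n. e k * m ^ k)"

lemma digit_less: "m > 0 \<Longrightarrow> digit m a k < m"
  by (simp add: digit_def)

lemma base_sum_less: "(\<And>k. k < n \<Longrightarrow> e k < m) \<Longrightarrow> base_sum m n e < m ^ n"
proof (induction n)
  case (Suc n)
  have "base_sum m (Suc n) e = base_sum m n e + e n * m ^ n" by (simp add: base_sum_def)
  also have "\<dots> < m ^ n + e n * m ^ n" using Suc by simp
  also have "\<dots> = Suc (e n) * m ^ n" by simp
  also have "\<dots> \<le> m * m ^ n" using Suc.prems[of n] by (intro mult_right_mono) auto
  finally show ?case by simp
qed (simp add: base_sum_def)

lemma digit_base_sum:
  assumes "\<And>k. k < n \<Longrightarrow> e k < m" "k < n"
  shows "digit m (base_sum m n e) k = e k"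
  using assms
proof (induction n)
  case (Suc n)
  have S: "base_sum m (Suc n) e = base_sum m n e + e n * m ^ n" by (simp add: base_sum_def)
  have less: "base_sum m n e < m ^ n" using Suc.prems by (intro base_sum_less) simp
  have m: "m > 0" using Suc.prems(1)[of n] by simp
  show ?case
  proof (cases "k = n")
    case True
    thus ?thesis using less Suc.prems(1)[of n] m unfolding S digit_def by simp
  next
    case False
    hence k: "k < n" using Suc.prems by simp
    have "m ^ n = m ^ k * (m * m ^ (n - Suc k))"
      using k by (simp flip: power_Suc power_add add: Suc_diff_Suc)
    hence "base_sum m (Suc n) e = base_sum m n e + m ^ k * (m * (m ^ (n - Suc k) * e n))"
      unfolding S by (simp add: mult_ac)
    hence "digit m (base_sum m (Suc n) e) k =
        (base_sum m n e div m ^ k + m * (m ^ (n - Suc k) * e n)) mod m"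
      using m unfolding digit_def by simp
    also have "\<dots> = digit m (base_sum m n e) k" by (simp add: digit_def)
    finally show ?thesis using Suc.IH Suc.prems(1) k by simp
  qed
qed simp

lemma base_sum_digit: "a < m ^ n \<Longrightarrow> base_sum m n (digit m a) = a"
proof -
  have "base_sum m n (digit m a) = a mod m ^ n"
  proof (induction n)
    case (Suc n)
    have "a mod m ^ Suc n = a mod (m ^ n * m)" by (simp add: mult.commute)
    also have "\<dots> = m ^ n * (a div m ^ n mod m) + a mod m ^ n" by (rule mod_mult2_eq)
    finally show ?case using Suc by (simp add: base_sum_def digit_def mult.commute)
  qed (simp add: base_sum_def)
  thus "a < m ^ n \<Longrightarrow> base_sum m n (digit m a) = a" by simp
qed

lemma base_sum_cong: "(\<And>k. k < n \<Longrightarrow> e k = f k) \<Longrightarrow> base_sum m n e = base_sum m n f"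
  by (simp add: base_sum_def)

definition word_of :: "nat \<Rightarrow> nat \<Rightarrow> nat \<Rightarrow> nat list" where
  "word_of d n a = map (digit d a) [0..<n]"

lemma bij_betw_word_of:
  assumes "d > 0"
  shows "bij_betw (word_of d n) {..<d ^ n} (words d n)"
proof (rule bij_betw_byWitness[where f' = "\<lambda>e. base_sum d n (\<lambda>k. e ! k)"])
  have less: "e ! k < d" if "e \<in> words d n" "k < n" for e k
    using that by (auto simp: words_def subset_iff)
  show "\<forall>a\<in>{..<d ^ n}. base_sum d n (\<lambda>k. word_of d n a ! k) = a"
  proof
    fix a assume "a \<in> {..<d ^ n}"
    moreover have "base_sum d n (\<lambda>k. word_of d n a ! k) = base_sum d n (digit d a)"
      by (rule base_sum_cong) (simp add: word_of_def)
    ultimately show "base_sum d n (\<lambda>k. word_of d n a ! k) = a" using base_sum_digit by simp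
  qed
  show "\<forall>e\<in>words d n. word_of d n (base_sum d n (\<lambda>k. e ! k)) = e"
  proof
    fix e assume e: "e \<in> words d n"
    show "word_of d n (base_sum d n (\<lambda>k. e ! k)) = e"
    proof (rule nth_equalityI)
      show "length (word_of d n (base_sum d n (\<lambda>k. e ! k))) = length e"
        using e by (simp add: word_of_def words_def)
      fix k assume "k < length (word_of d n (base_sum d n (\<lambda>k. e ! k)))"
      hence k: "k < n" by (simp add: word_of_def)
      show "word_of d n (base_sum d n (\<lambda>k. e ! k)) ! k = e ! k"
        using digit_base_sum[of n "(!) e" d k] less[OF e] k by (simp add: word_of_def)
    qed
  qed
  show "word_of d n ` {..<d ^ n} \<subseteq> words d n"
    using digit_less[OF assms] by (auto simp: word_of_def words_def)
  show "(\<lambda>e. base_sum d n (\<lambda>k. e ! k)) ` words d n \<subseteq> {..<d ^ n}"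
    using less by (auto intro: base_sum_less)
qed

lemma word_of_words: "d > 0 \<Longrightarrow> a < d ^ n \<Longrightarrow> word_of d n a \<in> words d n"
  using bij_betw_word_of by (auto simp: bij_betw_def)

lemma word_of_nth [simp]: "k < n \<Longrightarrow> word_of d n a ! k = digit d a k"
  by (simp add: word_of_def)

lemma base_sum_word_of: "a < d ^ n \<Longrightarrow> base_sum d n ((!) (word_of d n a)) = a"
  by (subst base_sum_cong[of n _ "digit d a"]) (simp_all add: base_sum_digit)

lemma sum_words: "d > 0 \<Longrightarrow> (\<Sum>e\<in>words d n. f e) = (\<Sum>a<d ^ n. f (word_of d n a))"
  by (rule sum.reindex_bij_betw[OF bij_betw_word_of, symmetric])

text \<open>Permutations are numbered, with gaps, by their values read as base-\<open>n\<close> digits.\<close>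
definition perm_of :: "nat \<Rightarrow> nat \<Rightarrow> nat \<Rightarrow> nat" where
  "perm_of n b = (\<lambda>k. if k < n then digit n b k else k)"

definition is_perm :: "nat \<Rightarrow> nat \<Rightarrow> bool" where
  "is_perm n b \<longleftrightarrow> (\<forall>k<n. \<forall>j<k. digit n b k \<noteq> digit n b j)"

lemma perm_of_symgrp:
  assumes "n > 0"
  shows "perm_of n b \<in> symgrp n \<longleftrightarrow> is_perm n b"
proof
  assume "perm_of n b \<in> symgrp n"
  hence inj: "perm_of n b k = perm_of n b j \<longleftrightarrow> k = j" for k j by (rule symgrp_inj)
  show "is_perm n b" unfolding is_perm_def
  proof (intro allI impI)
    fix k j assume "k < n" "j < k"
    thus "digit n b k \<noteq> digit n b j" using inj[of k j] by (simp add: perm_of_def)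
  qed
next
  assume p: "is_perm n b"
  have "inj_on (perm_of n b) {..<n}"
  proof (rule inj_onI)
    fix j k assume "j \<in> {..<n}" "k \<in> {..<n}" "perm_of n b j = perm_of n b k"
    thus "j = k" using p by (cases j k rule: linorder_cases) (force simp: is_perm_def perm_of_def)+
  qed
  moreover have "perm_of n b ` {..<n} \<subseteq> {..<n}" using digit_less[OF assms] by (auto simp: perm_of_def)
  ultimately have "bij_betw (perm_of n b) {..<n} {..<n}" by (simp add: bij_betw_def endo_inj_surj)
  thus "perm_of n b \<in> symgrp n"
    unfolding symgrp_def mem_Collect_eq by (rule bij_imp_permutes) (simp add: perm_of_def)
qed

lemma bij_betw_perm_of:
  assumes "n > 0"
  shows "bij_betw (perm_of n) {b. b < n ^ n \<and> is_perm n b} (symgrp n)"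
proof (rule bij_betw_byWitness[where f' = "base_sum n n"])
  have p: "perm_of n (base_sum n n \<pi>) = \<pi>" if "\<pi> \<in> symgrp n" for \<pi>
  proof
    fix k show "perm_of n (base_sum n n \<pi>) k = \<pi> k"
      using that by (cases "k < n") (auto simp: perm_of_def digit_base_sum symgrp_def permutes_not_in)
  qed
  show "\<forall>\<pi>\<in>symgrp n. perm_of n (base_sum n n \<pi>) = \<pi>" using p by blast
  show "\<forall>b\<in>{b. b < n ^ n \<and> is_perm n b}. base_sum n n (perm_of n b) = b"
  proof clarify
    fix b assume b: "b < n ^ n"
    have "base_sum n n (perm_of n b) = base_sum n n (digit n b)"
      by (rule base_sum_cong) (simp add: perm_of_def)
    thus "base_sum n n (perm_of n b) = b" using base_sum_digit[OF b] by simp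
  qed
  show "perm_of n ` {b. b < n ^ n \<and> is_perm n b} \<subseteq> symgrp n" using perm_of_symgrp[OF assms] by auto
  show "base_sum n n ` symgrp n \<subseteq> {b. b < n ^ n \<and> is_perm n b}"
    using p perm_of_symgrp[OF assms] by (auto intro: base_sum_less) (metis)
qed

lemma perm_of_base_sum: "n > 0 \<Longrightarrow> \<pi> \<in> symgrp n \<Longrightarrow> perm_of n (base_sum n n \<pi>) = \<pi>"
  by (rule ext) (auto simp: perm_of_def digit_base_sum symgrp_def permutes_not_in)

lemma base_sum_perm_of: "b < n ^ n \<Longrightarrow> base_sum n n (perm_of n b) = b"
  by (subst base_sum_cong[of n _ "digit n b"]) (simp_all add: base_sum_digit perm_of_def)

text \<open>Turns a sum over permutations into a bounded sum over numbers, the only kind known to be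
  computable; the guard removes the gaps in the numbering.\<close>

lemma sum_symgrp_perm_of:
  assumes "n > 0"
  shows "(\<Sum>\<pi>\<in>symgrp n. f \<pi>) = (\<Sum>b<n ^ n. if is_perm n b then f (perm_of n b) else 0)"
proof -
  have "(\<Sum>\<pi>\<in>symgrp n. f \<pi>) = (\<Sum>b\<in>{b. b < n ^ n \<and> is_perm n b}. f (perm_of n b))"
    by (rule sum.reindex_bij_betw[OF bij_betw_perm_of[OF assms], symmetric])
  also have "{b. b < n ^ n \<and> is_perm n b} = {b\<in>{..<n ^ n}. is_perm n b}" by auto
  also have "(\<Sum>b\<in>{b\<in>{..<n ^ n}. is_perm n b}. f (perm_of n b)) = (\<Sum>b<n ^ n. if is_perm n b then f (perm_of n b) else 0)"
    by (rule sum.inter_filter) simp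
  finally show ?thesis .
qed

definition int_entry :: "nat \<Rightarrow> nat \<Rightarrow> int" where
  "int_entry c i = int_decode (lookup c i)"

text \<open>The certificate supplies the signs, and they are verified: value 1 at the identity and a
  change of sign under left multiplication by every transposition determine
  \<open>sign\<close>.\<close>

definition is_sign_table :: "nat \<Rightarrow> nat \<Rightarrow> bool" where
  "is_sign_table n c \<longleftrightarrow> int_entry c (base_sum n n (\<lambda>k. k)) = 1 \<and>
     (\<forall>b<n ^ n. is_perm n b \<longrightarrow> (\<forall>i<n. \<forall>j<i.
        int_entry c (base_sum n n (\<lambda>k. if digit n b k = i then j else if digit n b k = j then i else digit n b k)) =
        - int_entry c b))"

lemma is_sign_table_sign:
  assumes n: "n > 0" and c: "is_sign_table n c" and \<pi>: "\<pi> \<in> symgrp n"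
  shows "int_entry c (base_sum n n \<pi>) = sign \<pi>"
proof -
  have step: "int_entry c (base_sum n n (transpose i j \<circ> \<sigma>)) = - int_entry c (base_sum n n \<sigma>)"
    if "i < n" "j < i" "\<sigma> \<in> symgrp n" for i j \<sigma>
  proof -
    let ?b = "base_sum n n \<sigma>"
    have d: "digit n ?b k = \<sigma> k" if "k < n" for k
      using that \<open>\<sigma> \<in> symgrp n\<close> by (simp add: digit_base_sum)
    have b: "?b < n ^ n" "is_perm n ?b"
      using that perm_of_symgrp[OF n, of ?b] perm_of_base_sum[OF n] by (auto intro: base_sum_less)
    have "base_sum n n (transpose i j \<circ> \<sigma>) =
        base_sum n n (\<lambda>k. if digit n ?b k = i then j else if digit n ?b k = j then i else digit n ?b k)"
      by (rule base_sum_cong) (simp add: d transpose_def)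
    thus ?thesis using c b that(1,2) unfolding is_sign_table_def by simp
  qed
  have step': "int_entry c (base_sum n n (transpose i j \<circ> \<sigma>)) = - int_entry c (base_sum n n \<sigma>)"
    if "i < n" "j < n" "i \<noteq> j" "\<sigma> \<in> symgrp n" for i j \<sigma>
    using step[of i j \<sigma>] step[of j i \<sigma>] that by (cases i j rule: linorder_cases) (auto simp: transpose_commute)
  have "\<pi> permutes {..<n}" using \<pi> by (simp add: symgrp_def)
  moreover have "finite {..<n}" by simp
  ultimately show ?thesis
  proof (induction \<pi> rule: permutes_induct)
    case id
    have "base_sum n n id = base_sum n n (\<lambda>k. k)" by (rule base_sum_cong) simp
    thus ?case using c by (simp add: is_sign_table_def sign_id)
  next
    case (swap i j p)
    have "permutation p" using swap.hyps by (auto simp: permutation_permutes)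
    hence "sign (transpose i j \<circ> p) = - sign p"
      using swap.hyps(3) by (simp add: sign_compose permutation_swap_id sign_swap_id)
    moreover have "p \<in> symgrp n" using swap.hyps by (simp add: symgrp_def)
    hence "int_entry c (base_sum n n (transpose i j \<circ> p)) = - int_entry c (base_sum n n p)"
      using swap.hyps by (intro step') auto
    ultimately show ?case using swap.IH by (simp only:)
  qed
qed

definition part_sum :: "nat \<Rightarrow> nat \<Rightarrow> nat" where
  "part_sum L r = (\<Sum>i<r. lookup L i)"

text \<open>A bounded count in place of the \<open>LEAST\<close> in \<open>row_of\<close>: the
  number of rows that end at or before cell \<open>k\<close>. The bound \<open>n\<close> suffices
  because a partition of \<open>n\<close> has at most \<open>n\<close> parts.\<close>

definition code_row :: "nat \<Rightarrow> nat \<Rightarrow> nat \<Rightarrow> nat" where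
  "code_row n L k = (\<Sum>r<n. if part_sum L (Suc r) \<le> k then 1 else 0)"

definition code_col :: "nat \<Rightarrow> nat \<Rightarrow> nat \<Rightarrow> nat" where
  "code_col n L k = k - part_sum L (code_row n L k)"

definition is_row_perm :: "nat \<Rightarrow> nat \<Rightarrow> nat \<Rightarrow> bool" where
  "is_row_perm n L b \<longleftrightarrow> (\<forall>k<n. code_row n L (digit n b k) = code_row n L k)"

definition is_col_perm :: "nat \<Rightarrow> nat \<Rightarrow> nat \<Rightarrow> bool" where
  "is_col_perm n L b \<longleftrightarrow> (\<forall>k<n. code_col n L (digit n b k) = code_col n L k)"

text \<open>\<open>lookup\<close> is 0 past the end, so under the length bound the partial sum at
  \<open>d\<close> is the total.\<close>

definition is_partition_code :: "nat \<Rightarrow> nat \<Rightarrow> nat \<Rightarrow> bool" where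
  "is_partition_code d n L \<longleftrightarrow> length (list_decode L) \<le> d \<and> part_sum L d = n \<and>
     (\<forall>i<length (list_decode L). lookup L i \<noteq> 0 \<and> (\<forall>j<i. lookup L i \<le> lookup L j))"

lemma part_sum: "part_sum L r = sum_list (take r (list_decode L))"
proof -
  define l where "l = list_decode L"
  hence L: "L = list_encode l" by simp
  show ?thesis unfolding l_def[symmetric] unfolding L part_sum_def lookup_list_encode
    by (induction r) (simp_all add: sum_take_Suc)
qed

lemma is_partition_code: "is_partition_code d n L \<longleftrightarrow> list_decode L \<in> partitions_upto d n"
proof -
  define l where "l = list_decode L"
  hence L: "L = list_encode l" by simp
  have "sorted_wrt (\<ge>) l \<longleftrightarrow> (\<forall>i<length l. \<forall>j<i. l ! i \<le> l ! j)"
    by (auto simp: sorted_wrt_iff_nth_less)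
  moreover have "0 \<notin> set l \<longleftrightarrow> (\<forall>i<length l. l ! i \<noteq> 0)"
    by (auto simp: in_set_conv_nth)
  moreover have "(\<forall>i<length l. lookup L i \<noteq> 0 \<and> (\<forall>j<i. lookup L i \<le> lookup L j)) \<longleftrightarrow>
      (\<forall>i<length l. l ! i \<noteq> 0) \<and> (\<forall>i<length l. \<forall>j<i. l ! i \<le> l ! j)"
    unfolding L by (auto simp: lookup_list_encode)
  ultimately show ?thesis
    unfolding is_partition_code_def partitions_upto_def part_sum l_def[symmetric] by auto
qed

lemma code_row:
  assumes "shape n (list_decode L)" "k < n"
  shows "code_row n L k = row_of (list_decode L) k"
proof -
  let ?l = "list_decode L"
  have k: "k < sum_list ?l" and pos: "0 \<notin> set ?l" using assms by (auto simp: shape_def)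
  have "part_sum L (Suc r) \<le> k \<longleftrightarrow> r < row_of ?l k" for r
    using row_of_less_iff[OF k, of "Suc r"] by (auto simp: part_sum not_less[symmetric] less_Suc_eq_le)
  hence "code_row n L k = card {r\<in>{..<n}. r < row_of ?l k}"
    by (simp add: code_row_def sum.If_cases Int_def)
  moreover have "row_of ?l k < n"
  proof -
    have "length xs \<le> sum_list xs" if "0 \<notin> set xs" for xs :: "nat list"
      using that by (induction xs) auto
    from this[OF pos] show ?thesis using row_of_bounds(3)[OF k] assms by (simp add: shape_def)
  qed
  hence "{r\<in>{..<n}. r < row_of ?l k} = {..<row_of ?l k}" by auto
  ultimately show ?thesis by simp
qed

lemma code_col:
  "shape n (list_decode L) \<Longrightarrow> k < n \<Longrightarrow> code_col n L k = col_of (list_decode L) k"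
  by (simp add: code_col_def col_of_def code_row part_sum)

definition coded_tensor :: "nat \<Rightarrow> nat \<Rightarrow> nat \<Rightarrow> tensor" where
  "coded_tensor d n c = (\<lambda>e. if e \<in> words d n then of_int (int_entry c (base_sum d n ((!) e))) else 0)"

definition coded_galg :: "nat \<Rightarrow> nat \<Rightarrow> (nat \<Rightarrow> nat) \<Rightarrow> complex" where
  "coded_galg n c = (\<lambda>\<pi>. if \<pi> \<in> symgrp n then of_int (int_entry c (base_sum n n \<pi>)) else 0)"

text \<open>The coefficient at word number \<open>a\<close> of \<open>(Y c) X\<close>. The codes
  \<open>b\<close>, \<open>p\<close> and \<open>q\<close> run over all permutations, the row group
  and the column group; the nested digits spell the word acted on by \<open>b\<close>, then
  \<open>p\<close>, then \<open>q\<close>.\<close>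

definition young_value :: "nat \<Rightarrow> nat \<Rightarrow> nat \<Rightarrow> nat \<Rightarrow> nat \<Rightarrow> nat \<Rightarrow> nat \<Rightarrow> int" where
  "young_value d n c L X Y a =
    (\<Sum>b<n ^ n. if is_perm n b then int_entry Y b *
      (\<Sum>p<n ^ n. if is_perm n p \<and> is_row_perm n L p then
        (\<Sum>q<n ^ n. if is_perm n q \<and> is_col_perm n L q then
          int_entry c q * int_entry X (base_sum d n (\<lambda>k. digit d a (digit n b (digit n p (digit n q k)))))
        else 0) else 0) else 0)"

lemma sum_fibre_perm_of:
  assumes "n > 0"
  shows "(\<Sum>p\<in>fibre_group n F. f p) =
    (\<Sum>b<n ^ n. if is_perm n b \<and> (\<forall>k<n. F (digit n b k) = F k) then f (perm_of n b) else 0)"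
proof -
  have "(\<Sum>p\<in>fibre_group n F. f p) = (\<Sum>p\<in>symgrp n. if \<forall>k<n. F (p k) = F k then f p else 0)"
    unfolding fibre_group_def by (rule sum.inter_filter) simp
  also have "\<dots> = (\<Sum>b<n ^ n. if is_perm n b then
      (if \<forall>k<n. F (perm_of n b k) = F k then f (perm_of n b) else 0) else 0)"
    by (rule sum_symgrp_perm_of[OF assms])
  also have "\<dots> = (\<Sum>b<n ^ n. if is_perm n b \<and> (\<forall>k<n. F (digit n b k) = F k) then f (perm_of n b) else 0)"
    by (intro sum.cong refl) (auto simp: perm_of_def)
  finally show ?thesis .
qed

lemma algebra_op_fibre_sum:
  assumes "e \<in> words d n"
  shows "algebra_op d n (fibre_sum n F s) x e = (\<Sum>p\<in>fibre_group n F. of_int (s p) * x (wact n p e))"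
  unfolding fibre_sum_def algebra_op_sum fun_sum_apply
  by (intro sum.cong refl)
     (use assms in \<open>simp add: algebra_op_linear algebra_op_gdelta fibre_group_symgrp perm_op_apply\<close>)

lemma young_value:
  assumes dn: "d > 0" "n > 0" and c: "is_sign_table n c" and L: "shape n (list_decode L)" and a: "a < d ^ n"
  shows "algebra_op d n (conv n (coded_galg n Y) (young_symmetrizer n (list_decode L))) (coded_tensor d n X) (word_of d n a) =
    of_int (young_value d n c L X Y a)"
proof -
  let ?l = "list_decode L" and ?X = "coded_tensor d n X" and ?e = "word_of d n a"
  have e: "?e \<in> words d n" by (rule word_of_words[OF dn(1) a])
  have row: "(\<forall>k<n. row_of ?l (digit n b k) = row_of ?l k) \<longleftrightarrow> is_row_perm n L b" for b
    using digit_less[OF dn(2)] by (simp add: is_row_perm_def code_row[OF L])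
  have col: "(\<forall>k<n. col_of ?l (digit n b k) = col_of ?l k) \<longleftrightarrow> is_col_perm n L b" for b
    using digit_less[OF dn(2)] by (simp add: is_col_perm_def code_col[OF L])
  have inner: "of_int (sign (perm_of n q)) * ?X (wact n (perm_of n q) (wact n (perm_of n p) (wact n (perm_of n b) ?e))) =
      of_int (int_entry c q * int_entry X (base_sum d n (\<lambda>k. digit d a (digit n b (digit n p (digit n q k))))))"
    if perm: "is_perm n b" "is_perm n p" "is_perm n q" and q: "q < n ^ n" for b p q
  proof -
    note G = perm[folded perm_of_symgrp[OF dn(2)]]
    let ?w = "wact n (perm_of n q) (wact n (perm_of n p) (wact n (perm_of n b) ?e))"
    have "?w \<in> words d n" using G e by simp
    moreover have "base_sum d n ((!) ?w) = base_sum d n (\<lambda>k. digit d a (digit n b (digit n p (digit n q k))))"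
    proof (rule base_sum_cong)
      fix k assume k: "k < n"
      hence "digit n q k < n" "digit n p (digit n q k) < n" "digit n b (digit n p (digit n q k)) < n"
        using digit_less[OF dn(2)] by auto
      thus "?w ! k = digit d a (digit n b (digit n p (digit n q k)))" using k by (simp add: perm_of_def)
    qed
    moreover have "int_entry c q = sign (perm_of n q)"
      using is_sign_table_sign[OF dn(2) c G(3)] base_sum_perm_of[OF q] by simp
    ultimately show ?thesis by (simp add: coded_tensor_def)
  qed
  have "algebra_op d n (conv n (coded_galg n Y) (young_symmetrizer n ?l)) ?X ?e =
      (\<Sum>\<pi>\<in>symgrp n. coded_galg n Y \<pi> *
        algebra_op d n (row_sym n ?l) (algebra_op d n (col_sym n ?l) ?X) (wact n \<pi> ?e))"
    using e by (simp add: algebra_op_conv young_symmetrizer_conv algebra_op_apply[of _ _ "coded_galg n Y"])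
  also have "\<dots> = (\<Sum>b<n ^ n. if is_perm n b then coded_galg n Y (perm_of n b) *
        algebra_op d n (row_sym n ?l) (algebra_op d n (col_sym n ?l) ?X) (wact n (perm_of n b) ?e) else 0)"
    by (rule sum_symgrp_perm_of[OF dn(2)])
  also have "\<dots> = of_int (young_value d n c L X Y a)"
    unfolding young_value_def of_int_sum
  proof (intro sum.cong refl)
    fix b assume b: "b \<in> {..<n ^ n}"
    show "(if is_perm n b then coded_galg n Y (perm_of n b) *
        algebra_op d n (row_sym n ?l) (algebra_op d n (col_sym n ?l) ?X) (wact n (perm_of n b) ?e) else 0) =
      of_int (if is_perm n b then int_entry Y b *
        (\<Sum>p<n ^ n. if is_perm n p \<and> is_row_perm n L p then
          (\<Sum>q<n ^ n. if is_perm n q \<and> is_col_perm n L q then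
            int_entry c q * int_entry X (base_sum d n (\<lambda>k. digit d a (digit n b (digit n p (digit n q k)))))
          else 0) else 0) else 0)"
    proof (cases "is_perm n b")
      case True
      hence bG: "perm_of n b \<in> symgrp n" by (simp add: perm_of_symgrp[OF dn(2)])
      have Y: "coded_galg n Y (perm_of n b) = of_int (int_entry Y b)"
        using bG b by (simp add: coded_galg_def base_sum_perm_of)
      have "algebra_op d n (row_sym n ?l) (algebra_op d n (col_sym n ?l) ?X) (wact n (perm_of n b) ?e) =
          (\<Sum>p<n ^ n. if is_perm n p \<and> is_row_perm n L p then
            algebra_op d n (col_sym n ?l) ?X (wact n (perm_of n p) (wact n (perm_of n b) ?e)) else 0)"
        using bG e by (simp add: algebra_op_fibre_sum sum_fibre_perm_of[OF dn(2)] row)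
      also have "\<dots> = (\<Sum>p<n ^ n. if is_perm n p \<and> is_row_perm n L p then
          of_int (\<Sum>q<n ^ n. if is_perm n q \<and> is_col_perm n L q then
            int_entry c q * int_entry X (base_sum d n (\<lambda>k. digit d a (digit n b (digit n p (digit n q k)))))
          else 0) else 0)"
      proof (intro sum.cong refl if_cong)
        fix p assume "is_perm n p \<and> is_row_perm n L p"
        hence p: "is_perm n p" and pG: "perm_of n p \<in> symgrp n" by (auto simp: perm_of_symgrp[OF dn(2)])
        have "algebra_op d n (col_sym n ?l) ?X (wact n (perm_of n p) (wact n (perm_of n b) ?e)) =
            (\<Sum>q<n ^ n. if is_perm n q \<and> is_col_perm n L q then of_int (sign (perm_of n q)) *
              ?X (wact n (perm_of n q) (wact n (perm_of n p) (wact n (perm_of n b) ?e))) else 0)"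
          using bG pG e by (simp add: algebra_op_fibre_sum sum_fibre_perm_of[OF dn(2)] col)
        also have "\<dots> = of_int (\<Sum>q<n ^ n. if is_perm n q \<and> is_col_perm n L q then
            int_entry c q * int_entry X (base_sum d n (\<lambda>k. digit d a (digit n b (digit n p (digit n q k)))))
          else 0)"
          unfolding of_int_sum using inner[OF True p] by (intro sum.cong refl) simp
        finally show "algebra_op d n (col_sym n ?l) ?X (wact n (perm_of n p) (wact n (perm_of n b) ?e)) =
          of_int (\<Sum>q<n ^ n. if is_perm n q \<and> is_col_perm n L q then
            int_entry c q * int_entry X (base_sum d n (\<lambda>k. digit d a (digit n b (digit n p (digit n q k)))))
          else 0)" .
      qed
      also have "\<dots> = of_int (\<Sum>p<n ^ n. if is_perm n p \<and> is_row_perm n L p then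
          (\<Sum>q<n ^ n. if is_perm n q \<and> is_col_perm n L q then
            int_entry c q * int_entry X (base_sum d n (\<lambda>k. digit d a (digit n b (digit n p (digit n q k)))))
          else 0) else 0)"
        unfolding of_int_sum by (intro sum.cong refl) simp
      finally show ?thesis using True Y by simp
    qed simp
  qed
  finally show ?thesis .
qed

lemma int_computable_const [computable_intros]: "int_computable (\<lambda>x. c)"
  by (rule int_computableI[of "\<lambda>_. nat c" "\<lambda>_. nat (- c)"]) (auto intro: computable_intros)

lemma computable_digit [computable_intros]:
  "computable m \<Longrightarrow> computable a \<Longrightarrow> computable k \<Longrightarrow> computable (\<lambda>x. digit (m x) (a x) (k x))"
  unfolding digit_def by (intro computable_intros)

lemma computable_base_sum [computable_intros]:
  assumes "computable m" "computable n" "computable (\<lambda>z. e (pfst z) (psnd z))"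
  shows "computable (\<lambda>x. base_sum (m x) (n x) (\<lambda>k. e k x))"
  unfolding base_sum_def by (intro assms computable_intros computable_comp[OF assms(1)])

lemma decidable_is_perm [computable_intros]:
  assumes "computable n" "computable b" shows "decidable (\<lambda>x. is_perm (n x) (b x))"
  unfolding is_perm_def by (intro assms computable_intros computable_comp[OF assms(1)] computable_comp[OF assms(2)])

lemma int_computable_int_entry [computable_intros]: "computable c \<Longrightarrow> computable i \<Longrightarrow> int_computable (\<lambda>x. int_entry (c x) (i x))"
  unfolding int_entry_def by (intro computable_intros)

lemma computable_part_sum [computable_intros]:
  assumes "computable L" "computable r" shows "computable (\<lambda>x. part_sum (L x) (r x))"
  unfolding part_sum_def by (intro assms computable_intros computable_comp[OF assms(1)])

lemma computable_code_row [computable_intros]: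
  assumes "computable n" "computable L" "computable k" shows "computable (\<lambda>x. code_row (n x) (L x) (k x))"
  unfolding code_row_def by (intro assms computable_intros computable_comp[OF assms(2)] computable_comp[OF assms(3)])

lemma computable_code_col [computable_intros]:
  "computable n \<Longrightarrow> computable L \<Longrightarrow> computable k \<Longrightarrow> computable (\<lambda>x. code_col (n x) (L x) (k x))"
  unfolding code_col_def by (intro computable_intros)

lemma decidable_is_row_perm [computable_intros]:
  assumes "computable n" "computable L" "computable b" shows "decidable (\<lambda>x. is_row_perm (n x) (L x) (b x))"
  unfolding is_row_perm_def by (intro assms computable_intros assms[THEN computable_comp])

lemma decidable_is_col_perm [computable_intros]:
  assumes "computable n" "computable L" "computable b" shows "decidable (\<lambda>x. is_col_perm (n x) (L x) (b x))"
  unfolding is_col_perm_def by (intro assms computable_intros assms[THEN computable_comp])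

lemma decidable_is_partition_code [computable_intros]:
  assumes "computable d" "computable n" "computable L" shows "decidable (\<lambda>x. is_partition_code (d x) (n x) (L x))"
  unfolding is_partition_code_def by (intro assms computable_intros assms[THEN computable_comp])

lemma decidable_is_sign_table [computable_intros]:
  assumes "computable n" "computable c" shows "decidable (\<lambda>x. is_sign_table (n x) (c x))"
  unfolding is_sign_table_def by (intro assms computable_intros assms[THEN computable_comp])

lemma int_computable_young_value [computable_intros]:
  assumes "computable d" "computable n" "computable c" "computable L" "computable X" "computable Y" "computable a"
  shows "int_computable (\<lambda>x. young_value (d x) (n x) (c x) (L x) (X x) (Y x) (a x))"
  unfolding young_value_def by (intro assms computable_intros assms[THEN computable_comp])

definition letter_count :: "nat \<Rightarrow> nat \<Rightarrow> nat \<Rightarrow> nat \<Rightarrow> nat" where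
  "letter_count d n a z = (\<Sum>k<n. if digit d a k = z then 1 else 0)"

lemma letter_count: "letter_count d n a z = count (mset (word_of d n a)) z"
proof -
  have "count (mset (map f [0..<n])) z = (\<Sum>k<n. if f k = z then 1 else 0)" for f
    by (induction n) auto
  thus ?thesis by (simp add: letter_count_def word_of_def)
qed

lemma computable_letter_count [computable_intros]:
  assumes "computable d" "computable n" "computable a" "computable z" shows "computable (\<lambda>x. letter_count (d x) (n x) (a x) (z x))"
  unfolding letter_count_def by (intro assms computable_intros assms[THEN computable_comp])

text \<open>A certificate is a pair of a sign table and a list of \<open>d ^ n\<close> records \<open>(l, i, j, x, y)\<close>.\<close>
definition rec_l :: "nat \<Rightarrow> nat \<Rightarrow> nat" where "rec_l t s = pfst (lookup (psnd t) s)"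
definition rec_i :: "nat \<Rightarrow> nat \<Rightarrow> nat" where "rec_i t s = pfst (psnd (lookup (psnd t) s))"
definition rec_j :: "nat \<Rightarrow> nat \<Rightarrow> nat" where "rec_j t s = pfst (psnd (psnd (lookup (psnd t) s)))"
definition rec_x :: "nat \<Rightarrow> nat \<Rightarrow> nat" where "rec_x t s = pfst (psnd (psnd (psnd (lookup (psnd t) s))))"
definition rec_y :: "nat \<Rightarrow> nat \<Rightarrow> nat" where "rec_y t s = psnd (psnd (psnd (psnd (lookup (psnd t) s))))"

definition rec_value :: "nat \<Rightarrow> nat \<Rightarrow> nat \<Rightarrow> nat \<Rightarrow> nat \<Rightarrow> int" where
  "rec_value d n t s a = young_value d n (pfst t) (rec_l t s) (rec_x t s) (rec_y t s) a"

lemma computable_rec_fields [computable_intros]: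
  assumes "computable t" "computable s"
  shows "computable (\<lambda>x. rec_l (t x) (s x))" "computable (\<lambda>x. rec_i (t x) (s x))" "computable (\<lambda>x. rec_j (t x) (s x))"
    "computable (\<lambda>x. rec_x (t x) (s x))" "computable (\<lambda>x. rec_y (t x) (s x))"
  unfolding rec_l_def rec_i_def rec_j_def rec_x_def rec_y_def by (intro assms computable_intros)+

lemma int_computable_rec_value [computable_intros]:
  "computable d \<Longrightarrow> computable n \<Longrightarrow> computable t \<Longrightarrow> computable s \<Longrightarrow> computable a \<Longrightarrow> int_computable (\<lambda>x. rec_value (d x) (n x) (t x) (s x) (a x))"
  unfolding rec_value_def by (intro computable_intros)

text \<open>\<open>schur_data\<close> in bounded quantifiers over record numbers. In addition,
  records with equal \<open>(l, i)\<close> share \<open>x\<close> and those with equal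
  \<open>(l, j)\<close> share \<open>y\<close>, so that both become functions of the label; labels
  are distinct, which fixes their number; and the last clause confines each \<open>x\<close> to one
  weight space.\<close>

definition schur_check :: "nat \<Rightarrow> nat \<Rightarrow> nat \<Rightarrow> bool" where
  "schur_check d n t \<longleftrightarrow> is_sign_table n (pfst t) \<and>
    (\<forall>s<d ^ n. is_partition_code d n (rec_l t s)) \<and>
    (\<forall>s<d ^ n. rec_i t s \<noteq> 0 \<longrightarrow>
      (\<exists>s'<d ^ n. rec_l t s' = rec_l t s \<and> Suc (rec_i t s') = rec_i t s \<and> rec_j t s' = rec_j t s)) \<and>
    (\<forall>s<d ^ n. rec_j t s \<noteq> 0 \<longrightarrow>
      (\<exists>s'<d ^ n. rec_l t s' = rec_l t s \<and> rec_i t s' = rec_i t s \<and> Suc (rec_j t s') = rec_j t s)) \<and>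
    (\<forall>s<d ^ n. \<forall>s'<d ^ n. rec_l t s' = rec_l t s \<longrightarrow>
      (\<exists>r<d ^ n. rec_l t r = rec_l t s \<and> rec_i t r = rec_i t s \<and> rec_j t r = rec_j t s')) \<and>
    (\<forall>s<d ^ n. \<forall>s'<d ^ n. rec_l t s' = rec_l t s \<longrightarrow> rec_i t s' = rec_i t s \<longrightarrow> rec_x t s' = rec_x t s) \<and>
    (\<forall>s<d ^ n. \<forall>s'<d ^ n. rec_l t s' = rec_l t s \<longrightarrow> rec_j t s' = rec_j t s \<longrightarrow> rec_y t s' = rec_y t s) \<and>
    (\<forall>s<d ^ n. \<exists>a<d ^ n. rec_value d n t s a \<noteq> 0) \<and>
    (\<forall>s<d ^ n. \<forall>s'<s. \<not> (rec_l t s' = rec_l t s \<and> rec_i t s' = rec_i t s \<and> rec_j t s' = rec_j t s)) \<and>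
    (\<forall>s<d ^ n. \<forall>s'<s. (\<Sum>a<d ^ n. rec_value d n t s a * rec_value d n t s' a) = 0) \<and>
    (\<forall>s<d ^ n. \<forall>a<d ^ n. \<forall>a'<d ^ n. int_entry (rec_x t s) a \<noteq> 0 \<longrightarrow> int_entry (rec_x t s) a' \<noteq> 0 \<longrightarrow>
      (\<forall>z<d. letter_count d n a z = letter_count d n a' z))"

lemma decidable_schur_check: "decidable (\<lambda>z. schur_check (pfst z) (pfst (psnd z)) (psnd (psnd z)))"
  unfolding schur_check_def by (intro computable_intros)

section \<open>The algorithm\<close>

text \<open>Of the two roots of \<open>N x\<^sup>2 - k\<^sup>2\<close>, only \<open>k / sqrt N\<close> lies in the disk of radius \<open>\<bar>k\<bar>\<close> around \<open>k\<close>.\<close>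
definition sqrt_code :: "int \<Rightarrow> int \<Rightarrow> nat" where
  "sqrt_code k N = list_encode [list_encode [int_encode (- (k * k)), int_encode 0, int_encode N],
     int_encode k, int_encode 0, if k = 0 then 1 else nat \<bar>k\<bar>, 1]"

text \<open>As \<open>N \<ge> 1\<close>, the number is \<open>k q\<close> with
  \<open>0 < q \<le> 1\<close>. The two roots have distances \<open>\<bar>k\<bar> (1 - q)\<close>
  and \<open>\<bar>k\<bar> (1 + q)\<close> from \<open>k\<close>, one below
  \<open>\<bar>k\<bar>\<close> and one above. For \<open>k = 0\<close> the roots coincide, and
  radius 1 keeps the open disk nonempty.\<close>

lemma algebraic_code_sqrt_code:
  assumes "N > 0"
  shows "algebraic_code (sqrt_code k N) (of_int k / of_real (sqrt (of_int N)))"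
proof -
  define q where "q = 1 / sqrt (of_int N)"
  define z :: complex where "z = of_int k / of_real (sqrt (of_int N))"
  have q: "0 < q" "q \<le> 1" using assms by (auto simp: q_def)
  have zq: "z = of_real (of_int k * q)" by (simp add: z_def q_def)
  have root: "poly (map_poly of_int (Poly [- (k * k), 0, N])) x = 0 \<longleftrightarrow> x = z \<or> x = - z" for x :: complex
  proof -
    have "poly (map_poly of_int (Poly [- (k * k), 0, N])) x = of_int N * (x * x) - of_int k * of_int k"
      by (simp add: of_int_hom.map_poly_pCons_hom algebra_simps)
    moreover have "of_int k * of_int k = of_int N * (z * z)"
    proof -
      have "real_of_int k * real_of_int k = of_int N * ((of_int k * q) * (of_int k * q))"
        using assms by (simp add: q_def field_simps)
      thus ?thesis unfolding zq by (metis of_real_mult of_real_of_int_eq)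
    qed
    ultimately have "poly (map_poly of_int (Poly [- (k * k), 0, N])) x = of_int N * ((x - z) * (x + z))"
      by (simp add: algebra_simps)
    thus ?thesis using assms by (auto simp: eq_neg_iff_add_eq_0)
  qed
  let ?r = "if k = 0 then 1 else nat \<bar>k\<bar>"
  have dist: "cmod (of_real (of_int k * s) - Complex (of_int k / of_nat 1) (of_int 0 / of_nat 1)) = \<bar>of_int k\<bar> * \<bar>s - 1\<bar>" for s
  proof -
    have "of_real (of_int k * s) - Complex (of_int k / of_nat 1) (of_int 0 / of_nat 1) = of_real (of_int k * (s - 1))"
      by (simp add: complex_eq_iff algebra_simps)
    thus ?thesis by (simp only: norm_of_real abs_mult)
  qed
  have disk: "{x. poly (map_poly of_int (Poly [- (k * k), 0, N])) x = 0 \<and>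
      cmod (x - Complex (of_int k / of_nat 1) (of_int 0 / of_nat 1)) < of_nat ?r / of_nat 1} = {z}"
  proof (cases "k = 0")
    case True
    have z: "cmod (z - Complex (of_int k / of_nat 1) (of_int 0 / of_nat 1)) < of_nat ?r / of_nat 1"
      unfolding zq dist using True by simp
    have mz: "- z = z" using True by (simp add: z_def)
    show ?thesis
    proof (intro equalityI subsetI)
      fix x assume "x \<in> {x. poly (map_poly of_int (Poly [- (k * k), 0, N])) x = 0 \<and>
        cmod (x - Complex (of_int k / of_nat 1) (of_int 0 / of_nat 1)) < of_nat ?r / of_nat 1}"
      hence "x = z \<or> x = - z" using root by blast
      thus "x \<in> {z}" using mz by (metis singletonI)
    qed (use z root in blast)
  next
    case False
    have z: "cmod (z - Complex (of_int k / of_nat 1) (of_int 0 / of_nat 1)) < of_nat ?r / of_nat 1"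
      unfolding zq dist using q False by (simp add: mult_less_cancel_left2)
    have mz: "- z = of_real (of_int k * (- q))" by (simp add: zq)
    have "\<not> cmod (- z - Complex (of_int k / of_nat 1) (of_int 0 / of_nat 1)) < of_nat ?r / of_nat 1"
      unfolding mz dist using q False by (simp add: not_less mult_le_cancel_left1)
    thus ?thesis using z root by blast
  qed
  show ?thesis
    unfolding algebraic_code_def z_def[symmetric]
  proof (intro exI conjI)
    show "sqrt_code k N = list_encode [list_encode (map int_encode [- (k * k), 0, N]),
      int_encode k, int_encode 0, ?r, 1]" by (simp add: sqrt_code_def)
    show "Poly [- (k * k), 0, N] \<noteq> 0" using assms by simp
  qed (use disk in simp_all)
qed

lemma computable_sqrt_code [computable_intros]: "int_computable k \<Longrightarrow> int_computable N \<Longrightarrow> computable (\<lambda>x. sqrt_code (k x) (N x))"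
  unfolding sqrt_code_def by (intro computable_intros)

definition output_row :: "nat \<Rightarrow> nat \<Rightarrow> nat \<Rightarrow> nat \<Rightarrow> nat \<Rightarrow> nat" where
  "output_row d n t s a = list_encode [rec_l t s, rec_i t s, rec_j t s,
     list_encode (map (\<lambda>k. digit d a k) [0..<n]),
     sqrt_code (rec_value d n t s a) (\<Sum>b<d ^ n. rec_value d n t s b * rec_value d n t s b)]"

text \<open>One index runs through all pairs: its quotient by \<open>d ^ n\<close> is the record and
  its remainder the word.\<close>

definition schur_output :: "nat \<Rightarrow> nat \<Rightarrow> nat \<Rightarrow> nat" where
  "schur_output d n t =
     list_encode (map (\<lambda>\<rho>. output_row d n t (\<rho> div d ^ n) (\<rho> mod d ^ n)) [0..<d ^ n * d ^ n])"

lemma computable_output_row [computable_intros]: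
  assumes "computable d" "computable n" "computable t" "computable s" "computable a"
  shows "computable (\<lambda>x. output_row (d x) (n x) (t x) (s x) (a x))"
  unfolding output_row_def by (intro assms computable_intros assms[THEN computable_comp])

lemma computable_schur_output: "computable (\<lambda>z. schur_output (pfst z) (pfst (psnd z)) (psnd (psnd z)))"
  unfolding schur_output_def by (intro computable_intros)

lemma words_word_of:
  assumes "d > 0" "e \<in> words d n"
  obtains a where "a < d ^ n" "e = word_of d n a"
proof -
  have "e \<in> word_of d n ` {..<d ^ n}" using bij_betw_word_of[OF assms(1)] assms(2) by (simp add: bij_betw_def)
  thus ?thesis using that by blast
qed

lemma schur_check_sound:
  assumes dn: "d > 0" "n > 0" and check: "schur_check d n t"
  shows "\<exists>B. encodes_family d n (schur_output d n t) B \<and> schur_basis d n B \<and>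
    orthonormal_basis d n (schur_labels d n) B \<and>
    (\<forall>s\<in>schur_labels d n. \<exists>v\<in>words d n. B s \<in> cfun.span {perm_op d n \<pi> (ket v) | \<pi>. \<pi> \<in> symgrp n})"
proof -
  let ?D = "d ^ n"
  note c = check[unfolded schur_check_def]
  have c1: "is_sign_table n (pfst t)"
    and c2: "\<forall>s<?D. is_partition_code d n (rec_l t s)"
    and c3: "\<forall>s<?D. rec_i t s \<noteq> 0 \<longrightarrow>
      (\<exists>s'<?D. rec_l t s' = rec_l t s \<and> Suc (rec_i t s') = rec_i t s \<and> rec_j t s' = rec_j t s)"
    and c4: "\<forall>s<?D. rec_j t s \<noteq> 0 \<longrightarrow>
      (\<exists>s'<?D. rec_l t s' = rec_l t s \<and> rec_i t s' = rec_i t s \<and> Suc (rec_j t s') = rec_j t s)"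
    and c5: "\<forall>s<?D. \<forall>s'<?D. rec_l t s' = rec_l t s \<longrightarrow>
      (\<exists>r<?D. rec_l t r = rec_l t s \<and> rec_i t r = rec_i t s \<and> rec_j t r = rec_j t s')"
    and c6: "\<forall>s<?D. \<forall>s'<?D. rec_l t s' = rec_l t s \<longrightarrow> rec_i t s' = rec_i t s \<longrightarrow> rec_x t s' = rec_x t s"
    and c7: "\<forall>s<?D. \<forall>s'<?D. rec_l t s' = rec_l t s \<longrightarrow> rec_j t s' = rec_j t s \<longrightarrow> rec_y t s' = rec_y t s"
    and c8: "\<forall>s<?D. \<exists>a<?D. rec_value d n t s a \<noteq> 0"
    and c9: "\<forall>s<?D. \<forall>s'<s. \<not> (rec_l t s' = rec_l t s \<and> rec_i t s' = rec_i t s \<and> rec_j t s' = rec_j t s)"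
    and c10: "\<forall>s<?D. \<forall>s'<s. (\<Sum>a<?D. rec_value d n t s a * rec_value d n t s' a) = 0"
    and c11: "\<forall>s<?D. \<forall>a<?D. \<forall>a'<?D. int_entry (rec_x t s) a \<noteq> 0 \<longrightarrow> int_entry (rec_x t s) a' \<noteq> 0 \<longrightarrow>
      (\<forall>z<d. letter_count d n a z = letter_count d n a' z)"
    using c by - (elim conjE, assumption)+
  define label where "label s = (list_decode (rec_l t s), rec_i t s, rec_j t s)" for s
  have inj: "inj_on label {..<?D}"
  proof (rule inj_onI)
    fix s s' assume s: "s \<in> {..<?D}" "s' \<in> {..<?D}" "label s = label s'"
    hence "rec_l t s = rec_l t s'" "rec_i t s = rec_i t s'" "rec_j t s = rec_j t s'"
      by (auto simp: label_def) (metis list_decode_inverse)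
    thus "s = s'" using c9 s(1,2) by (metis lessThan_iff linorder_neqE_nat)
  qed
  define S where "S = label ` {..<?D}"
  \<comment> \<open>Which record is chosen is immaterial, by the sharing clauses \<open>c6\<close>
    and \<open>c7\<close>.\<close>
  define X where "X l i = coded_tensor d n (rec_x t (SOME s. s < ?D \<and> list_decode (rec_l t s) = l \<and> rec_i t s = i))"
    for l i
  define Y where "Y l j = coded_galg n (rec_y t (SOME s. s < ?D \<and> list_decode (rec_l t s) = l \<and> rec_j t s = j))"
    for l j
  have X: "X (list_decode (rec_l t s)) (rec_i t s) = coded_tensor d n (rec_x t s)" if s: "s < ?D" for s
  proof -
    let ?P = "\<lambda>r. r < ?D \<and> list_decode (rec_l t r) = list_decode (rec_l t s) \<and> rec_i t r = rec_i t s"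
    have "?P (SOME r. ?P r)" by (rule someI[of ?P s]) (use s in simp)
    hence "rec_x t (SOME r. ?P r) = rec_x t s" using c6 s by (metis list_decode_inverse)
    thus ?thesis by (simp add: X_def)
  qed
  have Y: "Y (list_decode (rec_l t s)) (rec_j t s) = coded_galg n (rec_y t s)" if s: "s < ?D" for s
  proof -
    let ?P = "\<lambda>r. r < ?D \<and> list_decode (rec_l t r) = list_decode (rec_l t s) \<and> rec_j t r = rec_j t s"
    have "?P (SOME r. ?P r)" by (rule someI[of ?P s]) (use s in simp)
    hence "rec_y t (SOME r. ?P r) = rec_y t s" using c7 s by (metis list_decode_inverse)
    thus ?thesis by (simp add: Y_def)
  qed
  let ?v = "young_vec d n X Y"
  have part: "list_decode (rec_l t s) \<in> partitions_upto d n" if "s < ?D" for s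
    using c2 that by (simp add: is_partition_code)
  have v: "?v (label s) (word_of d n a) = of_int (rec_value d n t s a)" if "s < ?D" "a < ?D" for s a
    using young_value[OF dn c1 _ that(2), of "rec_l t s" "rec_y t s" "rec_x t s"] part[OF that(1)] X[OF that(1)] Y[OF that(1)]
    by (simp add: young_vec_def label_def rec_value_def partitions_upto_shape)
  have inner: "inner_on (words d n) (?v (label s)) (?v (label s')) =
      of_int (\<Sum>a<?D. rec_value d n t s a * rec_value d n t s' a)" if "s < ?D" "s' < ?D" for s s'
    unfolding inner_on_def sum_words[OF dn(1)] of_int_sum
    by (intro sum.cong refl) (simp add: v that)
  have v0: "?v (label s) \<noteq> 0" if s: "s < ?D" for s
  proof -
    obtain a where "a < ?D" "rec_value d n t s a \<noteq> 0" using c8 s by blast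
    hence "?v (label s) (word_of d n a) \<noteq> 0" using v[OF s] by simp
    thus ?thesis by auto
  qed
  have orth: "inner_on (words d n) (?v (label s)) (?v (label s')) = 0" if "s < ?D" "s' < ?D" "s \<noteq> s'" for s s'
  proof -
    have "(\<Sum>a<?D. rec_value d n t s a * rec_value d n t s' a) = 0"
    proof (cases "s' < s")
      case True thus ?thesis using c10 that(1) by blast
    next
      case False
      hence "(\<Sum>a<?D. rec_value d n t s' a * rec_value d n t s a) = 0" using c10 that by auto
      thus ?thesis by (simp add: mult.commute)
    qed
    thus ?thesis by (simp only: inner[OF that(1,2)] of_int_0)
  qed
  have XV: "X l i \<in> tensor_space d n" for l i by (simp add: X_def coded_tensor_def tensor_space_def)
  have memS: "(l, i, j) \<in> S \<longleftrightarrow> (\<exists>s<?D. list_decode (rec_l t s) = l \<and> rec_i t s = i \<and> rec_j t s = j)" for l i j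
    by (auto simp: S_def label_def)
  have data: "schur_data d n S X Y"
    unfolding schur_data_def
  proof (intro conjI)
    show "finite S" by (simp add: S_def)
    show "card S = d ^ n" using card_image[OF inj] by (simp add: S_def)
    show "\<forall>l i j. (l, i, j) \<in> S \<longrightarrow> l \<in> partitions_upto d n \<and> X l i \<in> tensor_space d n"
      using part XV by (auto simp: memS)
    show "\<forall>l i j. (l, Suc i, j) \<in> S \<longrightarrow> (l, i, j) \<in> S"
    proof (intro allI impI)
      fix l i j assume "(l, Suc i, j) \<in> S"
      then obtain s where s: "s < ?D" "list_decode (rec_l t s) = l" "rec_i t s = Suc i" "rec_j t s = j"
        by (auto simp: memS)
      hence "\<exists>s'<?D. rec_l t s' = rec_l t s \<and> Suc (rec_i t s') = rec_i t s \<and> rec_j t s' = rec_j t s"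
        using c3[rule_format, of s] by simp
      thus "(l, i, j) \<in> S" using s unfolding memS by auto
    qed
    show "\<forall>l i j. (l, i, Suc j) \<in> S \<longrightarrow> (l, i, j) \<in> S"
    proof (intro allI impI)
      fix l i j assume "(l, i, Suc j) \<in> S"
      then obtain s where s: "s < ?D" "list_decode (rec_l t s) = l" "rec_i t s = i" "rec_j t s = Suc j"
        by (auto simp: memS)
      hence "\<exists>s'<?D. rec_l t s' = rec_l t s \<and> rec_i t s' = rec_i t s \<and> Suc (rec_j t s') = rec_j t s"
        using c4[rule_format, of s] by simp
      thus "(l, i, j) \<in> S" using s unfolding memS by auto
    qed
    show "\<forall>l i j i' j'. (l, i, j) \<in> S \<longrightarrow> (l, i', j') \<in> S \<longrightarrow> (l, i, j') \<in> S"
    proof (intro allI impI)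
      fix l i j i' j' assume "(l, i, j) \<in> S" "(l, i', j') \<in> S"
      then obtain s s' where s: "s < ?D" "list_decode (rec_l t s) = l" "rec_i t s = i"
        "s' < ?D" "list_decode (rec_l t s') = l" "rec_j t s' = j'"
        by (auto simp: memS)
      hence "rec_l t s' = rec_l t s" by (metis list_decode_inverse)
      then obtain r where "r < ?D" "rec_l t r = rec_l t s" "rec_i t r = rec_i t s" "rec_j t r = rec_j t s'"
        using c5 s(1,4) by blast
      thus "(l, i, j') \<in> S" using s unfolding memS by auto
    qed
    show "\<forall>s\<in>S. ?v s \<noteq> 0" using v0 by (auto simp: S_def)
    show "\<forall>s\<in>S. \<forall>s'\<in>S. s \<noteq> s' \<longrightarrow> inner_on (words d n) (?v s) (?v s') = 0"
      using orth unfolding S_def by blast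
  qed
  \<comment> \<open>Here the dimensions enter: the dimension count shows that the labels of the
    certificate are the true ones.\<close>
  have S: "S = schur_labels d n" by (rule schur_data_labels(1)[OF data])
  define B where "B s = cscale (1 / of_real (sqrt (\<Sum>e\<in>words d n. (cmod (?v s e))\<^sup>2))) (?v s)" for s
  have Br: "\<exists>r. r \<noteq> 0 \<and> B s = cscale r (?v s)" if "s \<in> S" for s
    by (rule schur_data_orthonormal(2)[OF data _ that]) (rule B_def)
  have ob: "orthonormal_basis d n S B"
    by (rule schur_data_orthonormal(1)[OF data]) (rule B_def)
  have sb: "schur_basis d n B" by (rule schur_data_basis[OF data Br])
  have orbit: "\<exists>v\<in>words d n. B s \<in> cfun.span {perm_op d n \<pi> (ket v) | \<pi>. \<pi> \<in> symgrp n}" if "s \<in> S" for s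
  proof -
    from that obtain r where r: "r < ?D" "s = label r" by (auto simp: S_def)
    let ?X = "coded_tensor d n (rec_x t r)"
    have s: "?v s = algebra_op d n (conv n (coded_galg n (rec_y t r)) (young_symmetrizer n (list_decode (rec_l t r)))) ?X"
      using X[OF r(1)] Y[OF r(1)] by (simp add: young_vec_def r(2) label_def)
    \<comment> \<open>Otherwise the basis vector would vanish. Any word in the support then serves
      as \<open>v\<close>, since \<open>c11\<close> gives all words of the support the same
      letters.\<close>
    have "?X \<noteq> 0" using v0[OF r(1)] s r(2) by (auto simp: algebra_op_linear)
    then obtain w where w: "?X w \<noteq> 0" by (auto simp: fun_eq_iff)
    hence ww: "w \<in> words d n" by (auto simp: coded_tensor_def split: if_splits)
    have "mset e = mset w" if e: "?X e \<noteq> 0" for e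
    proof -
      have ew: "e \<in> words d n" using e by (auto simp: coded_tensor_def split: if_splits)
      obtain a a' where a: "a < ?D" "e = word_of d n a" "a' < ?D" "w = word_of d n a'"
        using words_word_of[OF dn(1) ew] words_word_of[OF dn(1) ww] by metis
      have nz: "int_entry (rec_x t r) a \<noteq> 0" "int_entry (rec_x t r) a' \<noteq> 0"
        using e w ew ww a by (auto simp: coded_tensor_def base_sum_word_of)
      have "count (mset e) z = count (mset w) z" for z
      proof (cases "z < d")
        case True
        thus ?thesis using c11[rule_format, OF r(1) a(1,3) nz] by (simp only: a(2,4) letter_count)
      next
        case False
        hence "z \<notin> set e" "z \<notin> set w" using ew ww by (auto simp: words_def)
        hence "count (mset e) z = 0" "count (mset w) z = 0" by (simp_all only: count_mset_0_iff not_False_eq_True)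
        thus ?thesis by (simp only:)
      qed
      thus ?thesis by (rule multiset_eqI)
    qed
    moreover have "?X \<in> tensor_space d n" by (simp add: coded_tensor_def tensor_space_def)
    ultimately have "?v s \<in> cfun.span {perm_op d n \<pi> (ket w) | \<pi>. \<pi> \<in> symgrp n}"
      unfolding s using ww by (intro span_ket_orbit) auto
    hence "B s \<in> cfun.span {perm_op d n \<pi> (ket w) | \<pi>. \<pi> \<in> symgrp n}"
      unfolding B_def by (rule cfun.span_scale)
    thus ?thesis using ww by blast
  qed
  have enc: "encodes_family d n (schur_output d n t) B"
  proof -
    let ?N = "\<lambda>s. \<Sum>b<?D. rec_value d n t s b * rec_value d n t s b"
    let ?row = "\<lambda>\<rho>. ((label (\<rho> div ?D), word_of d n (\<rho> mod ?D)),
      sqrt_code (rec_value d n t (\<rho> div ?D) (\<rho> mod ?D)) (?N (\<rho> div ?D)))"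
    let ?rows = "map ?row [0..<?D * ?D]"
    have D: "?D > 0" using dn by simp
    have div: "\<rho> div ?D < ?D" "\<rho> mod ?D < ?D" if "\<rho> < ?D * ?D" for \<rho>
      using that D by (auto simp: less_mult_imp_div_less)
    have code: "algebraic_code (sqrt_code (rec_value d n t s a) (?N s)) (B (label s) (word_of d n a))"
      if s: "s < ?D" and a: "a < ?D" for s a
    proof -
      have "(\<Sum>e\<in>words d n. (cmod (?v (label s) e))\<^sup>2) = of_int (?N s)"
        unfolding sum_words[OF dn(1)] of_int_sum
        by (intro sum.cong refl) (simp add: v s power2_eq_square flip: of_int_mult of_int_abs)
      hence eq: "B (label s) (word_of d n a) = of_int (rec_value d n t s a) / of_real (sqrt (of_int (?N s)))"
        using v[OF s a] by (simp add: B_def)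
      have "?N s > 0"
      proof -
        obtain b where "b < ?D" "rec_value d n t s b \<noteq> 0" using c8 s by blast
        thus ?thesis
          by (intro sum_pos2[of _ b]) (auto simp: zero_less_mult_iff)
      qed
      thus ?thesis unfolding eq by (rule algebraic_code_sqrt_code)
    qed
    have "schur_output d n t = list_encode (map row_encode ?rows)"
      unfolding schur_output_def output_row_def map_map
      by (intro arg_cong[of _ _ list_encode] map_cong refl) (simp add: label_def word_of_def)
    moreover have "inj_on (\<lambda>\<rho>. fst (?row \<rho>)) {..<?D * ?D}"
    proof (rule inj_onI)
      fix \<rho> \<rho>' assume \<rho>: "\<rho> \<in> {..<?D * ?D}" "\<rho>' \<in> {..<?D * ?D}" "fst (?row \<rho>) = fst (?row \<rho>')"
      hence "\<rho> div ?D = \<rho>' div ?D" using div inj by (auto simp: inj_on_def)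
      moreover have "inj_on (word_of d n) {..<?D}" using bij_betw_word_of[OF dn(1)] by (simp add: bij_betw_def)
      hence "\<rho> mod ?D = \<rho>' mod ?D" using \<rho> div by (auto simp: inj_on_def)
      ultimately show "\<rho> = \<rho>'" by (metis div_mult_mod_eq)
    qed
    hence "distinct (map fst ?rows)"
      by (simp add: distinct_map comp_def lessThan_atLeast0)
    moreover have "set (map fst ?rows) = schur_labels d n \<times> words d n"
    proof
      show "set (map fst ?rows) \<subseteq> schur_labels d n \<times> words d n"
        using div word_of_words[OF dn(1)] S by (auto simp: S_def)
      show "schur_labels d n \<times> words d n \<subseteq> set (map fst ?rows)"
      proof clarify
        fix l i j e assume "(l, i, j) \<in> schur_labels d n" "e \<in> words d n"
        moreover from this obtain s where "s < ?D" "(l, i, j) = label s" using S by (auto simp: S_def)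
        ultimately obtain s a where sa: "s < ?D" "(l, i, j) = label s" "a < ?D" "e = word_of d n a"
          using words_word_of[OF dn(1)] by metis
        have "s * ?D + a < s * ?D + ?D" using sa by simp
        also have "\<dots> = (s + 1) * ?D" by simp
        also have "\<dots> \<le> ?D * ?D" using sa(1) by (intro mult_right_mono) auto
        finally have less: "s * ?D + a < ?D * ?D" .
        have "(s * ?D + a) div ?D = s" "(s * ?D + a) mod ?D = a" using sa(3) D by simp_all
        hence eq: "fst (?row (s * ?D + a)) = ((l, i, j), e)" using sa by simp
        have "fst (?row (s * ?D + a)) \<in> fst ` (?row ` set [0..<?D * ?D])"
          by (intro imageI) (use less in simp)
        thus "((l, i, j), e) \<in> set (map fst ?rows)" unfolding eq list.set_map .
      qed
    qed
    moreover have "\<forall>((s, e), c)\<in>set ?rows. algebraic_code c (B s e)"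
      using code div by auto
    ultimately show ?thesis unfolding encodes_family_def by blast
  qed
  show ?thesis using enc sb ob orbit unfolding S by blast
qed

lemma schur_check_complete:
  assumes dn: "d > 0" "n > 0"
  shows "\<exists>t. schur_check d n t"
proof -
  let ?D = "d ^ n"
  obtain a :: "nat list \<Rightarrow> nat \<Rightarrow> nat list \<Rightarrow> int" and b :: "nat list \<Rightarrow> nat \<Rightarrow> (nat \<Rightarrow> nat) \<Rightarrow> int" where
    data: "schur_data d n (schur_labels d n) (\<lambda>l i. \<Sum>e\<in>words d n. cscale (of_int (a l i e)) (ket e))
       (\<lambda>l j. \<Sum>\<pi>\<in>symgrp n. cscale (of_int (b l j \<pi>)) (gdelta \<pi>))"
    and cont: "\<And>l i. i < cfun.dim (Q_irrep d n l) \<Longrightarrow> \<exists>k. \<forall>e\<in>words d n. a l i e \<noteq> 0 \<longrightarrow> mset e = k"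
    by (rule schur_data_exists[of d n]) blast
  define X where "X l i = (\<Sum>e\<in>words d n. cscale (of_int (a l i e)) (ket e))" for l i
  define Y where "Y l j = (\<Sum>\<pi>\<in>symgrp n. cscale (of_int (b l j \<pi>)) (gdelta \<pi>))" for l j
  have data: "schur_data d n (schur_labels d n) X Y"
    using data by (simp only: X_def[abs_def] Y_def[abs_def])
  note dest = schur_dataD[OF data]
  \<comment> \<open>The records may be listed in any order.\<close>
  obtain f where f: "bij_betw f {..<?D} (schur_labels d n)"
    using ex_bij_betw_nat_finite[OF dest(1)] dest(2) by (auto simp: lessThan_atLeast0)
  define xc where "xc l i = list_encode (map (\<lambda>k. int_encode (a l i (word_of d n k))) [0..<?D])" for l i
  define yc where "yc l j = list_encode (map (\<lambda>k. int_encode (b l j (perm_of n k))) [0..<n ^ n])" for l j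
  define rc where "rc = (\<lambda>(l, i, j). pair (list_encode l) (pair i (pair j (pair (xc l i) (yc l j)))))"
  define sg where "sg = list_encode (map (\<lambda>k. int_encode (sign (perm_of n k))) [0..<n ^ n])"
  define t where "t = pair sg (list_encode (map (\<lambda>s. rc (f s)) [0..<?D]))"
  have fields: "rec_l t s = list_encode l" "rec_i t s = i" "rec_j t s = j" "rec_x t s = xc l i" "rec_y t s = yc l j"
    if "s < ?D" "f s = (l, i, j)" for s l i j
    using that by (simp_all add: t_def rec_l_def rec_i_def rec_j_def rec_x_def rec_y_def rc_def)
  have xe: "int_entry (xc l i) k = a l i (word_of d n k)" if "k < ?D" for l i k
    using that by (simp add: int_entry_def xc_def)
  have ye: "int_entry (yc l j) k = b l j (perm_of n k)" if "k < n ^ n" for l j k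
    using that by (simp add: int_entry_def yc_def)
  have se: "int_entry sg k = sign (perm_of n k)" if "k < n ^ n" for k
    using that by (simp add: int_entry_def sg_def)
  have less: "base_sum n n \<pi> < n ^ n" if "\<pi> \<in> symgrp n" for \<pi>
    using that by (intro base_sum_less) simp
  have sgt: "is_sign_table n sg"
    unfolding is_sign_table_def
  proof (intro conjI allI impI)
    have "base_sum n n (\<lambda>k. k) = base_sum n n id" by (rule base_sum_cong) simp
    thus "int_entry sg (base_sum n n (\<lambda>k. k)) = 1"
      using se[OF less[OF symgrp_id]] perm_of_base_sum[OF dn(2) symgrp_id] by (simp add: sign_id)
  next
    fix k i j assume k: "k < n ^ n" "is_perm n k" and ij: "i < n" "j < i"
    let ?\<pi> = "perm_of n k"
    have \<pi>: "?\<pi> \<in> symgrp n" using k perm_of_symgrp[OF dn(2)] by simp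
    have \<tau>: "transpose i j \<circ> ?\<pi> \<in> symgrp n" using ij \<pi> by (intro symgrp_comp symgrp_transpose) auto
    have "base_sum n n (\<lambda>m. if digit n k m = i then j else if digit n k m = j then i else digit n k m) =
        base_sum n n (transpose i j \<circ> ?\<pi>)"
      by (rule base_sum_cong) (simp add: perm_of_def transpose_def)
    moreover have "int_entry sg (base_sum n n (transpose i j \<circ> ?\<pi>)) = sign (transpose i j \<circ> ?\<pi>)"
      using se[OF less[OF \<tau>]] perm_of_base_sum[OF dn(2) \<tau>] by simp
    moreover have "sign (transpose i j \<circ> ?\<pi>) = - sign ?\<pi>"
      using symgrp_permutation[OF \<pi>] ij by (simp add: sign_compose permutation_swap_id sign_swap_id)
    ultimately show "int_entry sg (base_sum n n (\<lambda>m. if digit n k m = i then j else if digit n k m = j then i else digit n k m)) =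
        - int_entry sg k" using se[OF k(1)] by simp
  qed
  have Xc: "coded_tensor d n (xc l i) = X l i" for l i
  proof
    fix e
    show "coded_tensor d n (xc l i) e = X l i e"
    proof (cases "e \<in> words d n")
      case True
      obtain k where k: "k < ?D" "e = word_of d n k" by (rule words_word_of[OF dn(1) True])
      have "X l i e = (\<Sum>e'\<in>words d n. if e' = e then of_int (a l i e) else 0)"
        unfolding X_def fun_sum_apply by (intro sum.cong refl) (simp add: ket_def)
      also have "\<dots> = of_int (a l i e)" using True by simp
      finally show ?thesis using True k xe by (simp add: coded_tensor_def base_sum_word_of)
    next
      case False
      hence "X l i e = 0" unfolding X_def fun_sum_apply by (intro sum.neutral) (auto simp: ket_def)
      thus ?thesis using False by (simp add: coded_tensor_def)
    qed
  qed
  have Yc: "coded_galg n (yc l j) = Y l j" for l j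
  proof
    fix \<pi>
    show "coded_galg n (yc l j) \<pi> = Y l j \<pi>"
    proof (cases "\<pi> \<in> symgrp n")
      case True
      have "Y l j \<pi> = (\<Sum>\<sigma>\<in>symgrp n. if \<sigma> = \<pi> then of_int (b l j \<pi>) else 0)"
        unfolding Y_def fun_sum_apply by (intro sum.cong refl) (simp add: gdelta_def)
      also have "\<dots> = of_int (b l j \<pi>)" using True by simp
      finally show ?thesis using True ye[OF less[OF True]] perm_of_base_sum[OF dn(2) True] by (simp add: coded_galg_def)
    next
      case False
      hence "Y l j \<pi> = 0" unfolding Y_def fun_sum_apply by (intro sum.neutral) (auto simp: gdelta_def)
      thus ?thesis using False by (simp add: coded_galg_def)
    qed
  qed
  have fS: "f s \<in> schur_labels d n" if "s < ?D" for s using f that by (auto simp: bij_betw_def)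
  have Sf: "\<exists>s<?D. f s = x" if "x \<in> schur_labels d n" for x using f that unfolding bij_betw_def by (metis imageE lessThan_iff)
  have val: "young_vec d n X Y (f s) (word_of d n k) = of_int (rec_value d n t s k)" if s: "s < ?D" "k < ?D" for s k
  proof -
    obtain l i j where fs: "f s = (l, i, j)" by (cases "f s")
    have "l \<in> partitions_upto d n" using dest(3) fS[OF s(1)] fs by simp
    hence "shape n (list_decode (list_encode l))" by (simp add: partitions_upto_shape)
    from young_value[OF dn sgt this s(2), of "yc l j" "xc l i"]
    show ?thesis
      using fields[OF s(1) fs] by (simp add: young_vec_def fs rec_value_def Xc Yc) (simp add: t_def)
  qed
  have inner: "inner_on (words d n) (young_vec d n X Y (f s)) (young_vec d n X Y (f s')) =
      of_int (\<Sum>k<?D. rec_value d n t s k * rec_value d n t s' k)" if "s < ?D" "s' < ?D" for s s'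
    unfolding inner_on_def sum_words[OF dn(1)] of_int_sum
    by (intro sum.cong refl) (simp add: val that)
  have neq: "f s \<noteq> f s'" if "s < ?D" "s' < ?D" "s \<noteq> s'" for s s'
    using f that by (auto simp: bij_betw_def inj_on_def)
  have "schur_check d n t"
    unfolding schur_check_def
  proof (intro conjI)
    show "is_sign_table n (pfst t)" using sgt by (simp add: t_def)
    show "\<forall>s<?D. is_partition_code d n (rec_l t s)"
    proof (intro allI impI)
      fix s assume s: "s < ?D"
      obtain l i j where fs: "f s = (l, i, j)" by (cases "f s")
      show "is_partition_code d n (rec_l t s)"
        using fields(1)[OF s fs] dest(3) fS[OF s] fs by (simp add: is_partition_code)
    qed
    show "\<forall>s<?D. rec_i t s \<noteq> 0 \<longrightarrow>
      (\<exists>s'<?D. rec_l t s' = rec_l t s \<and> Suc (rec_i t s') = rec_i t s \<and> rec_j t s' = rec_j t s)"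
    proof (intro allI impI)
      fix s assume s: "s < ?D" "rec_i t s \<noteq> 0"
      obtain l i j where fs: "f s = (l, i, j)" by (cases "f s")
      obtain i' where i': "i = Suc i'" using s fields(2)[OF s(1) fs] by (cases i) auto
      have "(l, i', j) \<in> schur_labels d n" using dest(5)[of l i' j] fS[OF s(1)] fs i' by simp
      then obtain s' where s': "s' < ?D" "f s' = (l, i', j)" using Sf by blast
      show "\<exists>s'<?D. rec_l t s' = rec_l t s \<and> Suc (rec_i t s') = rec_i t s \<and> rec_j t s' = rec_j t s"
        using s' fields[OF s(1) fs] fields[OF s'] i' by (intro exI[of _ s']) simp
    qed
    show "\<forall>s<?D. rec_j t s \<noteq> 0 \<longrightarrow>
      (\<exists>s'<?D. rec_l t s' = rec_l t s \<and> rec_i t s' = rec_i t s \<and> Suc (rec_j t s') = rec_j t s)"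
    proof (intro allI impI)
      fix s assume s: "s < ?D" "rec_j t s \<noteq> 0"
      obtain l i j where fs: "f s = (l, i, j)" by (cases "f s")
      obtain j' where j': "j = Suc j'" using s fields(3)[OF s(1) fs] by (cases j) auto
      have "(l, i, j') \<in> schur_labels d n" using dest(6)[of l i j'] fS[OF s(1)] fs j' by simp
      then obtain s' where s': "s' < ?D" "f s' = (l, i, j')" using Sf by blast
      show "\<exists>s'<?D. rec_l t s' = rec_l t s \<and> rec_i t s' = rec_i t s \<and> Suc (rec_j t s') = rec_j t s"
        using s' fields[OF s(1) fs] fields[OF s'] j' by (intro exI[of _ s']) simp
    qed
    show "\<forall>s<?D. \<forall>s'<?D. rec_l t s' = rec_l t s \<longrightarrow>
      (\<exists>r<?D. rec_l t r = rec_l t s \<and> rec_i t r = rec_i t s \<and> rec_j t r = rec_j t s')"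
    proof (intro allI impI)
      fix s s' assume s: "s < ?D" "s' < ?D" "rec_l t s' = rec_l t s"
      obtain l i j where fs: "f s = (l, i, j)" by (cases "f s")
      obtain l' i' j' where fs': "f s' = (l', i', j')" by (cases "f s'")
      have "l' = l" using s(3) fields(1)[OF s(1) fs] fields(1)[OF s(2) fs'] by (metis list_encode_inverse)
      hence "(l, i, j') \<in> schur_labels d n" using dest(7)[of l i j i' j'] fS[OF s(1)] fS[OF s(2)] fs fs' by simp
      then obtain r where r: "r < ?D" "f r = (l, i, j')" using Sf by blast
      show "\<exists>r<?D. rec_l t r = rec_l t s \<and> rec_i t r = rec_i t s \<and> rec_j t r = rec_j t s'"
        using r fields[OF s(1) fs] fields[OF s(2) fs'] fields[OF r] by (intro exI[of _ r]) simp
    qed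
    show "\<forall>s<?D. \<forall>s'<?D. rec_l t s' = rec_l t s \<longrightarrow> rec_i t s' = rec_i t s \<longrightarrow> rec_x t s' = rec_x t s"
    proof (intro allI impI)
      fix s s' assume s: "s < ?D" "s' < ?D" "rec_l t s' = rec_l t s" "rec_i t s' = rec_i t s"
      obtain l i j where fs: "f s = (l, i, j)" by (cases "f s")
      obtain l' i' j' where fs': "f s' = (l', i', j')" by (cases "f s'")
      have "l' = l" using s(3) fields(1)[OF s(1) fs] fields(1)[OF s(2) fs'] by (metis list_encode_inverse)
      thus "rec_x t s' = rec_x t s" using s fields[OF s(1) fs] fields[OF s(2) fs'] by simp
    qed
    show "\<forall>s<?D. \<forall>s'<?D. rec_l t s' = rec_l t s \<longrightarrow> rec_j t s' = rec_j t s \<longrightarrow> rec_y t s' = rec_y t s"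
    proof (intro allI impI)
      fix s s' assume s: "s < ?D" "s' < ?D" "rec_l t s' = rec_l t s" "rec_j t s' = rec_j t s"
      obtain l i j where fs: "f s = (l, i, j)" by (cases "f s")
      obtain l' i' j' where fs': "f s' = (l', i', j')" by (cases "f s'")
      have "l' = l" using s(3) fields(1)[OF s(1) fs] fields(1)[OF s(2) fs'] by (metis list_encode_inverse)
      thus "rec_y t s' = rec_y t s" using s fields[OF s(1) fs] fields[OF s(2) fs'] by simp
    qed
    show "\<forall>s<?D. \<exists>k<?D. rec_value d n t s k \<noteq> 0"
    proof (intro allI impI)
      fix s assume s: "s < ?D"
      show "\<exists>k<?D. rec_value d n t s k \<noteq> 0"
      proof (rule ccontr)
        assume "\<not> ?thesis"
        hence "inner_on (words d n) (young_vec d n X Y (f s)) (young_vec d n X Y (f s)) = 0"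
          unfolding inner[OF s s] by simp
        moreover have "young_vec d n X Y (f s) \<in> tensor_space d n" by (cases "f s") (simp add: young_vec_def)
        ultimately show False using tensor_inner_eq_0 dest(8)[OF fS[OF s]] by blast
      qed
    qed
    show "\<forall>s<?D. \<forall>s'<s. \<not> (rec_l t s' = rec_l t s \<and> rec_i t s' = rec_i t s \<and> rec_j t s' = rec_j t s)"
    proof (intro allI impI notI)
      fix s s' assume s: "s < ?D" "s' < s" "rec_l t s' = rec_l t s \<and> rec_i t s' = rec_i t s \<and> rec_j t s' = rec_j t s"
      obtain l i j where fs: "f s = (l, i, j)" by (cases "f s")
      obtain l' i' j' where fs': "f s' = (l', i', j')" by (cases "f s'")
      have s': "s' < ?D" using s by simp
      have "l' = l" using s(3) fields(1)[OF s(1) fs] fields(1)[OF s' fs'] by (metis list_encode_inverse)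
      hence "f s' = f s" using s(3) fields[OF s(1) fs] fields[OF s' fs'] fs fs' by simp
      thus False using neq[of s' s] s s' by simp
    qed
    show "\<forall>s<?D. \<forall>s'<s. (\<Sum>k<?D. rec_value d n t s k * rec_value d n t s' k) = 0"
    proof (intro allI impI)
      fix s s' assume s: "s < ?D" "s' < s"
      hence s': "s' < ?D" by simp
      have "inner_on (words d n) (young_vec d n X Y (f s)) (young_vec d n X Y (f s')) = 0"
        using s s' by (intro dest(9) fS neq) auto
      thus "(\<Sum>k<?D. rec_value d n t s k * rec_value d n t s' k) = 0"
        unfolding inner[OF s(1) s'] of_int_eq_0_iff .
    qed
    show "\<forall>s<?D. \<forall>k<?D. \<forall>k'<?D. int_entry (rec_x t s) k \<noteq> 0 \<longrightarrow> int_entry (rec_x t s) k' \<noteq> 0 \<longrightarrow>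
      (\<forall>z<d. letter_count d n k z = letter_count d n k' z)"
    proof (intro allI impI)
      fix s k k' z assume s: "s < ?D" and k: "k < ?D" "k' < ?D"
        "int_entry (rec_x t s) k \<noteq> 0" "int_entry (rec_x t s) k' \<noteq> 0"
      obtain l i j where fs: "f s = (l, i, j)" by (cases "f s")
      have "i < cfun.dim (Q_irrep d n l)" using fS[OF s] fs by (simp add: schur_labels_def)
      then obtain m where "\<forall>e\<in>words d n. a l i e \<noteq> 0 \<longrightarrow> mset e = m" using cont by blast
      moreover have "a l i (word_of d n k) \<noteq> 0" "a l i (word_of d n k') \<noteq> 0"
        using k fields(4)[OF s fs] xe by simp_all
      ultimately have "mset (word_of d n k) = m" "mset (word_of d n k') = m"
        using k word_of_words[OF dn(1)] by blast+
      thus "letter_count d n k z = letter_count d n k' z" by (simp add: letter_count)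
    qed
  qed
  thus ?thesis by blast
qed

theorem theorem2:
  "\<exists>A :: recf. \<forall>d n :: nat. d \<ge> 1 \<longrightarrow> n \<ge> 1 \<longrightarrow>
     (\<exists>out B. computes A [d, n] out \<and> encodes_family d n out B \<and>
        schur_basis d n B \<and> orthonormal_basis d n (schur_labels d n) B \<and>
        (\<forall>s \<in> schur_labels d n. \<exists>v \<in> words d n.
           B s \<in> cfun.span {perm_op d n \<pi> (ket v) | \<pi>. \<pi> \<in> symgrp n}))"
proof -
  \<comment> \<open>The algorithm is fixed before \<open>d\<close> and \<open>n\<close>;
    completeness of the check makes it halt and soundness makes its output correct.\<close>
  obtain A where A: "\<And>d n. \<exists>t. schur_check d n t \<Longrightarrow>
      \<exists>t. schur_check d n t \<and> computes A [d, n] (schur_output d n t)"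
    using search_computable[OF decidable_schur_check computable_schur_output] by blast
  show ?thesis
  proof (intro exI[of _ A] allI impI)
    fix d n :: nat assume "d \<ge> 1" "n \<ge> 1"
    hence dn: "d > 0" "n > 0" by simp_all
    obtain t where t: "schur_check d n t" "computes A [d, n] (schur_output d n t)"
      using A[OF schur_check_complete[OF dn]] by blast
    from schur_check_sound[OF dn t(1)] t(2)
    show "\<exists>out B. computes A [d, n] out \<and> encodes_family d n out B \<and>
        schur_basis d n B \<and> orthonormal_basis d n (schur_labels d n) B \<and>
        (\<forall>s \<in> schur_labels d n. \<exists>v \<in> words d n.
           B s \<in> cfun.span {perm_op d n \<pi> (ket v) | \<pi>. \<pi> \<in> symgrp n})"
      by blast
  qed
qed

end
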